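(* Let $P$ be a subsemigroup of a countable discrete group $G$. If $G_0\curvearrowright\partial\Omega_P$ is topologically free, then the boundary quotient $\partial C^*_\lambda(P)$ is simple.
   Context: $S = I_l(P)$ is the inverse semigroup of partial bijections of $P$ generated by the maps $p : P \to pP$, $x\mapsto px$ ($p \in P$), together with the empty map $0$. Its semilattice of idempotents $E$ is identified with the set $\mathcal{J} = \{p_1^{-1}q_1\cdots p_n^{-1}q_nP : p_i,q_i\in P\}\cup\{\emptyset\}$ of constructible right ideals of $P$ under intersection (here $qX=\{qx : x\in X\}$, $p^{-1}X = \{y \in P : py\in X\}$). Put $S^\times = S\setminus\{0\}$; for $s \in S^\times$ there is a unique $\sigma(s)\in G$ with $s(x) = \sigma(s)x$ for all $x$ in the domain of $s$. $\widehat{E}$ is the space of non-zero maps $\chi : \mathcal{J}\to\{0,1\}$ with $\chi(X\cap Y) = \chi(X)\chi(Y)$ and $\chi(\emptyset) = 0$, with the topology of pointwise convergence. $G$ acts partially on $\widehat{E}$: $g\in G$ has domain $U_{g^{-1}} = \{\chi : \chi(\mathrm{dom}(s)) = 1 \text{ for some } s\in S^\times \text{ with } \sigma(s) = g\}$, and $(g.\chi)(X) = \chi(s^{-1}(X\cap\mathrm{im}(s)))$ for such $s$. $\widehat{E}_{\max}$ is the set of $\chi\in\widehat{E}$ for which $\{X\in\mathcal{J} : \chi(X)=1\}$ is maximal (with respect to inclusion), and $\partial\Omega_P := \partial\widehat{E} := \overline{\widehat{E}_{\max}}$, which is a closed $G$-invariant subspace of $\widehat{E}$; $G\curvearrowright\partial\Omega_P$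 is the restricted partial action, with domains $U_{g^{-1}}\cap\partial\Omega_P$. $G_0 = \{g\in G : X\cap gP\neq\emptyset\neq X\cap g^{-1}P \text{ for all } \emptyset\neq X\in\mathcal{J}\}$; this is a subgroup of $G$, acting partially on $\partial\Omega_P$ by restriction. A partial action of a group $\Gamma$ on $Y$ with domains $U_{g^{-1}}$ is topologically free if for every $e\neq g\in\Gamma$, $\{y\in U_{g^{-1}} : g.y\neq y\}$ is dense in $U_{g^{-1}}$. $\partial C^*_\lambda(P) := C(\partial\Omega_P)\rtimes_r G$. For a partial action of $G$ on $Y$ with homeomorphisms $U_{g^{-1}}\to U_g$, the reduced partial crossed product $C_0(Y)\rtimes_r G$ is the completion of the $*$-algebra of finite sums $\sum_g f_g\delta_g$, $f_g\in C_0(U_g)$, with $(f\delta_g)(f'\delta_h) = \alpha^*_g(\alpha^*_{g^{-1}}(f)f')\delta_{gh}$, $(f\delta_g)^* = \alpha^*_{g^{-1}}(\overline{f})\delta_{g^{-1}}$, $\alpha^*_g(f) = f(g^{-1}.\,\cdot\,)$, in the norm $\sup_{y\in Y}\|\rho_y(\cdot)\|$, where with $G_y = \{g : y\in U_{g^{-1}}\}$, $\rho_y$ acts on $\ell^2(G_y)$ by $\rho_y(f\delta_g)\delta_h = f(gh.y)\delta_{gh}$ if $gh\in G_y$ and $0$ otherwise. *)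

theory Defs
  imports "HOL-Analysis.Analysis" "HOL-Algebra.Coset"
begin

section \<open>Square-summable families\<close>

abbreviation square_summable :: "('i \<Rightarrow> complex) \<Rightarrow> bool" where
  "square_summable f \<equiv> (\<lambda>i. (norm (f i))\<^sup>2) summable_on UNIV"

lemma square_summable_add:
  assumes "square_summable f" "square_summable g"
  shows "square_summable (\<lambda>i. f i + g i)"
proof (rule summable_on_comparison_test)
  show "(\<lambda>i. 2 * (norm (f i))\<^sup>2 + 2 * (norm (g i))\<^sup>2) summable_on UNIV"
    using assms by (intro summable_on_add summable_on_cmult_right)
  fix i
  have "(norm (f i + g i))\<^sup>2 \<le> (norm (f i) + norm (g i))\<^sup>2"
    by (simp add: norm_triangle_ineq)
  also have "\<dots> \<le> 2 * (norm (f i))\<^sup>2 + 2 * (norm (g i))\<^sup>2"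
    using sum_squares_bound[of "norm (f i)" "norm (g i)"] by (simp add: power2_sum)
  finally show "(norm (f i + g i))\<^sup>2 \<le> 2 * (norm (f i))\<^sup>2 + 2 * (norm (g i))\<^sup>2" .
qed auto

lemma square_summable_cmult:
  "square_summable f \<Longrightarrow> square_summable (\<lambda>i. c * f i)"
  by (simp add: norm_mult power_mult_distrib summable_on_cmult_right)

lemma square_summable_uminus: "square_summable f \<Longrightarrow> square_summable (\<lambda>i. - f i)"
  by simp

lemma square_summable_diff:
  assumes "square_summable f" "square_summable g"
  shows "square_summable (\<lambda>i. f i - g i)"
  using square_summable_add[OF assms(1) square_summable_uminus[OF assms(2)]] by simp

lemma square_summable_inner:
  assumes "square_summable f" "square_summable g"
  shows "(\<lambda>i. inner (f i) (g i)) summable_on UNIV"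
proof (rule abs_summable_summable, rule summable_on_comparison_test)
  show "(\<lambda>i. (norm (f i))\<^sup>2 + (norm (g i))\<^sup>2) summable_on UNIV"
    using assms by (intro summable_on_add)
  fix i
  have "\<bar>inner (f i) (g i)\<bar> \<le> norm (f i) * norm (g i)"
    by (rule Cauchy_Schwarz_ineq2)
  also have "\<dots> \<le> (norm (f i))\<^sup>2 + (norm (g i))\<^sup>2"
    using sum_squares_bound[of "norm (f i)" "norm (g i)"]
      mult_nonneg_nonneg[OF norm_ge_zero norm_ge_zero, of "f i" "g i"] by linarith
  finally show "norm (inner (f i) (g i)) \<le> (norm (f i))\<^sup>2 + (norm (g i))\<^sup>2" by simp
qed auto

typedef 'i ell2 = "{f :: 'i \<Rightarrow> complex. square_summable f}"
  by (rule exI[of _ "\<lambda>_. 0"]) simp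

setup_lifting type_definition_ell2

instantiation ell2 :: (type) real_inner
begin

lift_definition zero_ell2 :: "'a ell2" is "\<lambda>_. 0" by simp
lift_definition plus_ell2 :: "'a ell2 \<Rightarrow> 'a ell2 \<Rightarrow> 'a ell2" is "\<lambda>f g i. f i + g i"
  by (rule square_summable_add)
lift_definition minus_ell2 :: "'a ell2 \<Rightarrow> 'a ell2 \<Rightarrow> 'a ell2" is "\<lambda>f g i. f i - g i"
  by (rule square_summable_diff)
lift_definition uminus_ell2 :: "'a ell2 \<Rightarrow> 'a ell2" is "\<lambda>f i. - f i"
  by simp
lift_definition scaleR_ell2 :: "real \<Rightarrow> 'a ell2 \<Rightarrow> 'a ell2" is "\<lambda>r f i. complex_of_real r * f i"
  by (rule square_summable_cmult)
text \<open>The real part of the usual complex inner product; it induces the usual norm.\<close>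
lift_definition inner_ell2 :: "'a ell2 \<Rightarrow> 'a ell2 \<Rightarrow> real" is
  "\<lambda>f g. \<Sum>\<^sub>\<infinity>i. inner (f i) (g i)" .
definition norm_ell2 :: "'a ell2 \<Rightarrow> real" where
  "norm_ell2 x = sqrt (inner x x)"
definition dist_ell2 :: "'a ell2 \<Rightarrow> 'a ell2 \<Rightarrow> real" where
  "dist_ell2 x y = norm (x - y)"
definition sgn_ell2 :: "'a ell2 \<Rightarrow> 'a ell2" where
  "sgn_ell2 x = inverse (norm x) *\<^sub>R x"
definition uniformity_ell2 :: "('a ell2 \<times> 'a ell2) filter" where
  "uniformity_ell2 = (INF e\<in>{0 <..}. principal {(x, y). dist x y < e})"
definition open_ell2 :: "'a ell2 set \<Rightarrow> bool" where
  "open_ell2 U \<longleftrightarrow> (\<forall>x\<in>U. \<forall>\<^sub>F (x', y) in uniformity. x' = x \<longrightarrow> y \<in> U)"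

instance
proof
  fix x y z :: "'a ell2" and r s :: real
  show "x + y + z = x + (y + z)" by transfer (simp add: add.assoc)
  show "x + y = y + x" by transfer (simp add: add.commute)
  show "0 + x = x" by transfer simp
  show "- x + x = 0" by transfer simp
  show "x - y = x + - y" by transfer simp
  show "r *\<^sub>R (x + y) = r *\<^sub>R x + r *\<^sub>R y" by transfer (simp add: distrib_left)
  show "(r + s) *\<^sub>R x = r *\<^sub>R x + s *\<^sub>R x" by transfer (simp add: distrib_right)
  show "r *\<^sub>R s *\<^sub>R x = (r * s) *\<^sub>R x" by transfer (simp add: mult.assoc)
  show "1 *\<^sub>R x = x" by transfer simp
  show "dist x y = norm (x - y)" by (rule dist_ell2_def)
  show "sgn x = inverse (norm x) *\<^sub>R x" by (rule sgn_ell2_def)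
  show "uniformity = (INF e\<in>{0 <..}. principal {(x, y). dist (x::'a ell2) y < e})"
    by (rule uniformity_ell2_def)
  show "open U \<longleftrightarrow> (\<forall>x\<in>U. \<forall>\<^sub>F (x', y) in uniformity. x' = x \<longrightarrow> y \<in> U)" for U :: "'a ell2 set"
    by (rule open_ell2_def)
  show "inner x y = inner y x" by transfer (simp add: inner_commute)
  show "inner (x + y) z = inner x z + inner y z"
    by transfer (simp add: inner_add_left infsum_add square_summable_inner)
  show "inner (r *\<^sub>R x) y = r * inner x y"
  proof transfer
    fix r :: real and f g :: "'a \<Rightarrow> complex"
    have "inner (complex_of_real r * f i) (g i) = r * inner (f i) (g i)" for i
      by (metis inner_scaleR_left scaleR_conv_of_real)
    then show "(\<Sum>\<^sub>\<infinity>i. inner (complex_of_real r * f i) (g i)) = r * (\<Sum>\<^sub>\<infinity>i. inner (f i) (g i))"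
      by (simp add: infsum_cmult_right')
  qed
  show "0 \<le> inner x x" by transfer (simp add: infsum_nonneg)
  show "inner x x = 0 \<longleftrightarrow> x = 0"
  proof transfer
    fix f :: "'a \<Rightarrow> complex" assume f: "square_summable f"
    have "f i = 0" if "(\<Sum>\<^sub>\<infinity>i. inner (f i) (f i)) = 0" for i
    proof -
      have "inner (f i) (f i) = 0"
        by (rule nonneg_infsum_le_0D[where A = UNIV])
          (use that square_summable_inner[OF f f] in \<open>simp_all only: inner_ge_zero order_refl UNIV_I\<close>)
      then show ?thesis by (simp only: inner_eq_zero_iff)
    qed
    then have "(\<Sum>\<^sub>\<infinity>i. inner (f i) (f i)) = 0 \<Longrightarrow> f = (\<lambda>_. 0)" by (rule ext)
    moreover have "f = (\<lambda>_. 0) \<Longrightarrow> (\<Sum>\<^sub>\<infinity>i. inner (f i) (f i)) = 0" by (simp only: inner_zero_left infsum_0_simp)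
    ultimately show "(\<Sum>\<^sub>\<infinity>i. inner (f i) (f i)) = 0 \<longleftrightarrow> f = (\<lambda>_. 0)" by (rule iffI)
  qed
  show "norm x = sqrt (inner x x)" by (rule norm_ell2_def)
qed

end

lemma ell2_eqI: "(\<And>i. Rep_ell2 x i = Rep_ell2 y i) \<Longrightarrow> x = y"
  by (simp add: Rep_ell2_inject[symmetric] fun_eq_iff)

lemma square_summable_Rep_ell2: "square_summable (Rep_ell2 x)"
  using Rep_ell2[of x] by simp

lemma Rep_Abs_ell2: "square_summable f \<Longrightarrow> Rep_ell2 (Abs_ell2 f) = f"
  by (simp add: Abs_ell2_inverse)

lemma norm_ell2_sq: "(norm x)\<^sup>2 = (\<Sum>\<^sub>\<infinity>i. (norm (Rep_ell2 x i))\<^sup>2)"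
  by (simp add: norm_ell2_def inner_ell2.rep_eq power2_norm_eq_inner infsum_nonneg)

lemma norm_ell2_finite_bound:
  assumes "finite F"
  shows "(\<Sum>i\<in>F. (norm (Rep_ell2 x i))\<^sup>2) \<le> (norm x)\<^sup>2"
  unfolding norm_ell2_sq using assms square_summable_Rep_ell2
  by (intro finite_sum_le_infsum) auto

lemma norm_Rep_ell2_le: "norm (Rep_ell2 x i) \<le> norm x"
  using norm_ell2_finite_bound[of "{i}" x] by (auto intro: power2_le_imp_le)

lemma norm_ell2_leI:
  assumes "0 \<le> c" "\<And>F. finite F \<Longrightarrow> (\<Sum>i\<in>F. (norm (Rep_ell2 x i))\<^sup>2) \<le> c\<^sup>2"
  shows "norm x \<le> c"
proof (rule power2_le_imp_le)
  show "(norm x)\<^sup>2 \<le> c\<^sup>2"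
    unfolding norm_ell2_sq
    using square_summable_Rep_ell2 assms(2) by (intro infsum_le_finite_sums) auto
qed (use assms in auto)

lemma square_summableI:
  assumes "\<And>F. finite F \<Longrightarrow> (\<Sum>i\<in>F. (norm (f i))\<^sup>2) \<le> c"
  shows "square_summable f"
  using assms by (intro nonneg_bdd_above_summable_on) (auto simp: bdd_above_def)

instance ell2 :: (type) complete_space
proof
  fix X :: "nat \<Rightarrow> 'a ell2" assume X: "Cauchy X"
  have "Cauchy (\<lambda>n. Rep_ell2 (X n) i)" for i
  proof (rule metric_CauchyI)
    fix e :: real assume "e > 0"
    then obtain N where "\<forall>m\<ge>N. \<forall>n\<ge>N. norm (X m - X n) < e"
      using X by (auto simp: Cauchy_def dist_norm)
    moreover have "dist (Rep_ell2 (X m) i) (Rep_ell2 (X n) i) \<le> norm (X m - X n)" for m n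
      using norm_Rep_ell2_le[of "X m - X n" i] by (simp add: minus_ell2.rep_eq dist_norm)
    ultimately have "\<forall>m\<ge>N. \<forall>n\<ge>N. dist (Rep_ell2 (X m) i) (Rep_ell2 (X n) i) < e"
      by (meson le_less_trans)
    then show "\<exists>M. \<forall>m\<ge>M. \<forall>n\<ge>M. dist (Rep_ell2 (X m) i) (Rep_ell2 (X n) i) < e" ..
  qed
  then have "\<forall>i. \<exists>l. (\<lambda>n. Rep_ell2 (X n) i) \<longlonglongrightarrow> l"
    by (simp add: Cauchy_convergent_iff convergent_def)
  then obtain f where f: "\<And>i. (\<lambda>n. Rep_ell2 (X n) i) \<longlonglongrightarrow> f i"
    by metis
  have key: "(\<Sum>i\<in>F. (norm (Rep_ell2 (X m) i - f i))\<^sup>2) \<le> e\<^sup>2"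
    if N: "\<forall>m\<ge>N. \<forall>n\<ge>N. norm (X m - X n) < e" and "m \<ge> N" "finite F" for N m e F
  proof (rule LIMSEQ_le_const2)
    show "(\<lambda>n. \<Sum>i\<in>F. (norm (Rep_ell2 (X m) i - Rep_ell2 (X n) i))\<^sup>2)
            \<longlonglongrightarrow> (\<Sum>i\<in>F. (norm (Rep_ell2 (X m) i - f i))\<^sup>2)"
      by (intro tendsto_intros f)
    have "(\<Sum>i\<in>F. (norm (Rep_ell2 (X m) i - Rep_ell2 (X n) i))\<^sup>2) \<le> e\<^sup>2" if "n \<ge> N" for n
    proof -
      have "(\<Sum>i\<in>F. (norm (Rep_ell2 (X m) i - Rep_ell2 (X n) i))\<^sup>2) \<le> (norm (X m - X n))\<^sup>2"
        using norm_ell2_finite_bound[of F "X m - X n"] \<open>finite F\<close> by (simp add: minus_ell2.rep_eq)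
      also have "\<dots> \<le> e\<^sup>2"
        using N \<open>m \<ge> N\<close> that by (intro power_mono) (auto intro: less_imp_le)
      finally show ?thesis .
    qed
    then show "\<exists>N. \<forall>n\<ge>N. (\<Sum>i\<in>F. (norm (Rep_ell2 (X m) i - Rep_ell2 (X n) i))\<^sup>2) \<le> e\<^sup>2"
      by blast
  qed
  obtain N where "\<forall>m\<ge>N. \<forall>n\<ge>N. norm (X m - X n) < 1"
    using X zero_less_one unfolding Cauchy_def dist_norm by blast
  then have "square_summable (\<lambda>i. Rep_ell2 (X N) i - f i)"
    using key by (intro square_summableI[where c = "1\<^sup>2"]) blast
  then have f_sum: "square_summable f"
    using square_summable_diff[OF square_summable_Rep_ell2[of "X N"], of "\<lambda>i. Rep_ell2 (X N) i - f i"]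
    by simp
  have "X \<longlonglongrightarrow> Abs_ell2 f"
  proof (rule metric_LIMSEQ_I)
    fix e :: real assume "e > 0"
    then have "e / 2 > 0" by simp
    then obtain N where N: "\<forall>m\<ge>N. \<forall>n\<ge>N. norm (X m - X n) < e / 2"
      using X unfolding Cauchy_def dist_norm by blast
    have "norm (X m - Abs_ell2 f) \<le> e / 2" if "m \<ge> N" for m
      using key[OF N that] \<open>e > 0\<close>
      by (intro norm_ell2_leI) (auto simp: minus_ell2.rep_eq Rep_Abs_ell2[OF f_sum])
    then have "\<forall>m\<ge>N. dist (X m) (Abs_ell2 f) < e"
      using \<open>e > 0\<close> by (force simp: dist_norm)
    then show "\<exists>N. \<forall>m\<ge>N. dist (X m) (Abs_ell2 f) < e" ..
  qed
  then show "convergent X" by (auto simp: convergent_def)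
qed

instance ell2 :: (type) banach ..

lift_definition scaleC_ell2 :: "complex \<Rightarrow> 'i ell2 \<Rightarrow> 'i ell2" is "\<lambda>c f i. c * f i"
  by (rule square_summable_cmult)

text \<open>\<open>ell2_delta j\<close> is the basis vector at \<open>j\<close>.\<close>

lift_definition ell2_delta :: "'i \<Rightarrow> 'i ell2" is "\<lambda>j i. if i = j then 1 else 0"
proof (rule square_summableI)
  fix j :: 'i and F :: "'i set" assume "finite F"
  have "(\<Sum>i\<in>F. (norm (if i = j then 1 else 0 :: complex))\<^sup>2) = (\<Sum>i\<in>F. if i = j then 1 else 0)"
    by (rule sum.cong) auto
  also have "\<dots> \<le> (1 :: real)" using \<open>finite F\<close> by simp
  finally show "(\<Sum>i\<in>F. (norm (if i = j then 1 else 0 :: complex))\<^sup>2) \<le> 1" .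
qed

text \<open>Weighted composition operators.\<close>

definition wcomp :: "'i set \<Rightarrow> ('i \<Rightarrow> complex) \<Rightarrow> ('i \<Rightarrow> 'j) \<Rightarrow> 'j ell2 \<Rightarrow> 'i ell2" where
  "wcomp K w \<phi> \<xi> = Abs_ell2 (\<lambda>i. if i \<in> K then w i * Rep_ell2 \<xi> (\<phi> i) else 0)"

lemma wcomp_bound:
  assumes "inj_on \<phi> K" "\<And>i. i \<in> K \<Longrightarrow> norm (w i) \<le> M" "finite F"
  shows "(\<Sum>i\<in>F. (norm (if i \<in> K then w i * Rep_ell2 \<xi> (\<phi> i) else 0))\<^sup>2) \<le> (M * norm \<xi>)\<^sup>2"
proof -
  have "(\<Sum>i\<in>F. (norm (if i \<in> K then w i * Rep_ell2 \<xi> (\<phi> i) else 0))\<^sup>2)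
      = (\<Sum>i\<in>F \<inter> K. (norm (w i * Rep_ell2 \<xi> (\<phi> i)))\<^sup>2)"
    using assms(3) by (intro sum.mono_neutral_cong_right) auto
  also have "\<dots> \<le> (\<Sum>i\<in>F \<inter> K. M\<^sup>2 * (norm (Rep_ell2 \<xi> (\<phi> i)))\<^sup>2)"
    using assms(2) by (intro sum_mono) (auto simp: norm_mult power_mult_distrib intro!: mult_right_mono power_mono)
  also have "\<dots> = M\<^sup>2 * (\<Sum>j\<in>\<phi> ` (F \<inter> K). (norm (Rep_ell2 \<xi> j))\<^sup>2)"
    using assms(1) by (subst sum.reindex) (auto simp: sum_distrib_left inj_on_def)
  also have "\<dots> \<le> M\<^sup>2 * (norm \<xi>)\<^sup>2"
    using assms(3) by (intro mult_left_mono norm_ell2_finite_bound) auto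
  finally show ?thesis by (simp add: power_mult_distrib)
qed

lemma Rep_wcomp:
  assumes "inj_on \<phi> K" "\<And>i. i \<in> K \<Longrightarrow> norm (w i) \<le> M"
  shows "Rep_ell2 (wcomp K w \<phi> \<xi>) = (\<lambda>i. if i \<in> K then w i * Rep_ell2 \<xi> (\<phi> i) else 0)"
  unfolding wcomp_def
  by (rule Rep_Abs_ell2, rule square_summableI) (rule wcomp_bound[OF assms])

lemma bounded_linear_wcomp:
  assumes "inj_on \<phi> K" "\<And>i. i \<in> K \<Longrightarrow> norm (w i) \<le> M" "0 \<le> M"
  shows "bounded_linear (wcomp K w \<phi>)"
proof (rule bounded_linear_intro[where K = M])
  note R = Rep_wcomp[OF assms(1,2)]
  show "wcomp K w \<phi> (x + y) = wcomp K w \<phi> x + wcomp K w \<phi> y" for x y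
    by (rule ell2_eqI) (simp add: R plus_ell2.rep_eq distrib_left)
  show "wcomp K w \<phi> (r *\<^sub>R x) = r *\<^sub>R wcomp K w \<phi> x" for r x
    by (rule ell2_eqI) (simp add: R scaleR_ell2.rep_eq)
  show "norm (wcomp K w \<phi> x) \<le> norm x * M" for x
    using wcomp_bound[OF assms(1,2)] assms(3)
    by (intro norm_ell2_leI) (auto simp: R mult.commute)
qed

lemma Rep_ell2_sum: "Rep_ell2 (\<Sum>a\<in>A. x a) i = (\<Sum>a\<in>A. Rep_ell2 (x a) i)"
  by (induction A rule: infinite_finite_induct) (auto simp: zero_ell2.rep_eq plus_ell2.rep_eq)

text \<open>Inclusion and evaluation of one summand of a direct sum.\<close>

definition ell2_in :: "'j \<Rightarrow> 'i ell2 \<Rightarrow> ('j \<times> 'i) ell2" where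
  "ell2_in j = wcomp {i. fst i = j} (\<lambda>_. 1) snd"

definition ell2_ev :: "'j \<Rightarrow> ('j \<times> 'i) ell2 \<Rightarrow> 'i ell2" where
  "ell2_ev j = wcomp UNIV (\<lambda>_. 1) (Pair j)"

lemma wcomp_norm_le:
  assumes "inj_on \<phi> K"
  shows "norm (wcomp K (\<lambda>_. 1) \<phi> \<xi>) \<le> norm \<xi>"
  using wcomp_bound[OF assms, of "\<lambda>_. 1" 1 _ \<xi>]
  by (intro norm_ell2_leI) (simp_all add: Rep_wcomp[OF assms, of "\<lambda>_. 1" 1])

lemma ell2_in_props:
  shows bounded_linear_ell2_in: "bounded_linear (ell2_in j)"
    and norm_ell2_in: "norm (ell2_in j \<xi>) \<le> norm \<xi>"
    and Rep_ell2_in: "Rep_ell2 (ell2_in j \<xi>) (j', i) = (if j' = j then Rep_ell2 \<xi> i else 0)"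
proof -
  have inj: "inj_on snd {i. fst i = j}" by (auto simp: inj_on_def)
  show "bounded_linear (ell2_in j)" unfolding ell2_in_def
    by (rule bounded_linear_wcomp[OF inj, where M = 1]) auto
  show "norm (ell2_in j \<xi>) \<le> norm \<xi>" unfolding ell2_in_def by (rule wcomp_norm_le[OF inj])
  show "Rep_ell2 (ell2_in j \<xi>) (j', i) = (if j' = j then Rep_ell2 \<xi> i else 0)"
    unfolding ell2_in_def by (subst Rep_wcomp[OF inj, where M = 1]) auto
qed

lemma ell2_ev_props:
  shows bounded_linear_ell2_ev: "bounded_linear (ell2_ev j)"
    and norm_ell2_ev: "norm (ell2_ev j \<xi>) \<le> norm \<xi>"
    and Rep_ell2_ev: "Rep_ell2 (ell2_ev j \<xi>) i = Rep_ell2 \<xi> (j, i)"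
proof -
  have inj: "inj_on (Pair j) UNIV" by (auto simp: inj_on_def)
  show "bounded_linear (ell2_ev j)" unfolding ell2_ev_def
    by (rule bounded_linear_wcomp[OF inj, where M = 1]) auto
  show "norm (ell2_ev j \<xi>) \<le> norm \<xi>" unfolding ell2_ev_def by (rule wcomp_norm_le[OF inj])
  show "Rep_ell2 (ell2_ev j \<xi>) i = Rep_ell2 \<xi> (j, i)"
    unfolding ell2_ev_def by (subst Rep_wcomp[OF inj, where M = 1]) auto
qed

lemma sum_norm_ell2_ev:
  assumes "finite A"
  shows "(\<Sum>j\<in>A. (norm (ell2_ev j \<xi>))\<^sup>2) \<le> (norm \<xi>)\<^sup>2"
proof -
  let ?q = "\<lambda>i. (norm (Rep_ell2 \<xi> i))\<^sup>2"
  have s: "?q summable_on A \<times> UNIV"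
    by (rule summable_on_subset_banach[OF square_summable_Rep_ell2]) simp
  have "(\<Sum>j\<in>A. (norm (ell2_ev j \<xi>))\<^sup>2) = (\<Sum>\<^sub>\<infinity>j\<in>A. \<Sum>\<^sub>\<infinity>i. ?q (j, i))"
    using assms by (simp add: norm_ell2_sq Rep_ell2_ev)
  also have "\<dots> = infsum ?q (A \<times> UNIV)"
    using infsum_Sigma'_banach[of "\<lambda>j i. ?q (j, i)" A "\<lambda>_. UNIV"] s
    by (simp add: case_prod_unfold)
  also have "\<dots> \<le> (norm \<xi>)\<^sup>2"
    unfolding norm_ell2_sq by (rule infsum_mono2[OF s square_summable_Rep_ell2]) auto
  finally show ?thesis .
qed

lemma inner_wcomp:
  assumes \<phi>: "inj_on \<phi> K" and w: "\<And>i. i \<in> K \<Longrightarrow> norm (w i) \<le> M"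
    and L: "L = \<phi> ` K" and \<psi>: "\<And>i. i \<in> K \<Longrightarrow> \<psi> (\<phi> i) = i"
    and v: "\<And>i. i \<in> K \<Longrightarrow> v (\<phi> i) = cnj (w i)"
  shows "inner (wcomp K w \<phi> \<xi>) \<eta> = inner \<xi> (wcomp L v \<psi> \<eta>)"
proof -
  have \<psi>': "inj_on \<psi> L" using \<psi> by (auto simp: L inj_on_def)
  have v': "norm (v j) \<le> M" if "j \<in> L" for j using that v w by (auto simp: L)
  have R: "Rep_ell2 (wcomp K w \<phi> \<xi>) = (\<lambda>i. if i \<in> K then w i * Rep_ell2 \<xi> (\<phi> i) else 0)"
    using \<phi> w by (rule Rep_wcomp)
  have R': "Rep_ell2 (wcomp L v \<psi> \<eta>) = (\<lambda>i. if i \<in> L then v i * Rep_ell2 \<eta> (\<psi> i) else 0)"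
    using \<psi>' v' by (rule Rep_wcomp)
  have cnj: "inner (c * x) y = inner x (cnj c * y)" for c x y :: complex
    by (simp add: inner_complex_def algebra_simps)
  have "inner (wcomp K w \<phi> \<xi>) \<eta> = (\<Sum>\<^sub>\<infinity>i\<in>K. inner (w i * Rep_ell2 \<xi> (\<phi> i)) (Rep_ell2 \<eta> i))"
    unfolding inner_ell2.rep_eq R
    by (rule infsum_cong_neutral) auto
  also have "\<dots> = (\<Sum>\<^sub>\<infinity>i\<in>K. inner (Rep_ell2 \<xi> (\<phi> i)) (v (\<phi> i) * Rep_ell2 \<eta> (\<psi> (\<phi> i))))"
    by (rule infsum_cong) (simp add: cnj v \<psi>)
  also have "\<dots> = (\<Sum>\<^sub>\<infinity>j\<in>L. inner (Rep_ell2 \<xi> j) (v j * Rep_ell2 \<eta> (\<psi> j)))"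
    using infsum_reindex[OF \<phi>, of "\<lambda>j. inner (Rep_ell2 \<xi> j) (v j * Rep_ell2 \<eta> (\<psi> j))"]
    by (simp add: L o_def)
  also have "\<dots> = inner \<xi> (wcomp L v \<psi> \<eta>)"
    unfolding inner_ell2.rep_eq R'
    by (rule infsum_cong_neutral) auto
  finally show ?thesis .
qed

section \<open>Simplicity\<close>

definition scaleC_op :: "complex \<Rightarrow> ('i ell2 \<Rightarrow>\<^sub>L 'i ell2) \<Rightarrow> ('i ell2 \<Rightarrow>\<^sub>L 'i ell2)" where
  "scaleC_op c T = Blinfun (\<lambda>\<xi>. scaleC_ell2 c (blinfun_apply T \<xi>))"

lemma scaleC_op_apply: "blinfun_apply (scaleC_op c (T :: 'i ell2 \<Rightarrow>\<^sub>L 'i ell2)) \<xi> = scaleC_ell2 c (blinfun_apply T \<xi>)"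
proof -
  have *: "scaleC_ell2 c = wcomp UNIV (\<lambda>_. c) (id :: 'i \<Rightarrow> 'i)"
    by (rule ext) (simp add: scaleC_ell2_def wcomp_def)
  have "bounded_linear (scaleC_ell2 c :: 'i ell2 \<Rightarrow> 'i ell2)"
    unfolding * by (rule bounded_linear_wcomp[where M = "norm c"]) auto
  then have "bounded_linear (\<lambda>\<xi>. scaleC_ell2 c (blinfun_apply T \<xi>))"
    by (rule bounded_linear_compose) (rule blinfun.bounded_linear_right)
  then show ?thesis
    by (simp add: scaleC_op_def bounded_linear_Blinfun_apply)
qed

definition closed_two_sided_ideal ::
    "('i ell2 \<Rightarrow>\<^sub>L 'i ell2) set \<Rightarrow> ('i ell2 \<Rightarrow>\<^sub>L 'i ell2) set \<Rightarrow> bool" where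
  "closed_two_sided_ideal A I \<longleftrightarrow>
     I \<subseteq> A \<and> closed I \<and> 0 \<in> I \<and>
     (\<forall>S\<in>I. \<forall>T\<in>I. S + T \<in> I) \<and>
     (\<forall>c. \<forall>T\<in>I. scaleC_op c T \<in> I) \<and>
     (\<forall>S\<in>A. \<forall>T\<in>I. S o\<^sub>L T \<in> I \<and> T o\<^sub>L S \<in> I)"

definition simple_Cstar_algebra :: "('i ell2 \<Rightarrow>\<^sub>L 'i ell2) set \<Rightarrow> bool" where
  "simple_Cstar_algebra A \<longleftrightarrow>
     A \<noteq> {0} \<and> (\<forall>I. closed_two_sided_ideal A I \<longrightarrow> I = {0} \<or> I = A)"

section \<open>Partial actions and reduced partial crossed products\<close>

text \<open>
  A partial action of \<open>G\<close> on \<open>Y\<close> is given by \<open>D\<close> and \<open>act\<close>, where \<open>D g\<close> is the domain of \<open>g\<close>.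
  In the usual notation \<open>D g\<close> is \<open>U\<close> indexed by the inverse of \<open>g\<close>, so that the range of \<open>g\<close>
  is \<open>D (inv g)\<close>.
\<close>

definition topologically_free ::
    "('g, 'm) monoid_scheme \<Rightarrow> 'g set \<Rightarrow> ('g \<Rightarrow> 'y::topological_space set) \<Rightarrow> ('g \<Rightarrow> 'y \<Rightarrow> 'y) \<Rightarrow> bool"
  where
  "topologically_free G \<Gamma> D act \<longleftrightarrow>
     (\<forall>g\<in>\<Gamma>. g \<noteq> \<one>\<^bsub>G\<^esub> \<longrightarrow> D g \<subseteq> closure {y \<in> D g. act g y \<noteq> y})"

text \<open>Functions in \<open>C0 U\<close> are extended by zero outside \<open>U\<close>.\<close>

definition C0 :: "'y::topological_space set \<Rightarrow> ('y \<Rightarrow> complex) set" where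
  "C0 U = {f. continuous_on U f \<and> (\<forall>\<epsilon>>0. compact {y \<in> U. \<epsilon> \<le> norm (f y)}) \<and> (\<forall>y. y \<notin> U \<longrightarrow> f y = 0)}"

lemma C0_bounded:
  assumes "f \<in> C0 U"
  obtains M where "0 \<le> M" "\<And>y. norm (f y) \<le> M"
proof -
  let ?K = "{y \<in> U. 1 \<le> norm (f y)}"
  have "compact (f ` ?K)"
    using assms by (intro compact_continuous_image) (auto simp: C0_def intro: continuous_on_subset)
  then obtain B where B: "\<And>y. y \<in> ?K \<Longrightarrow> norm (f y) \<le> B"
    by (meson bounded_iff compact_imp_bounded imageI)
  have "norm (f y) \<le> max 1 B" for y
    using B[of y] assms by (cases "y \<in> ?K") (auto simp: C0_def le_max_iff_disj not_le)
  then show thesis using that[of "max 1 B"] by auto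
qed

definition pc_supp :: "('g \<Rightarrow> 'y \<Rightarrow> complex) \<Rightarrow> 'g set" where
  "pc_supp a = {g. a g \<noteq> (\<lambda>_. 0)}"

text \<open>The finite sum of the \<open>a g\<close> times delta at \<open>g\<close> is encoded as the function \<open>a\<close>.\<close>

definition pc_alg ::
    "('g, 'm) monoid_scheme \<Rightarrow> ('g \<Rightarrow> 'y::topological_space set) \<Rightarrow> ('g \<Rightarrow> 'y \<Rightarrow> complex) set" where
  "pc_alg G D = {a. finite (pc_supp a) \<and> pc_supp a \<subseteq> carrier G \<and>
                    (\<forall>g\<in>carrier G. a g \<in> C0 (D (inv\<^bsub>G\<^esub> g)))}"

definition pc_pull ::
    "('g, 'm) monoid_scheme \<Rightarrow> ('g \<Rightarrow> 'y set) \<Rightarrow> ('g \<Rightarrow> 'y \<Rightarrow> 'y) \<Rightarrow> 'g \<Rightarrow> ('y \<Rightarrow> complex) \<Rightarrow> 'y \<Rightarrow> complex"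
  where
  "pc_pull G D act g f y = (if y \<in> D (inv\<^bsub>G\<^esub> g) then f (act (inv\<^bsub>G\<^esub> g) y) else 0)"

definition pc_mult ::
    "('g, 'm) monoid_scheme \<Rightarrow> ('g \<Rightarrow> 'y set) \<Rightarrow> ('g \<Rightarrow> 'y \<Rightarrow> 'y) \<Rightarrow>
     ('g \<Rightarrow> 'y \<Rightarrow> complex) \<Rightarrow> ('g \<Rightarrow> 'y \<Rightarrow> complex) \<Rightarrow> 'g \<Rightarrow> 'y \<Rightarrow> complex" where
  "pc_mult G D act a b m y =
     (\<Sum>(g, h) \<in> {(g, h) \<in> pc_supp a \<times> pc_supp b. g \<otimes>\<^bsub>G\<^esub> h = m}.
        pc_pull G D act g (\<lambda>x. pc_pull G D act (inv\<^bsub>G\<^esub> g) (a g) x * b h x) y)"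

definition pc_star ::
    "('g, 'm) monoid_scheme \<Rightarrow> ('g \<Rightarrow> 'y set) \<Rightarrow> ('g \<Rightarrow> 'y \<Rightarrow> 'y) \<Rightarrow>
     ('g \<Rightarrow> 'y \<Rightarrow> complex) \<Rightarrow> 'g \<Rightarrow> 'y \<Rightarrow> complex" where
  "pc_star G D act a g =
     (if g \<in> carrier G then pc_pull G D act g (\<lambda>x. cnj (a (inv\<^bsub>G\<^esub> g) x)) else (\<lambda>_. 0))"

definition pc_fibre :: "('g, 'm) monoid_scheme \<Rightarrow> ('g \<Rightarrow> 'y set) \<Rightarrow> 'y \<Rightarrow> 'g set" where
  "pc_fibre G D y = {g \<in> carrier G. y \<in> D g}"

text \<open>
  The representation on the square-summable functions on \<open>pc_fibre G D y\<close>, on coefficients;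
  \<open>pc_rho_delta\<close> below gives its values on basis vectors.
  These functions are regarded as functions on the whole type; the operators vanish on the
  orthogonal complement.
\<close>

definition pc_rho ::
    "('g, 'm) monoid_scheme \<Rightarrow> ('g \<Rightarrow> 'y set) \<Rightarrow> ('g \<Rightarrow> 'y \<Rightarrow> 'y) \<Rightarrow> 'y \<Rightarrow>
     ('g \<Rightarrow> 'y \<Rightarrow> complex) \<Rightarrow> ('g \<Rightarrow> complex) \<Rightarrow> 'g \<Rightarrow> complex" where
  "pc_rho G D act y a \<xi> k =
     (\<Sum>g\<in>pc_supp a. if k \<in> pc_fibre G D y \<and> inv\<^bsub>G\<^esub> g \<otimes>\<^bsub>G\<^esub> k \<in> pc_fibre G D y
                     then a g (act k y) * \<xi> (inv\<^bsub>G\<^esub> g \<otimes>\<^bsub>G\<^esub> k) else 0)"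

definition pc_rho_op ::
    "('g, 'm) monoid_scheme \<Rightarrow> ('g \<Rightarrow> 'y set) \<Rightarrow> ('g \<Rightarrow> 'y \<Rightarrow> 'y) \<Rightarrow> 'y \<Rightarrow>
     ('g \<Rightarrow> 'y \<Rightarrow> complex) \<Rightarrow> ('g ell2 \<Rightarrow>\<^sub>L 'g ell2)" where
  "pc_rho_op G D act y a = Blinfun (\<lambda>\<xi>. Abs_ell2 (pc_rho G D act y a (Rep_ell2 \<xi>)))"

text \<open>The direct sum of the \<open>pc_rho_op G D act y a\<close> over all \<open>y \<in> Y\<close>.\<close>

definition pc_reg ::
    "('g, 'm) monoid_scheme \<Rightarrow> 'y set \<Rightarrow> ('g \<Rightarrow> 'y set) \<Rightarrow> ('g \<Rightarrow> 'y \<Rightarrow> 'y) \<Rightarrow>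
     ('g \<Rightarrow> 'y \<Rightarrow> complex) \<Rightarrow> (('y \<times> 'g) ell2 \<Rightarrow>\<^sub>L ('y \<times> 'g) ell2)" where
  "pc_reg G Y D act a = Blinfun (\<lambda>\<xi>. Abs_ell2 (\<lambda>(y, k).
     if y \<in> Y then pc_rho G D act y a (\<lambda>h. Rep_ell2 \<xi> (y, h)) k else 0))"

text \<open>
  The completion of \<open>pc_alg G D\<close> in the norm \<open>sup {norm (pc_rho_op G D act y a) | y. y \<in> Y}\<close>,
  realised as the closure of its image under the isometric homomorphism \<open>pc_reg\<close>; see
  \<open>norm_pc_reg\<close>, \<open>pc_reg_mult\<close>, \<open>pc_reg_star\<close> and \<open>pc_reg_inj\<close> below.
\<close>

definition reduced_crossed_product ::
    "('g, 'm) monoid_scheme \<Rightarrow> 'y::topological_space set \<Rightarrow> ('g \<Rightarrow> 'y set) \<Rightarrow> ('g \<Rightarrow> 'y \<Rightarrow> 'y) \<Rightarrow>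
     (('y \<times> 'g) ell2 \<Rightarrow>\<^sub>L ('y \<times> 'g) ell2) set" where
  "reduced_crossed_product G Y D act = closure (pc_reg G Y D act ` pc_alg G D)"

text \<open>The summand of \<open>pc_reg\<close> at \<open>g\<close>.\<close>

definition pc_index :: "('g, 'm) monoid_scheme \<Rightarrow> 'y set \<Rightarrow> ('g \<Rightarrow> 'y set) \<Rightarrow> 'g \<Rightarrow> ('y \<times> 'g) set" where
  "pc_index G Y D g =
     {(y, k). y \<in> Y \<and> k \<in> pc_fibre G D y \<and> inv\<^bsub>G\<^esub> g \<otimes>\<^bsub>G\<^esub> k \<in> pc_fibre G D y}"

definition pc_term ::
    "('g, 'm) monoid_scheme \<Rightarrow> 'y set \<Rightarrow> ('g \<Rightarrow> 'y set) \<Rightarrow> ('g \<Rightarrow> 'y \<Rightarrow> 'y) \<Rightarrow> 'g \<Rightarrow>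
     ('y \<Rightarrow> complex) \<Rightarrow> ('y \<times> 'g) ell2 \<Rightarrow> ('y \<times> 'g) ell2" where
  "pc_term G Y D act g f =
     wcomp (pc_index G Y D g) (\<lambda>(y, k). f (act k y)) (\<lambda>(y, k). (y, inv\<^bsub>G\<^esub> g \<otimes>\<^bsub>G\<^esub> k))"

text \<open>The set-theoretic part of the axioms of a partial action.\<close>

definition partial_action ::
    "('g, 'm) monoid_scheme \<Rightarrow> 'y set \<Rightarrow> ('g \<Rightarrow> 'y set) \<Rightarrow> ('g \<Rightarrow> 'y \<Rightarrow> 'y) \<Rightarrow> bool" where
  "partial_action G Y D act \<longleftrightarrow>
     D \<one>\<^bsub>G\<^esub> = Y \<and> (\<forall>y\<in>Y. act \<one>\<^bsub>G\<^esub> y = y) \<and>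
     (\<forall>g\<in>carrier G. D g \<subseteq> Y \<and>
        (\<forall>y\<in>D g. act g y \<in> D (inv\<^bsub>G\<^esub> g) \<and> act (inv\<^bsub>G\<^esub> g) (act g y) = y)) \<and>
     (\<forall>g\<in>carrier G. \<forall>h\<in>carrier G. \<forall>y\<in>D h. act h y \<in> D g \<longrightarrow>
        y \<in> D (g \<otimes>\<^bsub>G\<^esub> h) \<and> act (g \<otimes>\<^bsub>G\<^esub> h) y = act g (act h y))"

text \<open>What is needed of \<open>a \<in> pc_alg G D\<close> for \<open>pc_reg\<close> to be well defined.\<close>

definition pc_bdd :: "('g, 'm) monoid_scheme \<Rightarrow> ('g \<Rightarrow> 'y \<Rightarrow> complex) \<Rightarrow> bool" where
  "pc_bdd G a \<longleftrightarrow> finite (pc_supp a) \<and> pc_supp a \<subseteq> carrier G \<and> (\<forall>g. \<exists>M. \<forall>y. norm (a g y) \<le> M)"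

lemma pc_alg_imp_bdd:
  assumes "a \<in> pc_alg G D"
  shows "pc_bdd G a"
proof -
  have "\<exists>M. \<forall>y. norm (a g y) \<le> M" for g
  proof (cases "g \<in> carrier G")
    case True
    then have "a g \<in> C0 (D (inv\<^bsub>G\<^esub> g))" using assms by (simp add: pc_alg_def)
    then obtain M where "\<And>y. norm (a g y) \<le> M" by (rule C0_bounded) blast
    then show ?thesis by (intro exI allI)
  next
    case False
    then have "a g = (\<lambda>_. 0)" using assms by (auto simp: pc_alg_def pc_supp_def)
    then show ?thesis by auto
  qed
  moreover have "finite (pc_supp a)" "pc_supp a \<subseteq> carrier G"
    using assms by (simp_all add: pc_alg_def)
  ultimately show ?thesis unfolding pc_bdd_def by blast
qed

context
  fixes G :: "('g, 'm) monoid_scheme" (structure)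
  assumes G: "group G"
begin

interpretation group G by (fact G)

lemma pc_rho_delta:
  assumes "g \<in> carrier G" "h \<in> pc_fibre G D y"
  shows "pc_rho G D act y (\<lambda>g'. if g' = g then f else (\<lambda>_. 0)) (Rep_ell2 (ell2_delta h)) =
    (\<lambda>k. if k = g \<otimes> h \<and> g \<otimes> h \<in> pc_fibre G D y then f (act (g \<otimes> h) y) else 0)"
proof
  fix k
  have h: "h \<in> carrier G" using assms(2) by (simp add: pc_fibre_def)
  have supp: "pc_supp (\<lambda>g'. if g' = g then f else (\<lambda>_. 0)) = (if f = (\<lambda>_. 0) then {} else {g})"
    by (auto simp: pc_supp_def)
  have eq: "inv g \<otimes> k = h \<longleftrightarrow> k = g \<otimes> h" if "k \<in> carrier G"
    using that assms(1) h by (metis inv_solve_left)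
  show "pc_rho G D act y (\<lambda>g'. if g' = g then f else (\<lambda>_. 0)) (Rep_ell2 (ell2_delta h)) k =
    (if k = g \<otimes> h \<and> g \<otimes> h \<in> pc_fibre G D y then f (act (g \<otimes> h) y) else 0)"
    unfolding pc_rho_def supp using assms(2) eq by (auto simp: ell2_delta.rep_eq pc_fibre_def)
qed

lemma pc_term_props:
  assumes "g \<in> carrier G" "\<exists>M. \<forall>y. norm (f y) \<le> M"
  shows bounded_linear_pc_term: "bounded_linear (pc_term G Y D act g f)"
    and Rep_pc_term: "Rep_ell2 (pc_term G Y D act g f \<xi>) (y, k) =
      (if (y, k) \<in> pc_index G Y D g then f (act k y) * Rep_ell2 \<xi> (y, inv g \<otimes> k) else 0)"
proof -
  obtain M where M: "\<And>y. norm (f y) \<le> M" using assms(2) by blast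
  then have M0: "0 \<le> M" by (meson norm_ge_zero order_trans)
  have inj: "inj_on (\<lambda>(y, k). (y, inv g \<otimes> k)) (pc_index G Y D g)"
    using assms(1) by (auto simp: inj_on_def pc_index_def pc_fibre_def)
  have bd: "norm (case i of (y, k) \<Rightarrow> f (act k y)) \<le> M" for i
    using M by (cases i) simp
  show "bounded_linear (pc_term G Y D act g f)"
    unfolding pc_term_def by (rule bounded_linear_wcomp[OF inj bd M0])
  show "Rep_ell2 (pc_term G Y D act g f \<xi>) (y, k) =
      (if (y, k) \<in> pc_index G Y D g then f (act k y) * Rep_ell2 \<xi> (y, inv g \<otimes> k) else 0)"
    unfolding pc_term_def Rep_wcomp[OF inj bd] by simp
qed

lemma pc_reg_apply:
  assumes "pc_bdd G a"
  shows pc_reg_apply_sum: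
      "blinfun_apply (pc_reg G Y D act a) \<xi> = (\<Sum>g\<in>pc_supp a. pc_term G Y D act g (a g) \<xi>)"
    and Rep_pc_reg: "Rep_ell2 (blinfun_apply (pc_reg G Y D act a) \<xi>) (y, k) =
      (if y \<in> Y then pc_rho G D act y a (\<lambda>h. Rep_ell2 \<xi> (y, h)) k else 0)"
proof -
  have sub: "g \<in> carrier G" if "g \<in> pc_supp a" for g
    using assms that by (auto simp: pc_bdd_def)
  have bd: "\<exists>M. \<forall>y. norm (a g y) \<le> M" for g
    using assms by (simp add: pc_bdd_def)
  let ?T = "\<lambda>\<xi>. \<Sum>g\<in>pc_supp a. pc_term G Y D act g (a g) \<xi>"
  have R: "Rep_ell2 (?T \<xi>) (y, k) =
      (if y \<in> Y then pc_rho G D act y a (\<lambda>h. Rep_ell2 \<xi> (y, h)) k else 0)" for \<xi> y k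
    by (auto simp: Rep_ell2_sum Rep_pc_term[OF sub bd] pc_rho_def pc_index_def intro!: sum.cong)
  have eq: "Abs_ell2 (\<lambda>(y, k). if y \<in> Y then pc_rho G D act y a (\<lambda>h. Rep_ell2 \<xi> (y, h)) k else 0) = ?T \<xi>" for \<xi>
  proof -
    have "(\<lambda>(y, k). if y \<in> Y then pc_rho G D act y a (\<lambda>h. Rep_ell2 \<xi> (y, h)) k else 0) = Rep_ell2 (?T \<xi>)"
      by (auto simp only: R split: prod.split)
    then show ?thesis by (simp only: Rep_ell2_inverse)
  qed
  have "bounded_linear ?T"
    by (intro bounded_linear_sum bounded_linear_pc_term sub bd)
  then show "blinfun_apply (pc_reg G Y D act a) \<xi> = ?T \<xi>"
    unfolding pc_reg_def eq by (simp only: bounded_linear_Blinfun_apply)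
  then show "Rep_ell2 (blinfun_apply (pc_reg G Y D act a) \<xi>) (y, k) =
      (if y \<in> Y then pc_rho G D act y a (\<lambda>h. Rep_ell2 \<xi> (y, h)) k else 0)"
    by (simp only: R)
qed

lemma blinfun_apply_pc_rho_op:
  assumes "pc_bdd G a" "y \<in> Y"
  shows "blinfun_apply (pc_rho_op G D act y a) \<xi> =
    ell2_ev y (blinfun_apply (pc_reg G Y D act a) (ell2_in y \<xi>))"
proof -
  let ?T = "\<lambda>\<xi>. ell2_ev y (blinfun_apply (pc_reg G Y D act a) (ell2_in y \<xi>))"
  have "pc_rho G D act y a (Rep_ell2 \<xi>) = Rep_ell2 (?T \<xi>)" for \<xi>
    by (rule ext) (simp add: Rep_ell2_ev Rep_pc_reg[OF assms(1)] Rep_ell2_in assms(2))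
  then have eq: "Abs_ell2 (pc_rho G D act y a (Rep_ell2 \<xi>)) = ?T \<xi>" for \<xi>
    by (simp add: Rep_ell2_inverse)
  have "bounded_linear ?T"
    by (intro bounded_linear_compose[OF bounded_linear_ell2_ev]
        bounded_linear_compose[OF blinfun.bounded_linear_right] bounded_linear_ell2_in)
  then show ?thesis
    unfolding pc_rho_op_def eq by (simp only: bounded_linear_Blinfun_apply)
qed

lemma norm_pc_reg:
  fixes Y :: "'y set"
  assumes "pc_bdd G a" "Y \<noteq> {}"
  shows "norm (pc_reg G Y D act a) = (SUP y\<in>Y. norm (pc_rho_op G D act y a))"
proof (rule antisym)
  let ?R = "pc_reg G Y D act a" and ?r = "\<lambda>y. pc_rho_op G D act y a"
  have le: "norm (?r y) \<le> norm ?R" if "y \<in> Y" for y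
  proof (rule norm_blinfun_bound)
    fix \<xi>
    have "norm (blinfun_apply (?r y) \<xi>) \<le> norm (blinfun_apply ?R (ell2_in y \<xi>))"
      by (simp add: blinfun_apply_pc_rho_op[OF assms(1) that] norm_ell2_ev)
    also have "\<dots> \<le> norm ?R * norm (ell2_in y \<xi>)" by (rule norm_blinfun)
    also have "\<dots> \<le> norm ?R * norm \<xi>" by (intro mult_left_mono norm_ell2_in) simp
    finally show "norm (blinfun_apply (?r y) \<xi>) \<le> norm ?R * norm \<xi>" .
  qed simp
  then show "(SUP y\<in>Y. norm (?r y)) \<le> norm ?R"
    using assms(2) by (intro cSUP_least)
  let ?S = "SUP y\<in>Y. norm (?r y)"
  have S: "norm (?r y) \<le> ?S" if "y \<in> Y" for y
    using that le by (intro cSUP_upper) (auto simp: bdd_above_def)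
  have S0: "0 \<le> ?S" using assms(2) S norm_ge_zero order_trans by blast
  show "norm ?R \<le> ?S"
  proof (rule norm_blinfun_bound[OF S0], rule norm_ell2_leI)
    fix \<xi> :: "('y \<times> 'g) ell2" and F :: "('y \<times> 'g) set"
    show "0 \<le> ?S * norm \<xi>" using S0 by simp
    assume F: "finite F"
    let ?A = "fst ` F \<inter> Y"
    let ?x = "\<lambda>y k. Rep_ell2 (blinfun_apply ?R \<xi>) (y, k)"
    have x: "?x y k = Rep_ell2 (blinfun_apply (?r y) (ell2_ev y \<xi>)) k" if "y \<in> Y" for y k
      using that by (simp add: blinfun_apply_pc_rho_op[OF assms(1) that] Rep_ell2_ev Rep_pc_reg[OF assms(1)] Rep_ell2_in)
    have x0: "?x y k = 0" if "y \<notin> Y" for y k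
      using that by (simp add: Rep_pc_reg[OF assms(1)])
    have "(\<Sum>i\<in>F. (norm (Rep_ell2 (blinfun_apply ?R \<xi>) i))\<^sup>2)
        \<le> (\<Sum>i\<in>fst ` F \<times> snd ` F. (norm (Rep_ell2 (blinfun_apply ?R \<xi>) i))\<^sup>2)"
      using F by (intro sum_mono2) force+
    also have "\<dots> = (\<Sum>y\<in>fst ` F. \<Sum>k\<in>snd ` F. (norm (?x y k))\<^sup>2)"
      by (simp add: sum.cartesian_product case_prod_unfold)
    also have "\<dots> = (\<Sum>y\<in>?A. \<Sum>k\<in>snd ` F. (norm (?x y k))\<^sup>2)"
      using F by (intro sum.mono_neutral_right) (auto simp: x0)
    also have "\<dots> \<le> (\<Sum>y\<in>?A. ?S\<^sup>2 * (norm (ell2_ev y \<xi>))\<^sup>2)"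
    proof (rule sum_mono)
      fix y assume "y \<in> ?A"
      then have y: "y \<in> Y" by simp
      have "(\<Sum>k\<in>snd ` F. (norm (?x y k))\<^sup>2) \<le> (norm (blinfun_apply (?r y) (ell2_ev y \<xi>)))\<^sup>2"
        unfolding x[OF y] using F by (intro norm_ell2_finite_bound) simp
      also have "\<dots> \<le> (norm (?r y) * norm (ell2_ev y \<xi>))\<^sup>2"
        by (intro power_mono norm_blinfun) simp
      also have "\<dots> \<le> (?S * norm (ell2_ev y \<xi>))\<^sup>2"
        by (intro power_mono mult_right_mono S[OF y]) auto
      finally show "(\<Sum>k\<in>snd ` F. (norm (?x y k))\<^sup>2) \<le> ?S\<^sup>2 * (norm (ell2_ev y \<xi>))\<^sup>2"
        by (simp add: power_mult_distrib)
    qed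
    also have "\<dots> \<le> ?S\<^sup>2 * (norm \<xi>)\<^sup>2"
      using F by (simp add: sum_norm_ell2_ev mult_left_mono flip: sum_distrib_left)
    finally show "(\<Sum>i\<in>F. (norm (Rep_ell2 (blinfun_apply ?R \<xi>) i))\<^sup>2) \<le> (?S * norm \<xi>)\<^sup>2"
      by (simp add: power_mult_distrib)
  qed
qed

context
  fixes Y :: "'y set" and D :: "'g \<Rightarrow> 'y set" and act :: "'g \<Rightarrow> 'y \<Rightarrow> 'y"
  assumes pa: "partial_action G Y D act"
begin

lemma pa_one: "D \<one> = Y" "y \<in> Y \<Longrightarrow> act \<one> y = y"
  using pa by (auto simp: partial_action_def)

lemma pa_sub: "g \<in> carrier G \<Longrightarrow> D g \<subseteq> Y"
  using pa by (auto simp: partial_action_def)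

lemma pa_inv:
  "g \<in> carrier G \<Longrightarrow> y \<in> D g \<Longrightarrow> act g y \<in> D (inv g)"
  "g \<in> carrier G \<Longrightarrow> y \<in> D g \<Longrightarrow> act (inv g) (act g y) = y"
  using pa by (auto simp: partial_action_def)

lemma pa_mult:
  assumes "g \<in> carrier G" "h \<in> carrier G" "y \<in> D h" "act h y \<in> D g"
  shows "y \<in> D (g \<otimes> h)" "act (g \<otimes> h) y = act g (act h y)"
  using pa assms by (auto simp: partial_action_def)

lemma pa_fibre:
  assumes g: "g \<in> carrier G" and k: "k \<in> pc_fibre G D y"
  shows "g \<otimes> k \<in> pc_fibre G D y \<longleftrightarrow> act k y \<in> D g"
    and "g \<otimes> k \<in> pc_fibre G D y \<Longrightarrow> act (g \<otimes> k) y = act g (act k y)"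
proof -
  have k': "k \<in> carrier G" "y \<in> D k" using k by (auto simp: pc_fibre_def)
  show *: "g \<otimes> k \<in> pc_fibre G D y \<longleftrightarrow> act k y \<in> D g"
  proof
    assume "act k y \<in> D g"
    then show "g \<otimes> k \<in> pc_fibre G D y"
      using pa_mult(1)[OF g k'] g k' by (simp add: pc_fibre_def)
  next
    assume "g \<otimes> k \<in> pc_fibre G D y"
    then have "y \<in> D (g \<otimes> k)" by (simp add: pc_fibre_def)
    then have "act (inv k) (act k y) \<in> D (g \<otimes> k)" using pa_inv(2)[OF k'] by simp
    then have "act k y \<in> D ((g \<otimes> k) \<otimes> inv k)"
      using pa_mult(1)[of "g \<otimes> k" "inv k" "act k y"] g k' pa_inv(1)[OF k'] by simp
    then show "act k y \<in> D g" using g k' by (simp add: m_assoc)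
  qed
  show "act (g \<otimes> k) y = act g (act k y)" if "g \<otimes> k \<in> pc_fibre G D y"
    using that * pa_mult(2)[OF g k'] by simp
qed

lemma pc_rho_mult:
  assumes a: "pc_bdd G a" and b: "pc_bdd G b"
  shows "pc_rho G D act y (pc_mult G D act a b) \<xi> k =
    pc_rho G D act y a (pc_rho G D act y b \<xi>) k"
proof (cases "k \<in> pc_fibre G D y")
  case True
  then have k: "k \<in> carrier G" "y \<in> D k" by (auto simp: pc_fibre_def)
  let ?A = "pc_supp a" and ?B = "pc_supp b" and ?m = "\<lambda>(g, h). g \<otimes> h"
  let ?F = "pc_fibre G D y"
  have fin: "finite ?A" "finite ?B" and sub: "?A \<subseteq> carrier G" "?B \<subseteq> carrier G"
    using a b by (auto simp: pc_bdd_def)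
  let ?t = "\<lambda>(g, h). pc_pull G D act g (\<lambda>x. pc_pull G D act (inv g) (a g) x * b h x) (act k y)"
  have t: "?t (g, h) = (if inv g \<otimes> k \<in> ?F then a g (act k y) * b h (act (inv g \<otimes> k) y) else 0)"
    if g: "g \<in> carrier G" for g h
  proof (cases "inv g \<otimes> k \<in> ?F")
    case T: True
    have g': "inv g \<in> carrier G" using g by simp
    have 1: "act k y \<in> D (inv g)" using T pa_fibre(1)[OF g' True] by simp
    have 2: "act (inv g \<otimes> k) y = act (inv g) (act k y)" using T pa_fibre(2)[OF g' True] by simp
    have 3: "act (inv g) (act k y) \<in> D g" "act g (act (inv g) (act k y)) = act k y"
      using pa_inv[OF g' 1] g by simp_all
    show ?thesis using T 1 2 3 g by (simp add: pc_pull_def)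
  next
    case F: False
    have "act k y \<notin> D (inv g)" using F pa_fibre(1)[OF _ True, of "inv g"] g by simp
    then show ?thesis using F by (simp add: pc_pull_def)
  qed
  let ?c = "\<lambda>m. if inv m \<otimes> k \<in> ?F then \<xi> (inv m \<otimes> k) else 0"
  have ab: "pc_mult G D act a b m (act k y) = (\<Sum>p\<in>{p \<in> ?A \<times> ?B. ?m p = m}. ?t p)" for m
  proof -
    have "{(g, h) \<in> ?A \<times> ?B. g \<otimes> h = m} = {p \<in> ?A \<times> ?B. ?m p = m}" by auto
    then show ?thesis by (simp only: pc_mult_def)
  qed
  have supp: "pc_supp (pc_mult G D act a b) \<subseteq> ?m ` (?A \<times> ?B)"
  proof
    fix m assume "m \<in> pc_supp (pc_mult G D act a b)"
    then obtain z where "pc_mult G D act a b m z \<noteq> 0" by (auto simp: pc_supp_def fun_eq_iff)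
    then have "{(g, h) \<in> ?A \<times> ?B. g \<otimes> h = m} \<noteq> {}"
      unfolding pc_mult_def by (intro notI) (simp only: sum.empty simp_thms)
    then obtain g h where "g \<in> ?A" "h \<in> ?B" "g \<otimes> h = m" by blast
    then show "m \<in> ?m ` (?A \<times> ?B)" by (intro image_eqI[of _ _ "(g, h)"]) simp_all
  qed
  have "pc_rho G D act y (pc_mult G D act a b) \<xi> k =
      (\<Sum>m\<in>pc_supp (pc_mult G D act a b). pc_mult G D act a b m (act k y) * ?c m)"
    unfolding pc_rho_def using True by (intro sum.cong) auto
  also have "\<dots> = (\<Sum>m\<in>?m ` (?A \<times> ?B). pc_mult G D act a b m (act k y) * ?c m)"
    using supp fin by (intro sum.mono_neutral_left) (auto simp: pc_supp_def)
  also have "\<dots> = (\<Sum>m\<in>?m ` (?A \<times> ?B). \<Sum>p\<in>{p \<in> ?A \<times> ?B. ?m p = m}. ?t p * ?c (?m p))"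
    unfolding ab sum_distrib_right by (intro sum.cong) auto
  also have "\<dots> = (\<Sum>p\<in>?A \<times> ?B. ?t p * ?c (?m p))"
    using fin by (intro sum.group) auto
  also have "\<dots> = (\<Sum>g\<in>?A. \<Sum>h\<in>?B. ?t (g, h) * ?c (g \<otimes> h))"
    unfolding sum.cartesian_product by (rule sum.cong) (simp_all split: prod.split)
  also have "\<dots> = (\<Sum>g\<in>?A. if inv g \<otimes> k \<in> ?F
      then a g (act k y) * pc_rho G D act y b \<xi> (inv g \<otimes> k) else 0)"
  proof (rule sum.cong)
    fix g assume "g \<in> ?A"
    then have g: "g \<in> carrier G" using sub by auto
    have "inv (g \<otimes> h) \<otimes> k = inv h \<otimes> (inv g \<otimes> k)" if "h \<in> ?B" for h
      using that g sub k by (auto simp: inv_mult_group m_assoc)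
    then have "?t (g, h) * ?c (g \<otimes> h) = (if inv g \<otimes> k \<in> ?F then a g (act k y) *
        (if inv h \<otimes> (inv g \<otimes> k) \<in> ?F then b h (act (inv g \<otimes> k) y) * \<xi> (inv h \<otimes> (inv g \<otimes> k)) else 0) else 0)"
      if "h \<in> ?B" for h
      using that unfolding t[OF g] by auto
    then show "(\<Sum>h\<in>?B. ?t (g, h) * ?c (g \<otimes> h)) = (if inv g \<otimes> k \<in> ?F
      then a g (act k y) * pc_rho G D act y b \<xi> (inv g \<otimes> k) else 0)"
      by (auto simp: pc_rho_def sum_distrib_left intro!: sum.cong)
  qed simp
  also have "\<dots> = pc_rho G D act y a (pc_rho G D act y b \<xi>) k"
    unfolding pc_rho_def[of _ _ _ _ a] using True by simp
  finally show ?thesis .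
qed (simp add: pc_rho_def)

lemma pc_reg_mult:
  assumes a: "pc_bdd G a" and b: "pc_bdd G b"
  shows "pc_reg G Y D act (pc_mult G D act a b) = pc_reg G Y D act a o\<^sub>L pc_reg G Y D act b"
proof (rule blinfun_eqI)
  fix \<xi>
  let ?T = "pc_reg G Y D act a o\<^sub>L pc_reg G Y D act b"
  have "(\<lambda>(y, k). if y \<in> Y then pc_rho G D act y (pc_mult G D act a b) (\<lambda>h. Rep_ell2 \<xi> (y, h)) k else 0)
      = Rep_ell2 (blinfun_apply ?T \<xi>)" for \<xi>
    by (auto simp: Rep_pc_reg[OF a] Rep_pc_reg[OF b] pc_rho_mult[OF a b])
  then have "(\<lambda>\<xi>. Abs_ell2 (\<lambda>(y, k). if y \<in> Y then
      pc_rho G D act y (pc_mult G D act a b) (\<lambda>h. Rep_ell2 \<xi> (y, h)) k else 0)) = blinfun_apply ?T"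
    by (simp only: Rep_ell2_inverse)
  then show "blinfun_apply (pc_reg G Y D act (pc_mult G D act a b)) \<xi> = blinfun_apply ?T \<xi>"
    unfolding pc_reg_def[of _ _ _ _ "pc_mult G D act a b"] by (simp add: blinfun_apply_inverse)
qed

lemma pc_bdd_star:
  assumes "pc_bdd G a"
  shows "pc_bdd G (pc_star G D act a)" and "pc_supp (pc_star G D act a) \<subseteq> (\<lambda>g. inv g) ` pc_supp a"
proof -
  show sub: "pc_supp (pc_star G D act a) \<subseteq> (\<lambda>g. inv g) ` pc_supp a"
  proof
    fix g assume g: "g \<in> pc_supp (pc_star G D act a)"
    then have gc: "g \<in> carrier G" by (auto simp: pc_supp_def pc_star_def)
    then have "inv g \<in> pc_supp a"
      using g by (auto simp: pc_supp_def pc_star_def pc_pull_def fun_eq_iff split: if_splits)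
    then show "g \<in> (\<lambda>g. inv g) ` pc_supp a" using gc by (metis imageI inv_inv)
  qed
  have "\<exists>M. \<forall>y. norm (pc_star G D act a g y) \<le> M" for g
  proof -
    obtain M where M: "\<forall>y. norm (a (inv g) y) \<le> M" using assms unfolding pc_bdd_def by blast
    then have "0 \<le> M" by (meson norm_ge_zero order_trans)
    with M have "\<forall>y. norm (pc_star G D act a g y) \<le> M" by (simp add: pc_star_def pc_pull_def)
    then show ?thesis ..
  qed
  moreover have "finite (pc_supp (pc_star G D act a))"
    using finite_subset[OF sub] assms by (simp add: pc_bdd_def)
  moreover have "pc_supp (pc_star G D act a) \<subseteq> carrier G"
    by (auto simp: pc_supp_def pc_star_def split: if_splits)
  ultimately show "pc_bdd G (pc_star G D act a)" by (simp add: pc_bdd_def)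
qed

lemma inner_pc_term:
  assumes a: "pc_bdd G a" and g: "g \<in> carrier G"
  shows "inner (pc_term G Y D act g (a g) \<xi>) \<eta> =
    inner \<xi> (pc_term G Y D act (inv g) (pc_star G D act a (inv g)) \<eta>)"
proof -
  obtain M where M: "\<And>y. norm (a g y) \<le> M" using a unfolding pc_bdd_def by blast
  show ?thesis unfolding pc_term_def
  proof (rule inner_wcomp)
    show "inj_on (\<lambda>(y, k). (y, inv g \<otimes> k)) (pc_index G Y D g)"
      using g by (auto simp: inj_on_def pc_index_def pc_fibre_def)
    show "norm (case i of (y, k) \<Rightarrow> a g (act k y)) \<le> M" for i using M by (cases i) simp
    show "pc_index G Y D (inv g) = (\<lambda>(y, k). (y, inv g \<otimes> k)) ` pc_index G Y D g"
    proof (intro Set.set_eqI iffI)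
      fix i assume i: "i \<in> pc_index G Y D (inv g)"
      obtain y k where [simp]: "i = (y, k)" by (cases i)
      have "(y, g \<otimes> k) \<in> pc_index G Y D g" "k = inv g \<otimes> (g \<otimes> k)"
        using i g by (auto simp: pc_index_def pc_fibre_def m_assoc[symmetric])
      then show "i \<in> (\<lambda>(y, k). (y, inv g \<otimes> k)) ` pc_index G Y D g" by force
    next
      fix i assume "i \<in> (\<lambda>(y, k). (y, inv g \<otimes> k)) ` pc_index G Y D g"
      then obtain y k where yk: "(y, k) \<in> pc_index G Y D g" and [simp]: "i = (y, inv g \<otimes> k)" by auto
      then have "inv (inv g) \<otimes> (inv g \<otimes> k) = k"
        using g by (auto simp: pc_index_def pc_fibre_def m_assoc[symmetric])
      then show "i \<in> pc_index G Y D (inv g)" using yk by (simp add: pc_index_def)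
    qed
    fix i assume i: "i \<in> pc_index G Y D g"
    obtain y k where [simp]: "i = (y, k)" by (cases i)
    have k: "k \<in> pc_fibre G D y" "inv g \<otimes> k \<in> pc_fibre G D y" "k \<in> carrier G"
      using i by (auto simp: pc_index_def pc_fibre_def)
    have gk: "g \<otimes> (inv g \<otimes> k) = k" using g k by (simp add: m_assoc[symmetric])
    show "(case case i of (y, k) \<Rightarrow> (y, inv g \<otimes> k) of (y, k) \<Rightarrow> (y, inv (inv g) \<otimes> k)) = i"
      using g gk by simp
    have "act (inv g \<otimes> k) y \<in> D g" "act g (act (inv g \<otimes> k) y) = act k y"
      using pa_fibre[OF g k(2)] k(1) by (simp_all add: gk)
    then show "(case case i of (y, k) \<Rightarrow> (y, inv g \<otimes> k) of (y, k) \<Rightarrow> pc_star G D act a (inv g) (act k y)) =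
        cnj (case i of (y, k) \<Rightarrow> a g (act k y))"
      using g by (simp add: pc_star_def pc_pull_def)
  qed
qed

text \<open>
  For complex linear operators, being adjoint for the real part of the inner product is the same
  as being adjoint.
\<close>

lemma pc_reg_star:
  assumes a: "pc_bdd G a"
  shows "inner (blinfun_apply (pc_reg G Y D act a) \<xi>) \<eta> =
    inner \<xi> (blinfun_apply (pc_reg G Y D act (pc_star G D act a)) \<eta>)"
proof -
  let ?s = "pc_star G D act a"
  have fin: "finite (pc_supp a)" and sub: "pc_supp a \<subseteq> carrier G" using a by (auto simp: pc_bdd_def)
  have inj: "inj_on (\<lambda>g. inv g) (pc_supp a)" using sub inv_inj by (rule inj_on_subset[rotated])
  have zero: "pc_term G Y D act g (\<lambda>_. 0) \<eta> = 0" if "g \<in> carrier G" for g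
  proof (rule ell2_eqI)
    fix i
    have "\<exists>M. \<forall>y::'y. norm (0 :: complex) \<le> M" by auto
    then show "Rep_ell2 (pc_term G Y D act g (\<lambda>_. 0) \<eta>) i = Rep_ell2 0 i"
      using Rep_pc_term[OF that, of "\<lambda>_::'y. 0"] by (cases i) (simp add: zero_ell2.rep_eq)
  qed
  have "inner (blinfun_apply (pc_reg G Y D act a) \<xi>) \<eta> =
      (\<Sum>g\<in>pc_supp a. inner (pc_term G Y D act g (a g) \<xi>) \<eta>)"
    by (simp add: pc_reg_apply_sum[OF a] inner_sum_left)
  also have "\<dots> = (\<Sum>g\<in>pc_supp a. inner \<xi> (pc_term G Y D act (inv g) (?s (inv g)) \<eta>))"
    using sub by (intro sum.cong inner_pc_term a) auto
  also have "\<dots> = (\<Sum>g\<in>(\<lambda>g. inv g) ` pc_supp a. inner \<xi> (pc_term G Y D act g (?s g) \<eta>))"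
    using inj by (simp add: sum.reindex)
  also have "\<dots> = (\<Sum>g\<in>pc_supp ?s. inner \<xi> (pc_term G Y D act g (?s g) \<eta>))"
    using fin sub pc_bdd_star(2)[OF a]
    by (intro sum.mono_neutral_right) (auto simp: pc_supp_def zero)
  also have "\<dots> = inner \<xi> (blinfun_apply (pc_reg G Y D act ?s) \<eta>)"
    by (simp add: pc_reg_apply_sum[OF pc_bdd_star(1)[OF a]] inner_sum_right)
  finally show ?thesis .
qed

end

lemma pc_reg_inj:
  fixes Y :: "'y::topological_space set"
  assumes pa: "partial_action G Y D act"
  shows "inj_on (pc_reg G Y D act) (pc_alg G D)"
proof (rule inj_onI)
  have coeff: "a g z = Rep_ell2 (blinfun_apply (pc_reg G Y D act a) (ell2_delta (z, inv g))) (z, \<one>)"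
    if a: "a \<in> pc_alg G D" and g: "g \<in> carrier G" and z: "z \<in> D (inv g)" for a g z
  proof -
    have zY: "z \<in> Y" using pa_sub[OF pa, of "inv g"] g z by auto
    have F: "\<one> \<in> pc_fibre G D z" using zY pa_one[OF pa] by (simp add: pc_fibre_def)
    have fin: "finite (pc_supp a)" and sub: "h \<in> pc_supp a \<Longrightarrow> h \<in> carrier G" for h
      using a by (auto simp: pc_alg_def)
    have eq: "h = g" if "h \<in> pc_supp a" "inv h = inv g" for h
      using that sub g by (metis inv_inv)
    have "Rep_ell2 (blinfun_apply (pc_reg G Y D act a) (ell2_delta (z, inv g))) (z, \<one>) =
        (\<Sum>h\<in>pc_supp a. if h = g then a g z else 0)"
      using zY F pa_one(2)[OF pa zY] sub g z
      by (auto simp: Rep_pc_reg[OF pc_alg_imp_bdd[OF a]] pc_rho_def ell2_delta.rep_eq pc_fibre_def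
          intro!: sum.cong dest: eq)
    also have "\<dots> = a g z" using fin by (auto simp: pc_supp_def)
    finally show ?thesis ..
  qed
  fix a b assume ab: "a \<in> pc_alg G D" "b \<in> pc_alg G D" "pc_reg G Y D act a = pc_reg G Y D act b"
  show "a = b"
  proof (intro ext)
    fix g z
    consider "g \<notin> carrier G" | "g \<in> carrier G" "z \<in> D (inv g)" | "g \<in> carrier G" "z \<notin> D (inv g)"
      by blast
    then show "a g z = b g z"
    proof cases
      case 1
      then have "g \<notin> pc_supp a" "g \<notin> pc_supp b" using ab by (auto simp: pc_alg_def)
      then show ?thesis by (simp add: pc_supp_def)
    next
      case 2
      then show ?thesis using coeff[OF ab(1) 2] coeff[OF ab(2) 2] ab(3) by metis
    next
      case 3
      then show ?thesis using ab by (simp add: pc_alg_def C0_def)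
    qed
  qed
qed

end

section \<open>The boundary quotient of a subsemigroup of a group\<close>

definition subsemigroup :: "'g set \<Rightarrow> ('g, 'm) monoid_scheme \<Rightarrow> bool" where
  "subsemigroup P G \<longleftrightarrow> P \<noteq> {} \<and> P \<subseteq> carrier G \<and> (\<forall>p\<in>P. \<forall>q\<in>P. p \<otimes>\<^bsub>G\<^esub> q \<in> P)"

definition left_mult :: "('g, 'm) monoid_scheme \<Rightarrow> 'g set \<Rightarrow> 'g \<Rightarrow> ('g \<rightharpoonup> 'g)" where
  "left_mult G P p = (\<lambda>x. if x \<in> P then Some (p \<otimes>\<^bsub>G\<^esub> x) else None)"

definition pinverse :: "('a \<rightharpoonup> 'b) \<Rightarrow> ('b \<rightharpoonup> 'a)" where
  "pinverse s = (\<lambda>y. if y \<in> ran s then Some (THE x. s x = Some y) else None)"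

text \<open>The inverse semigroup \<open>I\<^sub>l(P)\<close>, whose zero is the empty map.\<close>

inductive_set left_inverse_hull :: "('g, 'm) monoid_scheme \<Rightarrow> 'g set \<Rightarrow> ('g \<rightharpoonup> 'g) set"
  for G P where
  zero: "Map.empty \<in> left_inverse_hull G P"
| left_mult: "p \<in> P \<Longrightarrow> left_mult G P p \<in> left_inverse_hull G P"
| inverse: "s \<in> left_inverse_hull G P \<Longrightarrow> pinverse s \<in> left_inverse_hull G P"
| comp: "s \<in> left_inverse_hull G P \<Longrightarrow> t \<in> left_inverse_hull G P \<Longrightarrow> s \<circ>\<^sub>m t \<in> left_inverse_hull G P"

definition group_element :: "('g, 'm) monoid_scheme \<Rightarrow> ('g \<rightharpoonup> 'g) \<Rightarrow> 'g" where
  "group_element G s =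
     (THE g. g \<in> carrier G \<and> (\<forall>x\<in>dom s. s x = Some (g \<otimes>\<^bsub>G\<^esub> x)))"

text \<open>
  The word \<open>(p\<^sub>1, q\<^sub>1), \<dots>, (p\<^sub>n, q\<^sub>n)\<close> denotes the ideal obtained from \<open>P\<close> by translating by
  \<open>q\<^sub>n\<close>, taking the preimage under \<open>p\<^sub>n\<close>, and so on. The empty word gives \<open>P\<close>, as does \<open>(p, p)\<close>.
\<close>

fun word_ideal :: "('g, 'm) monoid_scheme \<Rightarrow> 'g set \<Rightarrow> ('g \<times> 'g) list \<Rightarrow> 'g set" where
  "word_ideal G P [] = P"
| "word_ideal G P ((p, q) # w) = {y \<in> P. p \<otimes>\<^bsub>G\<^esub> y \<in> q <#\<^bsub>G\<^esub> word_ideal G P w}"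

definition constructible_ideals :: "('g, 'm) monoid_scheme \<Rightarrow> 'g set \<Rightarrow> 'g set set" where
  "constructible_ideals G P = {word_ideal G P w | w. set w \<subseteq> P \<times> P} \<union> {{}}"

text \<open>
  A map from the constructible ideals to \<open>{0, 1}\<close> is encoded as a predicate which is false off the
  constructible ideals. The topology of pointwise convergence is then the one induced by the product
  topology on functions to (discrete) \<^typ>\<open>bool\<close>.
\<close>

definition spectrum :: "('g, 'm) monoid_scheme \<Rightarrow> 'g set \<Rightarrow> ('g set \<Rightarrow> bool) set" where
  "spectrum G P = {\<omega>.
     (\<forall>X. X \<notin> constructible_ideals G P \<longrightarrow> \<not> \<omega> X) \<and>
     (\<exists>X. \<omega> X) \<and> \<not> \<omega> {} \<and>
     (\<forall>X\<in>constructible_ideals G P. \<forall>Y\<in>constructible_ideals G P. \<omega> (X \<inter> Y) \<longleftrightarrow> \<omega> X \<and> \<omega> Y)}"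

definition max_spectrum :: "('g, 'm) monoid_scheme \<Rightarrow> 'g set \<Rightarrow> ('g set \<Rightarrow> bool) set" where
  "max_spectrum G P =
     {\<omega> \<in> spectrum G P. \<forall>\<psi>\<in>spectrum G P. {X. \<omega> X} \<subseteq> {X. \<psi> X} \<longrightarrow> \<psi> = \<omega>}"

definition boundary :: "('g, 'm) monoid_scheme \<Rightarrow> 'g set \<Rightarrow> ('g set \<Rightarrow> bool) set" where
  "boundary G P = spectrum G P \<inter> closure (max_spectrum G P)"

definition implements ::
    "('g, 'm) monoid_scheme \<Rightarrow> 'g set \<Rightarrow> 'g \<Rightarrow> ('g set \<Rightarrow> bool) \<Rightarrow> ('g \<rightharpoonup> 'g) \<Rightarrow> bool" where
  "implements G P g \<omega> s \<longleftrightarrow>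
     s \<in> left_inverse_hull G P \<and> s \<noteq> Map.empty \<and> group_element G s = g \<and> \<omega> (dom s)"

definition spectrum_dom :: "('g, 'm) monoid_scheme \<Rightarrow> 'g set \<Rightarrow> 'g \<Rightarrow> ('g set \<Rightarrow> bool) set" where
  "spectrum_dom G P g = {\<omega> \<in> spectrum G P. \<exists>s. implements G P g \<omega> s}"

text \<open>The value does not depend on the chosen \<open>s\<close>.\<close>

definition spectrum_act ::
    "('g, 'm) monoid_scheme \<Rightarrow> 'g set \<Rightarrow> 'g \<Rightarrow> ('g set \<Rightarrow> bool) \<Rightarrow> ('g set \<Rightarrow> bool)" where
  "spectrum_act G P g \<omega> =
     (let s = SOME s. implements G P g \<omega> s
      in (\<lambda>X. X \<in> constructible_ideals G P \<and> \<omega> {x. \<exists>y\<in>X \<inter> ran s. s x = Some y}))"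

definition boundary_dom :: "('g, 'm) monoid_scheme \<Rightarrow> 'g set \<Rightarrow> 'g \<Rightarrow> ('g set \<Rightarrow> bool) set" where
  "boundary_dom G P g = spectrum_dom G P g \<inter> boundary G P"

definition core_subgroup :: "('g, 'm) monoid_scheme \<Rightarrow> 'g set \<Rightarrow> 'g set" where
  "core_subgroup G P = {g \<in> carrier G. \<forall>X\<in>constructible_ideals G P. X \<noteq> {} \<longrightarrow>
     X \<inter> (g <#\<^bsub>G\<^esub> P) \<noteq> {} \<and> X \<inter> (inv\<^bsub>G\<^esub> g <#\<^bsub>G\<^esub> P) \<noteq> {}}"

definition boundary_quotient ::
    "('g, 'm) monoid_scheme \<Rightarrow> 'g set \<Rightarrow>
     ((('g set \<Rightarrow> bool) \<times> 'g) ell2 \<Rightarrow>\<^sub>L (('g set \<Rightarrow> bool) \<times> 'g) ell2) set" where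
  "boundary_quotient G P =
     reduced_crossed_product G (boundary G P) (boundary_dom G P) (spectrum_act G P)"

end

(*
  Let Y be the boundary. A character of the constructible ideals lies in Y iff, whenever it contains X
  and omits finitely many ideals, some nonempty constructible ideal in X avoids all of these. So every
  nonempty open subset of Y contains a cylinder {y. y X} with X nonempty.

  If every cylinder inside Z met its translate under g, then, conjugating by some p in Z, every
  cylinder would meet its translate under h = inv p g p. That puts h into the core subgroup and, by
  the description of Y, makes it act trivially, so h = 1 by topological freeness. Hence inside any
  open set there is a cylinder pY which is disjoint from its translates under any finite number of
  given nontrivial group elements.

  Let I be a nonzero ideal. Some S in I has a diagonal matrix coefficient c with c nonzero.
  Approximate S by a finite sum a. Then compressing a by the isometry of p, for pY chosen for the
  support of a in an open set where the coefficient of a at 1 is nearly constant, kills all terms but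
  that one: V* S V is within distance less than norm c of c, hence invertible, and I is everything.
*)
theory Submission
  imports Defs
begin

section \<open>Operators on square-summable families\<close>

text \<open>The definition of an ideal does not mention adjoints, so the argument avoids positivity
  and conditional expectations and works with matrix entries. A nonzero operator has a nonzero
  entry, possibly off the diagonal; left multiplication by a one-term element f delta_g, with f
  nonzero at the relevant point, carries it to the diagonal.

  Compression can be done by a single semigroup element because constructible ideals are right
  ideals: a nonempty X contains pP for each p in X, and p acts on all of Y with image the cylinder
  of pP. The compressed operator therefore lives on all of Y again and not on a corner, with all
  diagonal entries close to c. This does the work of minimality.

  The obstacle is that freeness speaks of moved points, while the argument needs ideals that g moves
  off themselves. Tightness bridges the two: at a moved point some ideal separates the point from
  its image, and avoiding finitely many ideals gives a nonempty one that g never maps into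
  itself.\<close>

lemma norm_ell2_le_pointwise:
  assumes "0 \<le> M" "\<And>i. norm (Rep_ell2 x i) \<le> M * norm (Rep_ell2 y i)"
  shows "norm x \<le> M * norm y"
proof (rule norm_ell2_leI)
  fix F :: "'a set" assume F: "finite F"
  have "(\<Sum>i\<in>F. (norm (Rep_ell2 x i))\<^sup>2) \<le> (\<Sum>i\<in>F. M\<^sup>2 * (norm (Rep_ell2 y i))\<^sup>2)"
    using assms(2) by (intro sum_mono) (metis norm_ge_zero power_mono power_mult_distrib)
  also have "\<dots> \<le> M\<^sup>2 * (norm y)\<^sup>2"
    using F by (simp add: mult_left_mono norm_ell2_finite_bound flip: sum_distrib_left)
  finally show "(\<Sum>i\<in>F. (norm (Rep_ell2 x i))\<^sup>2) \<le> (M * norm y)\<^sup>2"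
    by (simp add: power_mult_distrib)
qed (use assms in simp)

lemma norm_ell2_delta_le: "norm (ell2_delta j) \<le> 1"
proof (rule norm_ell2_leI)
  fix F :: "'a set" assume "finite F"
  have "(\<Sum>i\<in>F. (norm (Rep_ell2 (ell2_delta j) i))\<^sup>2) = (\<Sum>i\<in>F. if i = j then 1 else 0)"
    by (rule sum.cong) (auto simp: ell2_delta.rep_eq)
  also have "\<dots> \<le> (1 :: real)" using \<open>finite F\<close> by simp
  finally show "(\<Sum>i\<in>F. (norm (Rep_ell2 (ell2_delta j) i))\<^sup>2) \<le> 1\<^sup>2" by simp
qed simp

lemma ell2_delta_dense:
  fixes x :: "'i ell2"
  assumes "0 < e"
  obtains F where "finite F"
    "norm (x - (\<Sum>j\<in>F. scaleC_ell2 (Rep_ell2 x j) (ell2_delta j))) < e"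
proof -
  let ?q = "\<lambda>i. (norm (Rep_ell2 x i))\<^sup>2"
  have "(?q has_sum (norm x)\<^sup>2) UNIV"
    unfolding norm_ell2_sq using square_summable_Rep_ell2 by (rule has_sum_infsum)
  from has_sum_finite_approximation[OF this, of "(e/2)\<^sup>2"] assms
  obtain F where F: "finite F" "dist (sum ?q F) ((norm x)\<^sup>2) \<le> (e/2)\<^sup>2" by auto
  let ?y = "x - (\<Sum>j\<in>F. scaleC_ell2 (Rep_ell2 x j) (ell2_delta j))"
  have y: "Rep_ell2 ?y i = (if i \<in> F then 0 else Rep_ell2 x i)" for i
  proof -
    have "Rep_ell2 ?y i = Rep_ell2 x i - (\<Sum>j\<in>F. if i = j then Rep_ell2 x j else 0)"
      unfolding minus_ell2.rep_eq Rep_ell2_sum scaleC_ell2.rep_eq ell2_delta.rep_eq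
      by (intro arg_cong2[of _ _ _ _ "(-)"] sum.cong) auto
    then show ?thesis using F(1) by simp
  qed
  have "norm ?y \<le> e/2"
  proof (rule norm_ell2_leI)
    fix F' :: "'i set" assume F': "finite F'"
    have "(\<Sum>i\<in>F'. (norm (Rep_ell2 ?y i))\<^sup>2) = sum ?q (F' - F)"
      using F' by (intro sum.mono_neutral_cong_right) (auto simp: y)
    also have "\<dots> = sum ?q (F \<union> F') - sum ?q F"
      using sum.union_disjoint[of F "F' - F" ?q] F(1) F' by (simp add: Un_Diff_cancel)
    also have "\<dots> \<le> (norm x)\<^sup>2 - sum ?q F"
      using norm_ell2_finite_bound[of "F \<union> F'" x] F(1) F' by simp
    also have "\<dots> \<le> (e/2)\<^sup>2" using F(2) by (simp add: dist_real_def)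
    finally show "(\<Sum>i\<in>F'. (norm (Rep_ell2 ?y i))\<^sup>2) \<le> (e/2)\<^sup>2" .
  qed (use assms in simp)
  then have "norm ?y < e" using assms by simp
  with F(1) show thesis by (rule that)
qed

text \<open>\<open>blinfun\<close> operators are only real linear, so vanishing on the basis vectors
  does not suffice: entrywise conjugation minus the identity kills every basis vector. Complex
  homogeneity has to be supplied separately.\<close>

lemma blinfun_ell2_zeroI:
  assumes lin: "\<And>c \<xi>. blinfun_apply T (scaleC_ell2 c \<xi>) = scaleC_ell2 c (blinfun_apply T \<xi>)"
    and zero: "\<And>j. blinfun_apply T (ell2_delta j) = 0"
  shows "T = (0 :: 'i ell2 \<Rightarrow>\<^sub>L 'j ell2)"
proof (rule blinfun_eqI)
  fix \<xi>
  have sc0: "scaleC_ell2 c 0 = 0" for c by (rule ell2_eqI) (simp add: scaleC_ell2.rep_eq zero_ell2.rep_eq)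
  have "norm (blinfun_apply T \<xi>) \<le> 0"
  proof (rule field_le_epsilon)
    fix e :: real assume e: "0 < e"
    have K: "0 < norm T + 1" using norm_ge_zero[of T] by linarith
    then have "0 < e / (norm T + 1)" using e by simp
    then obtain F where F: "norm (\<xi> - (\<Sum>j\<in>F. scaleC_ell2 (Rep_ell2 \<xi> j) (ell2_delta j))) < e / (norm T + 1)"
      by (rule ell2_delta_dense)
    have "blinfun_apply T \<xi> = blinfun_apply T (\<xi> - (\<Sum>j\<in>F. scaleC_ell2 (Rep_ell2 \<xi> j) (ell2_delta j)))"
      by (simp add: blinfun.diff_right blinfun.sum_right lin zero sc0)
    also have "norm \<dots> \<le> norm T * (e / (norm T + 1))"
      using F by (intro order_trans[OF norm_blinfun] mult_left_mono) auto
    also have "\<dots> \<le> e" using K e by (simp add: field_simps)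
    finally show "norm (blinfun_apply T \<xi>) \<le> 0 + e" by simp
  qed
  then show "blinfun_apply T \<xi> = blinfun_apply 0 \<xi>" by simp
qed

lemma bounded_linear_Rep_ell2: "bounded_linear (\<lambda>x. Rep_ell2 x i)"
  by (rule bounded_linear_intro[where K = 1])
    (auto simp: plus_ell2.rep_eq scaleR_ell2.rep_eq norm_Rep_ell2_le scaleR_conv_of_real)

lemma continuous_on_coefficient:
  "continuous_on UNIV (\<lambda>T. Rep_ell2 (blinfun_apply T \<xi>) i)"
  by (intro linear_continuous_on bounded_linear_compose[OF bounded_linear_Rep_ell2]
      blinfun.bounded_linear_left)

lemma coefficient_diff_le:
  "norm (Rep_ell2 (blinfun_apply S (ell2_delta j)) i - Rep_ell2 (blinfun_apply T (ell2_delta j)) i)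
    \<le> norm (S - T)"
proof -
  have "norm (Rep_ell2 (blinfun_apply (S - T) (ell2_delta j)) i) \<le> norm (blinfun_apply (S - T) (ell2_delta j))"
    by (rule norm_Rep_ell2_le)
  also have "\<dots> \<le> norm (S - T) * 1"
    using norm_ell2_delta_le by (intro order_trans[OF norm_blinfun] mult_left_mono) auto
  finally show ?thesis by (simp add: blinfun.diff_left minus_ell2.rep_eq)
qed

section \<open>Reduced partial crossed products\<close>

definition pc_single :: "'g \<Rightarrow> ('y \<Rightarrow> complex) \<Rightarrow> 'g \<Rightarrow> 'y \<Rightarrow> complex" where
  "pc_single g f = (\<lambda>h. if h = g then f else (\<lambda>_. 0))"

text \<open>Only the set-theoretic axioms are recorded; topology enters through the
  \<open>C0\<close> coefficients and the hypotheses of the simplicity criterion.\<close>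

locale partial_group_action = group G for G :: "('g, 'm) monoid_scheme" (structure) +
  fixes Y :: "'y::topological_space set" and D :: "'g \<Rightarrow> 'y set" and act :: "'g \<Rightarrow> 'y \<Rightarrow> 'y"
  assumes pa: "partial_action G Y D act"
begin

abbreviation "reg \<equiv> pc_reg G Y D act"
abbreviation "fibre \<equiv> pc_fibre G D"
abbreviation "crossed \<equiv> reduced_crossed_product G Y D act"

lemma fibreD: "k \<in> fibre y \<Longrightarrow> k \<in> carrier G" "k \<in> fibre y \<Longrightarrow> y \<in> D k"
  by (auto simp: pc_fibre_def)

lemma act_in:
  assumes "k \<in> fibre y"
  shows "act k y \<in> Y"
  using pa_inv(1)[OF is_group pa, of k y] pa_sub[OF is_group pa, of "inv k"] assms
  by (auto simp: pc_fibre_def)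

lemma reg_in_crossed: "a \<in> pc_alg G D \<Longrightarrow> reg a \<in> crossed"
  unfolding reduced_crossed_product_def by (rule subsetD[OF closure_subset imageI])

lemma crossed_approx:
  assumes "T \<in> crossed" "0 < e"
  obtains a where "a \<in> pc_alg G D" "norm (T - reg a) < e"
  using assms unfolding reduced_crossed_product_def closure_approachable
  by (auto simp: dist_norm norm_minus_commute)

text \<open>Matrix entries are continuous in the operator, so a linear relation between two of them
  passes from finite sums to the closure. The factor \<open>c\<close> covers all uses:
  \<open>0\<close> for vanishing entries, \<open>1\<close> for equality, an arbitrary scalar for
  complex homogeneity.\<close>

lemma crossed_coefficient:
  assumes "T \<in> crossed"
    and "\<And>a. a \<in> pc_alg G D \<Longrightarrow>
      Rep_ell2 (blinfun_apply (reg a) \<xi>) i = c * Rep_ell2 (blinfun_apply (reg a) \<eta>) j"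
  shows "Rep_ell2 (blinfun_apply T \<xi>) i = c * Rep_ell2 (blinfun_apply T \<eta>) j"
proof -
  let ?C = "{T. Rep_ell2 (blinfun_apply T \<xi>) i = c * Rep_ell2 (blinfun_apply T \<eta>) j}"
  have "closed ?C"
    by (intro closed_Collect_eq continuous_on_mult_left continuous_on_coefficient)
  then have "crossed \<subseteq> ?C"
    unfolding reduced_crossed_product_def using assms(2) by (intro closure_minimal) auto
  then show ?thesis using assms(1) by blast
qed

lemma Rep_reg:
  assumes "a \<in> pc_alg G D"
  shows "Rep_ell2 (blinfun_apply (reg a) \<xi>) (y, k) =
    (if y \<in> Y \<and> k \<in> fibre y then
      \<Sum>g\<in>pc_supp a. if inv g \<otimes> k \<in> fibre y then a g (act k y) * Rep_ell2 \<xi> (y, inv g \<otimes> k) else 0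
     else 0)"
  by (simp add: Rep_pc_reg[OF is_group pc_alg_imp_bdd[OF assms]] pc_rho_def)

text \<open>A basis vector leaves one candidate summand, since \<open>inv g \<otimes> k = k'\<close>
  forces \<open>g = k \<otimes> inv k'\<close>. Hence diagonal entries see only the coefficient at
  the identity, and different points \<open>y\<close> never mix.\<close>

lemma Rep_reg_delta:
  assumes a: "a \<in> pc_alg G D"
  shows "Rep_ell2 (blinfun_apply (reg a) (ell2_delta (y', k'))) (y, k) =
    (if y \<in> Y \<and> y' = y \<and> k \<in> fibre y \<and> k' \<in> fibre y then a (k \<otimes> inv k') (act k y) else 0)"
proof (cases "y \<in> Y \<and> y' = y \<and> k \<in> fibre y \<and> k' \<in> fibre y")
  case True
  have fin: "finite (pc_supp a)" and sub: "pc_supp a \<subseteq> carrier G"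
    using a by (auto simp: pc_alg_def)
  have "inv g \<otimes> k = k' \<longleftrightarrow> g = k \<otimes> inv k'" if "g \<in> carrier G" for g
    using inv_solve_left[of k' g k] inv_solve_right[of g k k'] that True
      fibreD(1)[of k y] fibreD(1)[of k' y] by auto
  then have "(\<Sum>g\<in>pc_supp a. if inv g \<otimes> k \<in> fibre y
        then a g (act k y) * Rep_ell2 (ell2_delta (y', k')) (y, inv g \<otimes> k) else 0) =
      (\<Sum>g\<in>pc_supp a. if g = k \<otimes> inv k' then a g (act k y) else 0)"
    using True sub by (intro sum.cong) (auto simp: ell2_delta.rep_eq)
  also have "\<dots> = a (k \<otimes> inv k') (act k y)"
    using fin by (auto simp: pc_supp_def)
  finally show ?thesis unfolding Rep_reg[OF a] using True by (simp only: if_True simp_thms)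
next
  case False
  then show ?thesis
    by (auto simp: Rep_reg[OF a] ell2_delta.rep_eq intro!: sum.neutral)
qed

lemma crossed_delta_neq0:
  assumes "T \<in> crossed" "Rep_ell2 (blinfun_apply T (ell2_delta (y', k'))) (y, k) \<noteq> 0"
  shows "y \<in> Y" "y' = y" "k \<in> fibre y" "k' \<in> fibre y"
proof -
  have "y \<in> Y \<and> y' = y \<and> k \<in> fibre y \<and> k' \<in> fibre y"
  proof (rule ccontr)
    assume *: "\<not> ?thesis"
    have "Rep_ell2 (blinfun_apply T (ell2_delta (y', k'))) (y, k) =
        0 * Rep_ell2 (blinfun_apply T (ell2_delta (y', k'))) (y, k)"
      using assms(1) by (rule crossed_coefficient) (use * in \<open>auto simp: Rep_reg_delta\<close>)
    then show False using assms(2) by simp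
  qed
  then show "y \<in> Y" "y' = y" "k \<in> fibre y" "k' \<in> fibre y" by auto
qed

lemma crossed_scaleC:
  assumes "T \<in> crossed"
  shows "blinfun_apply T (scaleC_ell2 c \<xi>) = scaleC_ell2 c (blinfun_apply T \<xi>)"
proof (rule ell2_eqI)
  fix i :: "'y \<times> 'g"
  obtain y k where [simp]: "i = (y, k)" by (cases i)
  have "Rep_ell2 (blinfun_apply T (scaleC_ell2 c \<xi>)) i = c * Rep_ell2 (blinfun_apply T \<xi>) i"
    using assms
    by (rule crossed_coefficient)
      (auto simp: Rep_reg scaleC_ell2.rep_eq sum_distrib_left intro!: sum.cong)
  then show "Rep_ell2 (blinfun_apply T (scaleC_ell2 c \<xi>)) i = Rep_ell2 (scaleC_ell2 c (blinfun_apply T \<xi>)) i"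
    by (simp add: scaleC_ell2.rep_eq)
qed

text \<open>Stands in for faithfulness of the conditional expectation: some entry survives, though
  perhaps off the diagonal. The fibre conditions hold because all other entries vanish.\<close>

lemma crossed_nonzero_coefficient:
  assumes "T \<in> crossed" "T \<noteq> 0"
  obtains y k h where "y \<in> Y" "k \<in> fibre y" "h \<in> fibre y"
    "Rep_ell2 (blinfun_apply T (ell2_delta (y, k))) (y, h) \<noteq> 0"
proof -
  have "\<exists>j i. Rep_ell2 (blinfun_apply T (ell2_delta j)) i \<noteq> 0"
  proof (rule ccontr)
    assume "\<not> ?thesis"
    then have "blinfun_apply T (ell2_delta j) = 0" for j
      by (intro ell2_eqI) (unfold zero_ell2.rep_eq, blast)
    then have "T = 0" using crossed_scaleC[OF assms(1)] by (intro blinfun_ell2_zeroI) auto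
    then show False using assms(2) by simp
  qed
  then obtain y' k y h where "Rep_ell2 (blinfun_apply T (ell2_delta (y', k))) (y, h) \<noteq> 0" by auto
  then show thesis using crossed_delta_neq0[OF assms(1), of y' k y h] that by metis
qed

section \<open>One-term elements f delta_g\<close>

lemma pc_single_in_alg:
  assumes "g \<in> carrier G" "f \<in> C0 (D (inv g))"
  shows "pc_single g f \<in> pc_alg G D"
proof -
  have "pc_supp (pc_single g f) \<subseteq> {g}" by (auto simp: pc_supp_def pc_single_def)
  then have "finite (pc_supp (pc_single g f))" "pc_supp (pc_single g f) \<subseteq> carrier G"
    using assms(1) by (auto intro: finite_subset)
  moreover have "{y. y \<in> U \<and> e \<le> 0} = {}" if "0 < e" for e :: real and U :: "'y set"
    using that by auto
  then have "(\<lambda>_. 0) \<in> C0 (D h)" for h by (simp add: C0_def)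
  ultimately show ?thesis using assms by (auto simp: pc_alg_def pc_single_def)
qed

lemma Rep_reg_single:
  assumes "g \<in> carrier G" "f \<in> C0 (D (inv g))"
  shows "Rep_ell2 (blinfun_apply (reg (pc_single g f)) \<xi>) (y, k) =
    (if y \<in> Y \<and> k \<in> fibre y \<and> inv g \<otimes> k \<in> fibre y
     then f (act k y) * Rep_ell2 \<xi> (y, inv g \<otimes> k) else 0)"
proof (cases "f = (\<lambda>_. 0)")
  case True
  then show ?thesis
    using Rep_reg[OF pc_single_in_alg[OF assms]] by (auto simp: pc_single_def intro!: sum.neutral)
next
  case False
  then have "pc_supp (pc_single g f) = {g}" by (auto simp: pc_supp_def pc_single_def)
  then show ?thesis
    using Rep_reg[OF pc_single_in_alg[OF assms]] by (auto simp: pc_single_def)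
qed

lemma norm_reg_single_le:
  assumes g: "g \<in> carrier G" and f: "f \<in> C0 (D (inv g))" and M: "0 \<le> M" "\<And>y. norm (f y) \<le> M"
  shows "norm (reg (pc_single g f)) \<le> M"
proof (rule norm_blinfun_bound[OF M(1)])
  fix \<xi> :: "('y \<times> 'g) ell2"
  let ?w = "\<lambda>(y, k). f (act k y)" and ?p = "\<lambda>(y, k). (y, inv g \<otimes> k)"
  have "inj_on ?p (pc_index G Y D g)"
    using g by (auto simp: inj_on_def pc_index_def pc_fibre_def)
  moreover have "norm (?w i) \<le> M" for i using M(2) by (cases i) simp
  ultimately have B: "(\<Sum>i\<in>F. (norm (if i \<in> pc_index G Y D g then ?w i * Rep_ell2 \<xi> (?p i) else 0))\<^sup>2)
      \<le> (M * norm \<xi>)\<^sup>2" if "finite F" for F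
    using that by (intro wcomp_bound)
  have "Rep_ell2 (blinfun_apply (reg (pc_single g f)) \<xi>) i =
      (if i \<in> pc_index G Y D g then ?w i * Rep_ell2 \<xi> (?p i) else 0)" for i
    by (cases i) (simp add: Rep_reg_single[OF g f] pc_index_def)
  then show "norm (blinfun_apply (reg (pc_single g f)) \<xi>) \<le> M * norm \<xi>"
    using B M(1) by (intro norm_ell2_leI) auto
qed

section \<open>A simplicity criterion\<close>

text \<open>\<open>contr\<close> combines minimality and freeness: \<open>p\<close> is defined on
  all of \<open>Y\<close>, its image \<open>D (inv p)\<close> fits into a prescribed open set, and
  every \<open>g\<close> in \<open>F\<close> moves that image off itself. \<open>sep\<close>
  provides the functions that bring a nonzero entry to the diagonal.\<close>

lemma contracting_imp_simple:
  assumes "Y \<noteq> {}" and unit: "indicator Y \<in> C0 Y"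
    and sep: "\<And>g y. g \<in> carrier G \<Longrightarrow> y \<in> D g \<Longrightarrow> \<exists>f\<in>C0 (D g). f y \<noteq> 0"
    and contr: "\<And>y U F. y \<in> Y \<Longrightarrow> open U \<Longrightarrow> y \<in> U \<Longrightarrow> finite F \<Longrightarrow> F \<subseteq> carrier G - {\<one>} \<Longrightarrow>
      \<exists>p\<in>carrier G. D p = Y \<and> indicator (D (inv p)) \<in> C0 (D (inv p)) \<and> D (inv p) \<subseteq> U \<and>
        (\<forall>g\<in>F. \<forall>z\<in>D g. z \<in> D (inv p) \<longrightarrow> act g z \<notin> D (inv p))"
  shows "simple_Cstar_algebra crossed"
proof -
  \<comment> \<open>\<open>E\<close> projects onto the span of the basis vectors at
    \<open>(y, k)\<close> with \<open>y \<in> Y\<close> and \<open>k\<close> in the fibre of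
    \<open>y\<close>. It is the unit of \<open>crossed\<close>, in general different from the
    identity operator because the Hilbert space is indexed by whole types.\<close>
  define E where "E = reg (pc_single \<one> (indicator Y))"
  have D1: "D \<one> = Y" by (rule pa_one(1)[OF is_group pa])
  have unit': "indicator Y \<in> C0 (D (inv \<one>))" using unit D1 by simp
  have EA: "E \<in> crossed"
    unfolding E_def using unit' by (intro reg_in_crossed pc_single_in_alg) auto
  have RE: "Rep_ell2 (blinfun_apply E \<xi>) (y, k) =
      (if y \<in> Y \<and> k \<in> fibre y then Rep_ell2 \<xi> (y, k) else 0)" for \<xi> y k
    unfolding E_def using act_in[of k y] fibreD(1)[of k y] by (auto simp: Rep_reg_single[OF one_closed unit'])
  have ET: "E o\<^sub>L T = T" if T: "T \<in> crossed" for T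
  proof (intro blinfun_eqI ell2_eqI)
    fix \<xi> and i :: "'y \<times> 'g"
    obtain y k where [simp]: "i = (y, k)" by (cases i)
    have "Rep_ell2 (blinfun_apply T \<xi>) i = 0 * Rep_ell2 (blinfun_apply T \<xi>) i" if "\<not> (y \<in> Y \<and> k \<in> fibre y)"
      using T by (rule crossed_coefficient) (use that in \<open>auto simp: Rep_reg\<close>)
    then show "Rep_ell2 (blinfun_apply (E o\<^sub>L T) \<xi>) i = Rep_ell2 (blinfun_apply T \<xi>) i"
      by (simp add: RE)
  qed
  have TE: "T o\<^sub>L E = T" if T: "T \<in> crossed" for T
  proof (intro blinfun_eqI ell2_eqI)
    fix \<xi> and i :: "'y \<times> 'g"
    obtain y k where [simp]: "i = (y, k)" by (cases i)
    have "Rep_ell2 (blinfun_apply T (blinfun_apply E \<xi>)) i = 1 * Rep_ell2 (blinfun_apply T \<xi>) i"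
      using T by (rule crossed_coefficient) (auto simp: Rep_reg RE intro!: sum.cong)
    then show "Rep_ell2 (blinfun_apply (T o\<^sub>L E) \<xi>) i = Rep_ell2 (blinfun_apply T \<xi>) i" by simp
  qed
  have "E \<noteq> 0"
  proof
    assume E0: "E = 0"
    obtain y where y: "y \<in> Y" using assms(1) by blast
    then have "Rep_ell2 (blinfun_apply E (ell2_delta (y, \<one>))) (y, \<one>) = 1"
      by (simp add: RE ell2_delta.rep_eq pc_fibre_def D1)
    then show False by (simp add: E0 zero_ell2.rep_eq)
  qed
  then have nontriv: "crossed \<noteq> {0}" using EA by blast
  have "I = crossed" if I: "closed_two_sided_ideal crossed I" and I0: "I \<noteq> {0}" for I
  proof -
    note ideal = I[unfolded closed_two_sided_ideal_def]
    have sub: "I \<subseteq> crossed" and cl: "closed I" using ideal by auto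
    have add: "S + T \<in> I" if "S \<in> I" "T \<in> I" for S T using ideal that by blast
    have scale: "scaleC_op c T \<in> I" if "T \<in> I" for c T using ideal that by blast
    have left: "S o\<^sub>L T \<in> I" and right: "T o\<^sub>L S \<in> I" if "S \<in> crossed" "T \<in> I" for S T
      using ideal that by blast+
    have diff: "S - T \<in> I" if "S \<in> I" "T \<in> I" for S T
    proof -
      have "scaleC_op (-1) T = - T"
        by (intro blinfun_eqI ell2_eqI)
          (simp add: scaleC_op_apply scaleC_ell2.rep_eq uminus_ell2.rep_eq blinfun.minus_left)
      then show ?thesis using add[OF that(1) scale[OF that(2), of "-1"]] by simp
    qed
    obtain T where T: "T \<in> I" "T \<noteq> 0" using I0 ideal by blast
    obtain y k h where y: "y \<in> Y" and k: "k \<in> fibre y" and h: "h \<in> fibre y"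
      and Tc: "Rep_ell2 (blinfun_apply T (ell2_delta (y, k))) (y, h) \<noteq> 0"
      using crossed_nonzero_coefficient T sub by (metis subsetD)
    note kh [simp] = fibreD(1)[OF k] fibreD(1)[OF h]
    \<comment> \<open>Translation by \<open>g\<close> sends \<open>h\<close> to \<open>k\<close>, so
      multiplying by a one-term element at \<open>g\<close> moves the entry from row
      \<open>h\<close> to row \<open>k\<close>. The point \<open>w = act k y\<close> lies in the
      range of \<open>g\<close>, where \<open>sep\<close> gives a function that is nonzero at
      \<open>w\<close>.\<close>
    define g where "g = k \<otimes> inv h"
    have g: "g \<in> carrier G" by (simp add: g_def)
    have gk: "inv g \<otimes> k = h" by (simp add: g_def inv_mult_group m_assoc)
    define w where "w = act k y"
    have "w \<in> D (inv g)"
      using pa_fibre(1)[OF is_group pa _ k, of "inv g"] g gk h by (simp add: w_def)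
    then obtain f where f: "f \<in> C0 (D (inv g))" "f w \<noteq> 0" using sep g by blast
    define S where "S = reg (pc_single g f) o\<^sub>L T"
    have SI: "S \<in> I"
      unfolding S_def using T(1) g f(1) by (intro left reg_in_crossed pc_single_in_alg)
    define c where "c = Rep_ell2 (blinfun_apply S (ell2_delta (y, k))) (y, k)"
    have c: "c \<noteq> 0"
      using Tc f(2) y k h by (simp add: w_def c_def S_def Rep_reg_single[OF g f(1)] gk)
    \<comment> \<open>Later \<open>a \<one>\<close> stays within \<open>2 * e\<close> of
      \<open>c\<close> on the chosen set, which costs 1/2 after division by \<open>c\<close>;
      replacing \<open>S\<close> by \<open>reg a\<close> costs another 1/4. The total 3/4 is below
      1.\<close>
    define e where "e = norm c / 4"
    have e: "0 < e" using c by (simp add: e_def)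
    obtain a where a: "a \<in> pc_alg G D" and Sa: "norm (S - reg a) < e"
      using crossed_approx[OF subsetD[OF sub SI] e] .
    have "norm (c - Rep_ell2 (blinfun_apply (reg a) (ell2_delta (y, k))) (y, k)) < e"
      unfolding c_def using coefficient_diff_le Sa by (rule le_less_trans)
    then have ca: "norm (c - a \<one> w) < e"
      using y k by (simp add: w_def Rep_reg_delta[OF a])
    have "a \<one> \<in> C0 (D (inv \<one>))" using a one_closed unfolding pc_alg_def by blast
    then have "a \<one> \<in> C0 Y" using D1 by simp
    then have "continuous_on Y (a \<one>)" by (simp add: C0_def)
    then have "\<exists>U. open U \<and> U \<inter> Y = a \<one> -` ball (a \<one> w) e \<inter> Y"
      by (rule continuous_on_open_invariant[THEN iffD1, rule_format, OF _ open_ball])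
    then obtain U where U: "open U" "U \<inter> Y = a \<one> -` ball (a \<one> w) e \<inter> Y" by blast
    have fin: "finite (pc_supp a)" and asub: "pc_supp a \<subseteq> carrier G" using a by (auto simp: pc_alg_def)
    have wY: "w \<in> Y" using act_in[OF k] by (simp add: w_def)
    have "w \<in> U" using U(2) wY e by auto
    then obtain p where p: "p \<in> carrier G" and Dp: "D p = Y" and iC0: "indicator (D (inv p)) \<in> C0 (D (inv p))"
      and pU: "D (inv p) \<subseteq> U"
      and disj: "\<And>g z. g \<in> pc_supp a \<Longrightarrow> g \<noteq> \<one> \<Longrightarrow> z \<in> D g \<Longrightarrow> z \<in> D (inv p) \<Longrightarrow> act g z \<notin> D (inv p)"
    proof -
      have *: "finite (pc_supp a - {\<one>})" "pc_supp a - {\<one>} \<subseteq> carrier G - {\<one>}" using fin asub by auto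
      show thesis using contr[OF wY U(1) \<open>w \<in> U\<close> *] that by (elim bexE conjE) blast
    qed
    \<comment> \<open>\<open>V\<close> sends the basis vector at \<open>(y, k)\<close> to the one at
      \<open>(y, p \<otimes> k)\<close> and \<open>W\<close> reverses this. Since \<open>p\<close>
      is total, nothing is lost on the range of \<open>E\<close>.\<close>
    define V where "V = reg (pc_single p (indicator (D (inv p))))"
    define W where "W = reg (pc_single (inv p) (indicator Y))"
    have ip: "inv p \<in> carrier G" using p by simp
    have unitp: "indicator Y \<in> C0 (D (inv (inv p)))" using unit p Dp by simp
    have VA: "V \<in> crossed" and WA: "W \<in> crossed"
      unfolding V_def W_def using p ip iC0 unitp by (auto intro!: reg_in_crossed pc_single_in_alg)
    have nV: "norm V \<le> 1" and nW: "norm W \<le> 1"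
      unfolding V_def W_def using p ip iC0 unitp by (auto intro!: norm_reg_single_le simp: indicator_def)
    define B where "B = W o\<^sub>L reg a o\<^sub>L V"
    have pk: "p \<otimes> k \<in> fibre y" "act (p \<otimes> k) y \<in> D (inv p)" if "y \<in> Y" "k \<in> fibre y" for y k
    proof -
      have "act k y \<in> D p" using act_in[OF that(2)] Dp by simp
      then show "p \<otimes> k \<in> fibre y" using pa_fibre(1)[OF is_group pa p that(2)] by simp
      then show "act (p \<otimes> k) y \<in> D (inv p)"
        using pa_fibre(2)[OF is_group pa p that(2)] pa_inv(1)[OF is_group pa p \<open>act k y \<in> D p\<close>] by simp
    qed
    have RB: "Rep_ell2 (blinfun_apply B \<xi>) (y, k) =
        (if y \<in> Y \<and> k \<in> fibre y then a \<one> (act (p \<otimes> k) y) * Rep_ell2 \<xi> (y, k) else 0)" for \<xi> y k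
    proof (cases "y \<in> Y \<and> k \<in> fibre y")
      case True
      then have y: "y \<in> Y" and k: "k \<in> fibre y" by auto
      note kc = fibreD(1)[OF k]
      note pk' = pk[OF y k]
      have "Rep_ell2 (blinfun_apply B \<xi>) (y, k) =
          Rep_ell2 (blinfun_apply (reg a) (blinfun_apply V \<xi>)) (y, p \<otimes> k)"
        unfolding B_def W_def using y k pk' act_in[OF k] p by (simp add: Rep_reg_single[OF ip unitp])
      also have "\<dots> = (\<Sum>g\<in>pc_supp a. if inv g \<otimes> (p \<otimes> k) \<in> fibre y
          then a g (act (p \<otimes> k) y) * Rep_ell2 (blinfun_apply V \<xi>) (y, inv g \<otimes> (p \<otimes> k)) else 0)"
        using y pk' by (simp add: Rep_reg[OF a])
      also have "\<dots> = (\<Sum>g\<in>pc_supp a. if g = \<one> then a \<one> (act (p \<otimes> k) y) * Rep_ell2 \<xi> (y, k) else 0)"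
      proof (rule sum.cong)
        fix g assume g: "g \<in> pc_supp a"
        then have gc: "g \<in> carrier G" using asub by blast
        let ?m = "inv g \<otimes> (p \<otimes> k)"
        show "(if ?m \<in> fibre y then a g (act (p \<otimes> k) y) * Rep_ell2 (blinfun_apply V \<xi>) (y, ?m) else 0) =
            (if g = \<one> then a \<one> (act (p \<otimes> k) y) * Rep_ell2 \<xi> (y, k) else 0)"
        proof (cases "g = \<one>")
          case True
          moreover have "inv p \<otimes> (p \<otimes> k) = k" using p kc by (simp add: m_assoc[symmetric])
          ultimately show ?thesis using y k pk' kc p by (simp add: V_def Rep_reg_single[OF p iC0])
        next
          case False
          \<comment> \<open>If this term survived, \<open>act ?m y\<close> and its image under
            \<open>g\<close>, which is \<open>act (p \<otimes> k) y\<close>, would both lie in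
            \<open>D (inv p)\<close>.\<close>
          have "act ?m y \<notin> D (inv p)" if m: "?m \<in> fibre y"
          proof
            assume *: "act ?m y \<in> D (inv p)"
            have gm: "g \<otimes> ?m = p \<otimes> k" using gc p kc by (simp add: m_assoc[symmetric])
            have "act ?m y \<in> D g" "act g (act ?m y) = act (p \<otimes> k) y"
              using pa_fibre[OF is_group pa gc m] pk' by (simp_all add: gm)
            then show False using disj[OF g False _ *] pk' by simp
          qed
          then show ?thesis using False by (simp add: V_def Rep_reg_single[OF p iC0])
        qed
      qed simp
      also have "\<dots> = a \<one> (act (p \<otimes> k) y) * Rep_ell2 \<xi> (y, k)"
        using fin by (auto simp: pc_supp_def)
      finally show ?thesis using True by simp
    next
      case False
      then show ?thesis by (auto simp: B_def W_def Rep_reg_single[OF ip unitp])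
    qed
    \<comment> \<open>No inverse of \<open>X\<close> is formed. Polynomials in \<open>X\<close>
      without constant term lie in \<open>I\<close>; the Neumann partial sums multiplied by
      \<open>X\<close> are of this kind and converge to \<open>E\<close>, so closedness of
      \<open>I\<close> suffices.\<close>
    define X where "X = scaleC_op (1/c) (W o\<^sub>L S o\<^sub>L V)"
    have XI: "X \<in> I" unfolding X_def by (intro scale right left SI VA WA)
    have nsc: "norm (scaleC_ell2 b x) \<le> norm b * norm x" for b and x :: "('y \<times> 'g) ell2"
      by (rule norm_ell2_le_pointwise) (auto simp: scaleC_ell2.rep_eq norm_mult)
    have nX: "norm (E - X) \<le> 3/4"
    proof (rule norm_blinfun_bound)
      fix \<xi> :: "('y \<times> 'g) ell2"
      let ?u = "blinfun_apply E \<xi> - scaleC_ell2 (1/c) (blinfun_apply B \<xi>)"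
      let ?v = "blinfun_apply (W o\<^sub>L (S - reg a) o\<^sub>L V) \<xi>"
      have eq: "blinfun_apply (E - X) \<xi> = ?u - scaleC_ell2 (1/c) ?v"
        by (rule ell2_eqI)
          (simp add: X_def B_def scaleC_op_apply scaleC_ell2.rep_eq minus_ell2.rep_eq plus_ell2.rep_eq
            blinfun.diff_left blinfun.diff_right algebra_simps)
      have "norm ?u \<le> 1/2 * norm \<xi>"
      proof (rule norm_ell2_le_pointwise)
        fix i :: "'y \<times> 'g"
        obtain y k where i [simp]: "i = (y, k)" by (cases i)
        show "norm (Rep_ell2 ?u i) \<le> 1/2 * norm (Rep_ell2 \<xi> i)"
        proof (cases "y \<in> Y \<and> k \<in> fibre y")
          case True
          let ?z = "act (p \<otimes> k) y"
          have "?z \<in> D (inv p)" using pk(2) True by blast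
          then have "?z \<in> U" "?z \<in> Y" using pU pa_sub[OF is_group pa ip] by auto
          then have "?z \<in> a \<one> -` ball (a \<one> w) e \<inter> Y" unfolding U(2)[symmetric] by (rule IntI)
          then have "dist (a \<one> w) (a \<one> ?z) < e" by simp
          then have "norm (c - a \<one> ?z) < 2 * e"
            using ca norm_triangle_ineq[of "c - a \<one> w" "a \<one> w - a \<one> ?z"] by (simp add: dist_norm)
          then have "norm (c - a \<one> ?z) / norm c \<le> 1/2"
            using c by (simp add: e_def divide_simps)
          moreover have "Rep_ell2 ?u i = (c - a \<one> ?z) / c * Rep_ell2 \<xi> i"
            using True c by (simp add: RE RB minus_ell2.rep_eq scaleC_ell2.rep_eq diff_divide_distrib left_diff_distrib)
          ultimately show ?thesis
            by (simp add: norm_mult norm_divide mult_right_mono del: times_divide_eq_left)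
        next
          case False
          then show ?thesis by (auto simp: RE RB minus_ell2.rep_eq scaleC_ell2.rep_eq)
        qed
      qed simp
      moreover have "norm (scaleC_ell2 (1/c) ?v) \<le> 1/4 * norm \<xi>"
      proof -
        have "norm (W o\<^sub>L (S - reg a) o\<^sub>L V) \<le> norm (W o\<^sub>L (S - reg a)) * norm V"
          by (rule norm_blinfun_compose)
        also have "\<dots> \<le> (norm W * norm (S - reg a)) * norm V"
          by (intro mult_right_mono norm_blinfun_compose) simp
        also have "\<dots> \<le> (1 * e) * 1"
          using nV nW Sa e by (intro mult_mono) auto
        finally have "norm ?v \<le> e * norm \<xi>"
          by (intro order_trans[OF norm_blinfun] mult_right_mono) auto
        then have "norm (1/c) * norm ?v \<le> norm (1/c) * (e * norm \<xi>)" by (intro mult_left_mono) auto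
        also have "\<dots> = 1/4 * norm \<xi>" using c by (simp add: e_def norm_divide)
        finally show ?thesis using nsc[of "1/c" ?v] by linarith
      qed
      ultimately have "norm ?u + norm (scaleC_ell2 (1/c) ?v) \<le> 3/4 * norm \<xi>" by simp
      then show "norm (blinfun_apply (E - X) \<xi>) \<le> 3/4 * norm \<xi>"
        unfolding eq using norm_triangle_ineq4 order_trans by blast
    qed simp
    \<comment> \<open>\<open>Z n\<close> is \<open>E - (E - X) ^ Suc n\<close>.\<close>
    define Z where "Z n = ((\<lambda>Z. X + Z - (X o\<^sub>L Z)) ^^ n) X" for n
    have ZS: "Z (Suc n) = X + Z n - (X o\<^sub>L Z n)" for n by (simp add: Z_def)
    have ZI: "Z n \<in> I" for n
    proof (induction n)
      case 0
      then show ?case by (simp add: Z_def XI)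
    next
      case (Suc n)
      then show ?case unfolding ZS using XI sub by (intro diff add left) auto
    qed
    have nZ: "norm (E - Z n) \<le> (3/4) ^ Suc n" for n
    proof (induction n)
      case 0
      then show ?case using nX by (simp add: Z_def)
    next
      case (Suc n)
      have "E - Z (Suc n) = (E - X) o\<^sub>L (E - Z n)"
      proof (rule blinfun_eqI)
        fix \<xi>
        have 1: "blinfun_apply E (blinfun_apply E \<xi>) = blinfun_apply E \<xi>"
          "blinfun_apply X (blinfun_apply E \<xi>) = blinfun_apply X \<xi>"
          "blinfun_apply E (blinfun_apply (Z n) \<xi>) = blinfun_apply (Z n) \<xi>"
          using ET[OF EA] TE[of X] ET[of "Z n"] XI ZI sub by (metis blinfun_apply_blinfun_compose subsetD)+
        show "blinfun_apply (E - Z (Suc n)) \<xi> = blinfun_apply ((E - X) o\<^sub>L (E - Z n)) \<xi>"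
          by (simp add: ZS blinfun.diff_left blinfun.diff_right blinfun.add_left 1 algebra_simps)
      qed
      then have "norm (E - Z (Suc n)) \<le> norm (E - X) * norm (E - Z n)"
        using norm_blinfun_compose by metis
      also have "\<dots> \<le> 3/4 * (3/4) ^ Suc n" by (intro mult_mono nX Suc) auto
      finally show ?case by simp
    qed
    have "(\<lambda>n. (3/4 :: real) ^ Suc n) \<longlonglongrightarrow> 0"
      by (intro LIMSEQ_Suc LIMSEQ_power_zero) simp
    then have "(\<lambda>n. E - Z n) \<longlonglongrightarrow> 0"
      by (rule Lim_null_comparison[rotated]) (use nZ in auto)
    then have "(\<lambda>n. E - (E - Z n)) \<longlonglongrightarrow> E - 0" by (intro tendsto_diff tendsto_const)
    then have "Z \<longlonglongrightarrow> E" by simp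
    then have "E \<in> I" using closed_sequentially[OF cl] ZI by blast
    then have "T \<in> I" if "T \<in> crossed" for T using left[OF that] TE[OF that] by metis
    then show "I = crossed" using sub by blast
  qed
  then show ?thesis using nontriv unfolding simple_Cstar_algebra_def by blast
qed

end

section \<open>Constructible ideals and the left inverse hull\<close>

locale group_subsemigroup = group G for G :: "('g, 'm) monoid_scheme" (structure) +
  fixes P :: "'g set"
  assumes subsemigroup: "subsemigroup P G"
begin

abbreviation translate (infixr "\<cdot>" 75) where "g \<cdot> X \<equiv> g <#\<^bsub>G\<^esub> X"
abbreviation "J \<equiv> constructible_ideals G P"
abbreviation "Il \<equiv> left_inverse_hull G P"

lemma P_nonempty: "P \<noteq> {}" and P_carrier: "p \<in> P \<Longrightarrow> p \<in> carrier G"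
  and P_mult: "p \<in> P \<Longrightarrow> q \<in> P \<Longrightarrow> p \<otimes> q \<in> P"
  using subsemigroup by (auto simp: subsemigroup_def)

lemma mem_l_coset: "y \<in> g \<cdot> X \<longleftrightarrow> (\<exists>x\<in>X. y = g \<otimes> x)"
  by (auto simp: l_coset_def)

lemma mult_mem_l_coset:
  assumes "g \<in> carrier G" "x \<in> carrier G" "X \<subseteq> carrier G"
  shows "g \<otimes> x \<in> g \<cdot> X \<longleftrightarrow> x \<in> X"
  using assms by (auto simp: mem_l_coset)

lemma mem_l_coset_iff:
  assumes "g \<in> carrier G" "X \<subseteq> carrier G"
  shows "y \<in> g \<cdot> X \<longleftrightarrow> y \<in> carrier G \<and> inv g \<otimes> y \<in> X"
proof
  assume "y \<in> g \<cdot> X"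
  then show "y \<in> carrier G \<and> inv g \<otimes> y \<in> X" using assms by (auto simp: mem_l_coset m_assoc[symmetric])
next
  assume y: "y \<in> carrier G \<and> inv g \<otimes> y \<in> X"
  then have "y = g \<otimes> (inv g \<otimes> y)" using assms(1) by (simp add: m_assoc[symmetric])
  then show "y \<in> g \<cdot> X" using y by (auto simp: mem_l_coset)
qed

lemma l_coset_eq_empty: "g \<cdot> X = {} \<longleftrightarrow> X = {}"
  by (auto simp: l_coset_def)

lemma inv_l_coset:
  assumes "g \<in> carrier G" "X \<subseteq> carrier G"
  shows "inv g \<cdot> (g \<cdot> X) = X"
  using assms by (simp add: lcos_m_assoc lcos_mult_one)

section \<open>Closure properties of constructible ideals\<close>

lemma J_sub: "X \<in> J \<Longrightarrow> X \<subseteq> P"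
proof -
  have "word_ideal G P w \<subseteq> P" for w by (induction w) auto
  then show "X \<in> J \<Longrightarrow> X \<subseteq> P" by (auto simp: constructible_ideals_def)
qed

lemma J_carrier: "X \<in> J \<Longrightarrow> X \<subseteq> carrier G"
  using J_sub P_carrier by blast

lemma J_empty: "{} \<in> J"
  by (simp add: constructible_ideals_def)

lemma J_P: "P \<in> J"
proof -
  have "P = word_ideal G P []" by simp
  then show ?thesis unfolding constructible_ideals_def by fastforce
qed

lemma J_quotient:
  assumes "p \<in> P" "q \<in> P" "X \<in> J"
  shows "{y \<in> P. p \<otimes> y \<in> q \<cdot> X} \<in> J"
proof (cases "X = {}")
  case True
  then show ?thesis using J_empty by (simp add: l_coset_def)
next
  case False
  then obtain w where w: "X = word_ideal G P w" "set w \<subseteq> P \<times> P"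
    using assms(3) by (auto simp: constructible_ideals_def)
  then have "{y \<in> P. p \<otimes> y \<in> q \<cdot> X} = word_ideal G P ((p, q) # w)" "set ((p, q) # w) \<subseteq> P \<times> P"
    using assms by auto
  then show ?thesis unfolding constructible_ideals_def by blast
qed

text \<open>Words pair every preimage with a translation, and \<open>P\<close> may lack an identity.
  So translation by \<open>p\<close> alone is written as the preimage under \<open>p\<close> of
  translation by \<open>p \<otimes> p\<close>; \<open>J_preimage\<close> uses the mirror image of
  this trick.\<close>

lemma J_translate:
  assumes "p \<in> P" "X \<in> J"
  shows "p \<cdot> X \<in> J"
proof -
  have "{y \<in> P. p \<otimes> y \<in> (p \<otimes> p) \<cdot> X} = p \<cdot> X"
    using assms P_carrier P_mult J_sub[OF assms(2)] by (auto simp: mem_l_coset m_assoc subset_eq)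
  then show ?thesis using J_quotient[of p "p \<otimes> p" X] assms P_mult by simp
qed

lemma J_preimage:
  assumes "p \<in> P" "X \<in> J"
  shows "{y \<in> P. p \<otimes> y \<in> X} \<in> J"
proof -
  have "{y \<in> P. (p \<otimes> p) \<otimes> y \<in> p \<cdot> X} = {y \<in> P. p \<otimes> y \<in> X}"
    using assms P_carrier P_mult J_carrier[OF assms(2)] by (auto simp: m_assoc mult_mem_l_coset)
  then show ?thesis using J_quotient[of "p \<otimes> p" p X] assms P_mult by simp
qed

lemma J_right_ideal:
  assumes "X \<in> J" "x \<in> X" "p \<in> P"
  shows "x \<otimes> p \<in> X"
proof -
  have "x \<otimes> p \<in> word_ideal G P w" if "set w \<subseteq> P \<times> P" "x \<in> word_ideal G P w" for w x
    using that
  proof (induction w arbitrary: x)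
    case Nil
    then show ?case using assms(3) P_mult by simp
  next
    case (Cons ab w)
    obtain a b where ab: "ab = (a, b)" "a \<in> P" "b \<in> P" using Cons.prems by (cases ab) auto
    obtain z where z: "x \<in> P" "z \<in> word_ideal G P w" "a \<otimes> x = b \<otimes> z"
      using Cons.prems ab(1) by (auto simp: mem_l_coset)
    have zp: "z \<otimes> p \<in> word_ideal G P w" using Cons z(2) by simp
    have "word_ideal G P w \<in> J" using Cons.prems unfolding constructible_ideals_def by auto
    then have zc: "z \<in> carrier G" using J_carrier z(2) by blast
    have "a \<otimes> (x \<otimes> p) = (a \<otimes> x) \<otimes> p" using ab z(1) assms(3) P_carrier by (simp add: m_assoc)
    also have "\<dots> = b \<otimes> (z \<otimes> p)" unfolding z(3) using ab zc assms(3) P_carrier by (simp add: m_assoc)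
    finally show ?case using ab(1) z(1) zp assms(3) P_mult by (auto simp: mem_l_coset)
  qed
  then show ?thesis using assms by (auto simp: constructible_ideals_def)
qed

text \<open>Lets a cylinder be shrunk to the image of a single semigroup element.\<close>

lemma J_principal_sub:
  assumes "X \<in> J" "x \<in> X"
  shows "x \<cdot> P \<subseteq> X"
  using J_right_ideal[OF assms] by (auto simp: mem_l_coset)

text \<open>Induction on the word of the first ideal with the second one arbitrary: intersecting
  a^-1(bW) with Y gives a^-1(b(W \<inter> b^-1(aY))), and the inner intersection falls under the
  induction hypothesis.\<close>

lemma J_Int:
  assumes "X \<in> J" "Y \<in> J"
  shows "X \<inter> Y \<in> J"
proof -
  have "word_ideal G P w \<inter> Y \<in> J" if "set w \<subseteq> P \<times> P" "Y \<in> J" for w Y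
    using that
  proof (induction w arbitrary: Y)
    case Nil
    then show ?case using J_sub[OF Nil(2)] by (simp add: Int_absorb1)
  next
    case (Cons ab w)
    obtain a b where ab: "ab = (a, b)" "a \<in> P" "b \<in> P" using Cons.prems by (cases ab) auto
    let ?W = "word_ideal G P w" and ?Z = "{z \<in> P. b \<otimes> z \<in> a \<cdot> Y}"
    have W: "?W \<in> J" using Cons.prems unfolding constructible_ideals_def by auto
    have Z: "?Z \<in> J" by (rule J_quotient) (use ab Cons.prems in auto)
    then have "{y \<in> P. a \<otimes> y \<in> b \<cdot> (?W \<inter> ?Z)} \<in> J" using ab Cons by (intro J_quotient) auto
    moreover have "{y \<in> P. a \<otimes> y \<in> b \<cdot> (?W \<inter> ?Z)} = word_ideal G P (ab # w) \<inter> Y"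
    proof (intro Set.set_eqI iffI)
      fix y assume "y \<in> {y \<in> P. a \<otimes> y \<in> b \<cdot> (?W \<inter> ?Z)}"
      then obtain z where z: "y \<in> P" "a \<otimes> y = b \<otimes> z" "z \<in> ?W" "z \<in> ?Z" by (auto simp: mem_l_coset)
      then have "a \<otimes> y \<in> a \<cdot> Y" by simp
      then have "y \<in> Y"
        using mult_mem_l_coset[of a y Y] ab z(1) P_carrier J_carrier[OF Cons.prems(2)] by simp
      then show "y \<in> word_ideal G P (ab # w) \<inter> Y" using ab z by (auto simp: mem_l_coset)
    next
      fix y assume y: "y \<in> word_ideal G P (ab # w) \<inter> Y"
      then obtain z where z: "y \<in> P" "y \<in> Y" "z \<in> ?W" "a \<otimes> y = b \<otimes> z"
        using ab by (auto simp: mem_l_coset)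
      then have "b \<otimes> z \<in> a \<cdot> Y" using mem_l_coset by metis
      then have "z \<in> ?W \<inter> ?Z" using z J_sub[OF W] by auto
      then show "y \<in> {y \<in> P. a \<otimes> y \<in> b \<cdot> (?W \<inter> ?Z)}" using z by (auto simp: mem_l_coset)
    qed
    ultimately show ?case by simp
  qed
  moreover have "{} \<inter> Y \<in> J" using J_empty by simp
  ultimately show ?thesis using assms unfolding constructible_ideals_def by auto
qed

section \<open>The inverse hull as partial translations\<close>

definition translation :: "'g \<Rightarrow> 'g set \<Rightarrow> 'g \<rightharpoonup> 'g" where
  "translation g W = (\<lambda>x. if x \<in> W then Some (g \<otimes> x) else None)"

lemma dom_translation: "dom (translation g W) = W"
  by (auto simp: translation_def split: if_splits)

lemma ran_translation: "ran (translation g W) = g \<cdot> W"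
  by (auto simp: translation_def ran_def mem_l_coset)

lemma pinverse_translation:
  assumes "g \<in> carrier G" "W \<subseteq> carrier G"
  shows "pinverse (translation g W) = translation (inv g) (g \<cdot> W)"
proof
  fix y
  show "pinverse (translation g W) y = translation (inv g) (g \<cdot> W) y"
  proof (cases "y \<in> g \<cdot> W")
    case True
    then obtain x where x: "x \<in> W" "y = g \<otimes> x" by (auto simp: mem_l_coset)
    have "(THE x. translation g W x = Some y) = x"
      using x assms by (intro the_equality) (auto simp: translation_def subset_eq split: if_splits)
    moreover have "inv g \<otimes> y = x" using x assms by (auto simp: m_assoc[symmetric])
    ultimately show ?thesis using True
      unfolding pinverse_def ran_translation by (simp add: translation_def)
  next
    case False
    then show ?thesis unfolding pinverse_def ran_translation by (simp add: translation_def)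
  qed
qed

lemma comp_translation:
  assumes "g \<in> carrier G" "h \<in> carrier G" "V \<subseteq> carrier G"
  shows "translation g W \<circ>\<^sub>m translation h V = translation (g \<otimes> h) {x \<in> V. h \<otimes> x \<in> W}"
  using assms by (auto simp: translation_def map_comp_def m_assoc subset_eq fun_eq_iff)

lemma left_mult_translation: "left_mult G P p = translation p P"
  by (simp add: left_mult_def translation_def)

lemma group_element_translation:
  assumes "g \<in> carrier G" "W \<subseteq> carrier G" "W \<noteq> {}"
  shows "group_element G (translation g W) = g"
  unfolding group_element_def dom_translation
proof (rule the_equality)
  show "g \<in> carrier G \<and> (\<forall>x\<in>W. translation g W x = Some (g \<otimes> x))"
    using assms(1) by (simp add: translation_def)
  fix h assume h: "h \<in> carrier G \<and> (\<forall>x\<in>W. translation g W x = Some (h \<otimes> x))"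
  obtain x where "x \<in> W" using assms(3) by blast
  then show "h = g" using h assms by (auto simp: translation_def subset_eq)
qed

lemma pullback_eq:
  assumes "g \<in> carrier G" "W \<subseteq> carrier G"
  shows "{x \<in> W. g \<otimes> x \<in> X} = inv g \<cdot> (g \<cdot> W \<inter> X)"
proof -
  have "g \<cdot> W \<inter> X \<subseteq> carrier G" using l_coset_subset_G[OF assms(2,1)] by blast
  then show ?thesis
    using assms by (auto simp: mem_l_coset_iff[of "inv g"] mult_mem_l_coset subset_eq)
qed

text \<open>The induction invariant for the hull. Quantifying over all constructible ideals inside
  the domain makes it survive restriction, hence composition; treating \<open>g\<close> and
  \<open>inv g\<close> alike makes it survive inversion.\<close>

definition bitranslates :: "'g \<Rightarrow> 'g set \<Rightarrow> bool" where
  "bitranslates g W \<longleftrightarrow> W \<in> J \<and> (\<forall>Z\<in>J. Z \<subseteq> W \<longrightarrow> g \<cdot> Z \<in> J) \<and>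
    (\<forall>Z\<in>J. Z \<subseteq> g \<cdot> W \<longrightarrow> inv g \<cdot> Z \<in> J)"

lemma bitranslatesD:
  assumes "bitranslates g W"
  shows "W \<in> J" "Z \<in> J \<Longrightarrow> Z \<subseteq> W \<Longrightarrow> g \<cdot> Z \<in> J" "Z \<in> J \<Longrightarrow> Z \<subseteq> g \<cdot> W \<Longrightarrow> inv g \<cdot> Z \<in> J"
  using assms by (auto simp: bitranslates_def)

lemma bitranslatesI:
  assumes "W \<in> J" "\<And>Z. Z \<in> J \<Longrightarrow> Z \<subseteq> W \<Longrightarrow> g \<cdot> Z \<in> J"
    "\<And>Z. Z \<in> J \<Longrightarrow> Z \<subseteq> g \<cdot> W \<Longrightarrow> inv g \<cdot> Z \<in> J"
  shows "bitranslates g W"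
  using assms by (auto simp: bitranslates_def)

lemma hull_translation:
  assumes "s \<in> Il"
  shows "\<exists>g W. g \<in> carrier G \<and> s = translation g W \<and> bitranslates g W"
  using assms
proof (induction rule: left_inverse_hull.induct)
  case zero
  have "Map.empty = translation \<one> {}" by (simp add: translation_def)
  moreover have "g \<cdot> {} = {}" for g by (simp add: l_coset_def)
  then have "bitranslates \<one> {}" using J_empty by (intro bitranslatesI) auto
  ultimately show ?case using one_closed by blast
next
  case (left_mult p)
  have "inv p \<cdot> Z \<in> J" if Z: "Z \<in> J" "Z \<subseteq> p \<cdot> P" for Z
  proof -
    have "inv p \<cdot> Z = {x \<in> P. p \<otimes> x \<in> Z}"
      using pullback_eq[of p P Z] left_mult P_carrier Z(2) by (simp add: Int_absorb1 subset_eq)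
    then show ?thesis using J_preimage[OF left_mult Z(1)] by simp
  qed
  then have "bitranslates p P" using J_P J_translate[OF left_mult] by (simp add: bitranslates_def)
  then show ?case using P_carrier[OF left_mult] left_mult_translation by blast
next
  case (inverse s)
  then obtain g W where g: "g \<in> carrier G" and s: "s = translation g W" and gW: "bitranslates g W" by blast
  note W = bitranslatesD(1)[OF gW] and 1 = bitranslatesD(2)[OF gW] and 2 = bitranslatesD(3)[OF gW]
  have "inv g \<cdot> (g \<cdot> W) = W" using g J_carrier[OF W] by (rule inv_l_coset)
  then have "bitranslates (inv g) (g \<cdot> W)" using 1 2 g W by (intro bitranslatesI) auto
  moreover have "pinverse s = translation (inv g) (g \<cdot> W)"
    using s g J_carrier[OF W] by (simp add: pinverse_translation)
  ultimately show ?case using inv_closed[OF g] by blast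
next
  case (comp s t)
  from comp.IH(1) obtain g W where g: "g \<in> carrier G" and s: "s = translation g W"
    and gW: "bitranslates g W" by blast
  note W = bitranslatesD(1)[OF gW] and g1 = bitranslatesD(2)[OF gW] and g2 = bitranslatesD(3)[OF gW]
  from comp.IH(2) obtain h V where h: "h \<in> carrier G" and t: "t = translation h V"
    and hV: "bitranslates h V" by blast
  note V = bitranslatesD(1)[OF hV] and h1 = bitranslatesD(2)[OF hV] and h2 = bitranslatesD(3)[OF hV]
  let ?U = "{x \<in> V. h \<otimes> x \<in> W}"
  \<comment> \<open>The domain of the composite is reached by moving \<open>V\<close> forward by
    \<open>h\<close>, intersecting with \<open>W\<close>, and coming back; each stage stays
    constructible by the invariant for \<open>h\<close>.\<close>
  have "inv h \<cdot> (h \<cdot> V \<inter> W) \<in> J" using h1 h2 J_Int V W by simp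
  then have U: "?U \<in> J" using pullback_eq[OF h J_carrier[OF V]] by simp
  have gh: "g \<otimes> h \<in> carrier G" using g h by simp
  have st: "s \<circ>\<^sub>m t = translation (g \<otimes> h) ?U"
    unfolding s t using g h J_carrier[OF V] by (rule comp_translation)
  have F: "(g \<otimes> h) \<cdot> Z \<in> J" if Z: "Z \<in> J" "Z \<subseteq> ?U" for Z
  proof -
    have "h \<cdot> Z \<in> J" using Z by (intro h1) auto
    moreover have "h \<cdot> Z \<subseteq> W" using Z(2) by (auto simp: l_coset_def)
    ultimately have "g \<cdot> (h \<cdot> Z) \<in> J" by (rule g1)
    then show ?thesis using g h J_carrier[OF Z(1)] by (simp add: lcos_m_assoc)
  qed
  have B: "inv (g \<otimes> h) \<cdot> Z \<in> J" if Z: "Z \<in> J" "Z \<subseteq> (g \<otimes> h) \<cdot> ?U" for Z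
  proof -
    have Zg: "Z \<subseteq> g \<cdot> (h \<cdot> ?U)" using Z(2) g h J_carrier[OF U] by (simp add: lcos_m_assoc)
    moreover have "g \<cdot> (h \<cdot> ?U) \<subseteq> g \<cdot> W" by (auto simp: l_coset_def)
    ultimately have Z1: "inv g \<cdot> Z \<in> J" using Z(1) by (intro g2) auto
    have "inv g \<cdot> Z \<subseteq> inv g \<cdot> (g \<cdot> (h \<cdot> ?U))" using Zg by (auto simp: l_coset_def)
    also have "\<dots> = h \<cdot> ?U"
      using g h J_carrier[OF U] by (intro inv_l_coset l_coset_subset_G) auto
    also have "\<dots> \<subseteq> h \<cdot> V" by (auto simp: l_coset_def)
    finally have "inv h \<cdot> (inv g \<cdot> Z) \<in> J" by (rule h2[OF Z1])
    then show ?thesis using g h J_carrier[OF Z(1)] by (simp add: lcos_m_assoc inv_mult_group)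
  qed
  have "bitranslates (g \<otimes> h) ?U" using U F B by (rule bitranslatesI)
  then show ?case using gh st by blast
qed

text \<open>The identity on the domain of \<open>s\<close> is
  \<open>pinverse s \<circ>\<^sub>m s\<close>. For a word starting with \<open>(a, b)\<close>, the
  map \<open>s\<close> is multiplication by \<open>a\<close> followed by the inverse of
  multiplication by \<open>b\<close> restricted to the ideal of the tail.\<close>

lemma identity_in_hull:
  assumes "X \<in> J"
  shows "translation \<one> X \<in> Il"
proof -
  have dom_id: "translation \<one> W \<in> Il" if s: "translation g W \<in> Il" "g \<in> carrier G" "W \<subseteq> carrier G" for g W
  proof -
    have "pinverse (translation g W) \<circ>\<^sub>m translation g W = translation (inv g \<otimes> g) {x \<in> W. g \<otimes> x \<in> g \<cdot> W}"
      using s by (simp add: pinverse_translation comp_translation)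
    also have "{x \<in> W. g \<otimes> x \<in> g \<cdot> W} = W" by (auto simp: l_coset_def)
    finally show ?thesis
      using left_inverse_hull.comp[OF left_inverse_hull.inverse[OF s(1)] s(1)] s(2) by simp
  qed
  have P: "translation \<one> P \<in> Il"
  proof -
    obtain p where p: "p \<in> P" using P_nonempty by blast
    then have "translation p P \<in> Il"
      using left_inverse_hull.left_mult[of p P G] by (simp add: left_mult_translation)
    then show ?thesis using p P_carrier by (intro dom_id[of p]) auto
  qed
  have "translation \<one> (word_ideal G P w) \<in> Il" if "set w \<subseteq> P \<times> P" for w
    using that
  proof (induction w)
    case Nil
    then show ?case using P by simp
  next
    case (Cons ab w)
    obtain a b where ab: "ab = (a, b)" "a \<in> P" "b \<in> P" using Cons.prems by (cases ab) auto
    let ?W = "word_ideal G P w"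
    have W: "?W \<in> J" using Cons.prems unfolding constructible_ideals_def by auto
    have IH: "translation \<one> ?W \<in> Il" using Cons by simp
    have a: "translation a P \<in> Il" and b: "translation b P \<in> Il"
      using left_inverse_hull.left_mult ab by (metis left_mult_translation)+
    have c: "a \<in> carrier G" "b \<in> carrier G" "P \<subseteq> carrier G" using ab P_carrier by auto
    have "translation b P \<circ>\<^sub>m translation \<one> ?W = translation b ?W"
    proof -
      have "{x \<in> ?W. \<one> \<otimes> x \<in> P} = ?W" using J_sub[OF W] J_carrier[OF W] by (auto simp: subset_eq)
      then show ?thesis using c J_carrier[OF W] by (simp add: comp_translation)
    qed
    then have "translation b ?W \<in> Il" using left_inverse_hull.comp[OF b IH] by simp
    then have "translation (inv b) (b \<cdot> ?W) \<in> Il"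
      using left_inverse_hull.inverse pinverse_translation[OF c(2) J_carrier[OF W]] by metis
    from left_inverse_hull.comp[OF this a]
    have "translation (inv b \<otimes> a) {x \<in> P. a \<otimes> x \<in> b \<cdot> ?W} \<in> Il"
      using c by (simp add: comp_translation)
    then show ?case using dom_id[of "inv b \<otimes> a" "{x \<in> P. a \<otimes> x \<in> b \<cdot> ?W}"] c ab by auto
  qed
  moreover have "translation \<one> {} \<in> Il"
    using left_inverse_hull.zero[of G P] by (simp add: translation_def)
  ultimately show ?thesis using assms by (auto simp: constructible_ideals_def)
qed

text \<open>The nonzero hull elements in coordinates. Nonemptiness of \<open>W\<close> makes the
  group element unique. Unlike \<open>bitranslates\<close>, this demands membership in the hull, as
  the definition of the partial action does.\<close>

definition translates :: "'g \<Rightarrow> 'g set \<Rightarrow> bool" where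
  "translates g W \<longleftrightarrow> g \<in> carrier G \<and> W \<in> J \<and> W \<noteq> {} \<and> translation g W \<in> Il"

lemma translates_J:
  assumes "translates g W"
  shows "g \<in> carrier G" "W \<in> J" "W \<noteq> {}" "W \<subseteq> carrier G" "g \<cdot> W \<in> J"
proof -
  show g: "g \<in> carrier G" and W: "W \<in> J" and ne: "W \<noteq> {}" using assms by (auto simp: translates_def)
  then show Wc: "W \<subseteq> carrier G" using J_carrier by blast
  obtain h V where hV: "h \<in> carrier G" "translation g W = translation h V" "bitranslates h V"
    using hull_translation[of "translation g W"] assms unfolding translates_def by blast
  then have h: "h \<in> carrier G" "V \<in> J" "translation g W = translation h V" "h \<cdot> V \<in> J"
    using bitranslatesD[OF hV(3)] by auto
  have "V = W" using h(3) dom_translation by metis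
  moreover have "h = g"
    using group_element_translation[OF g Wc ne] group_element_translation[of h V] h \<open>V = W\<close> Wc ne by simp
  ultimately show "g \<cdot> W \<in> J" using h by simp
qed

text \<open>Restriction is composition with the idempotent of \<open>Z\<close>.\<close>

lemma translates_subset:
  assumes "translates g W" "Z \<in> J" "Z \<noteq> {}" "Z \<subseteq> W"
  shows "translates g Z"
proof -
  note W = translates_J[OF assms(1)]
  have "{x \<in> Z. \<one> \<otimes> x \<in> W} = Z" using assms(4) J_carrier[OF assms(2)] by (auto simp: subset_eq)
  then have "translation g W \<circ>\<^sub>m translation \<one> Z = translation g Z"
    using W J_carrier[OF assms(2)] by (simp add: comp_translation)
  then show ?thesis
    using left_inverse_hull.comp[of "translation g W" G P "translation \<one> Z"] identity_in_hull[OF assms(2)] assms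
    by (simp add: translates_def)
qed

lemma translates_inv:
  assumes "translates g W"
  shows "translates (inv g) (g \<cdot> W)"
  using translates_J[OF assms] left_inverse_hull.inverse[of "translation g W" G P] assms
  by (simp add: translates_def pinverse_translation l_coset_eq_empty)

lemma translates_mult:
  assumes "translates h Z" "translates g (h \<cdot> Z)"
  shows "translates (g \<otimes> h) Z"
proof -
  have "{x \<in> Z. h \<otimes> x \<in> h \<cdot> Z} = Z" by (auto simp: l_coset_def)
  then have "translation g (h \<cdot> Z) \<circ>\<^sub>m translation h Z = translation (g \<otimes> h) Z"
    using translates_J[OF assms(1)] translates_J[OF assms(2)] by (simp add: comp_translation)
  then show ?thesis
    using left_inverse_hull.comp[of "translation g (h \<cdot> Z)" G P "translation h Z"]
      translates_J[OF assms(1)] translates_J[OF assms(2)] assms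
    by (simp add: translates_def)
qed

lemma translates_one: "Z \<in> J \<Longrightarrow> Z \<noteq> {} \<Longrightarrow> translates \<one> Z"
  by (simp add: translates_def identity_in_hull)

lemma translates_P: "p \<in> P \<Longrightarrow> translates p P"
  using left_inverse_hull.left_mult[of p P G] P_carrier J_P P_nonempty
  by (simp add: translates_def left_mult_translation)

definition pullback :: "'g \<Rightarrow> 'g set \<Rightarrow> 'g set \<Rightarrow> 'g set" where
  "pullback g W X = {x \<in> W. g \<otimes> x \<in> X}"

text \<open>Outside the empty case, the pullback is the image of the ideal
  \<open>g \<cdot> W \<inter> X\<close> under the inverse translation, which is again a hull
  element.\<close>

lemma pullback_J:
  assumes "translates g W" "X \<in> J"
  shows "pullback g W X \<in> J"
proof (cases "g \<cdot> W \<inter> X = {}")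
  case True
  then have "pullback g W X = {}" by (auto simp: pullback_def l_coset_def)
  then show ?thesis using J_empty by simp
next
  case False
  note W = translates_J[OF assms(1)]
  have "translates (inv g) (g \<cdot> W \<inter> X)"
    using translates_inv[OF assms(1)] False W(5) assms(2) by (rule_tac translates_subset) (auto intro: J_Int)
  then show ?thesis
    using translates_J(5) pullback_eq[OF W(1,4)] by (simp add: pullback_def)
qed

end
section \<open>The boundary\<close>

lemma continuous_on_coordinate: "continuous_on S (\<lambda>\<psi> :: 'a \<Rightarrow> bool. \<psi> X)"
proof -
  have "continuous_on UNIV (\<lambda>\<psi> :: 'a \<Rightarrow> bool. \<psi> X)" by (rule continuous_on_product_coordinates)
  then show ?thesis by (rule continuous_on_subset) simp
qed

lemma open_coordinate: "open {\<psi> :: 'a \<Rightarrow> bool. \<psi> X}" "open {\<psi> :: 'a \<Rightarrow> bool. \<not> \<psi> X}"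
proof -
  have "open ((\<lambda>\<psi> :: 'a \<Rightarrow> bool. \<psi> X) -` B)" for B
    by (intro open_vimage open_discrete continuous_on_coordinate)
  from this[of "{True}"] this[of "{False}"]
  show "open {\<psi> :: 'a \<Rightarrow> bool. \<psi> X}" "open {\<psi> :: 'a \<Rightarrow> bool. \<not> \<psi> X}" by (simp_all add: vimage_def)
qed

lemma closed_coordinate: "closed {\<psi> :: 'a \<Rightarrow> bool. \<psi> X}" "closed {\<psi> :: 'a \<Rightarrow> bool. \<not> \<psi> X}"
  using open_coordinate[of X] by (simp_all add: closed_def Collect_neg_eq[symmetric])

lemma open_bool_fun_basis:
  fixes \<phi> :: "'a \<Rightarrow> bool"
  assumes "open U" "\<phi> \<in> U"
  obtains I where "finite I" "\<And>\<psi>. (\<And>i. i \<in> I \<Longrightarrow> \<psi> i = \<phi> i) \<Longrightarrow> \<psi> \<in> U"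
proof -
  have "openin (product_topology (\<lambda>_. euclidean) UNIV) U"
    using assms(1) by (simp add: euclidean_product_topology)
  from product_topology_open_contains_basis[OF this assms(2)]
  obtain X :: "'a \<Rightarrow> bool set" where X: "\<phi> \<in> (\<Pi>\<^sub>E i\<in>UNIV. X i)" "finite {i. X i \<noteq> UNIV}" "(\<Pi>\<^sub>E i\<in>UNIV. X i) \<subseteq> U"
    by auto
  have "\<psi> \<in> U" if "\<And>i. i \<in> {i. X i \<noteq> UNIV} \<Longrightarrow> \<psi> i = \<phi> i" for \<psi>
  proof -
    have "\<psi> i \<in> X i" for i
      using X(1) that[of i] by (cases "X i = UNIV") (auto simp: PiE_def Pi_def)
    then show ?thesis using X(3) by (auto simp: PiE_def Pi_def)
  qed
  with X(2) show thesis by (rule that)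
qed

lemma compact_UNIV_bool_fun: "compact (UNIV :: ('a \<Rightarrow> bool) set)"
proof -
  have "compact_space (product_topology (\<lambda>_ :: 'a. euclidean :: bool topology) UNIV)"
    unfolding compact_space_product_topology
    by (simp add: compact_space_def finite_imp_compact)
  then show ?thesis by (simp add: compact_space_def euclidean_product_topology)
qed

context group_subsemigroup
begin

abbreviation "spec \<equiv> spectrum G P"
abbreviation "bdry \<equiv> boundary G P"
abbreviation "bdom \<equiv> boundary_dom G P"
abbreviation "bact \<equiv> spectrum_act G P"

section \<open>Characters and maximal characters\<close>

lemma specD:
  assumes "\<phi> \<in> spec"
  shows "\<phi> X \<Longrightarrow> X \<in> J" "\<phi> X \<Longrightarrow> X \<noteq> {}" "\<phi> X \<Longrightarrow> Y \<in> J \<Longrightarrow> X \<subseteq> Y \<Longrightarrow> \<phi> Y"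
    "X \<in> J \<Longrightarrow> Y \<in> J \<Longrightarrow> \<phi> (X \<inter> Y) \<longleftrightarrow> \<phi> X \<and> \<phi> Y" "\<phi> P"
proof -
  show J: "\<phi> X \<Longrightarrow> X \<in> J" for X using assms unfolding spectrum_def by blast
  show "\<phi> X \<Longrightarrow> X \<noteq> {}" using assms unfolding spectrum_def by blast
  show Int: "X \<in> J \<Longrightarrow> Y \<in> J \<Longrightarrow> \<phi> (X \<inter> Y) \<longleftrightarrow> \<phi> X \<and> \<phi> Y" for X Y
    using assms unfolding spectrum_def by blast
  show mono: "\<phi> X \<Longrightarrow> Y \<in> J \<Longrightarrow> X \<subseteq> Y \<Longrightarrow> \<phi> Y" for X Y
    using Int[of X Y] J[of X] by (simp add: Int_absorb2)
  obtain X where "\<phi> X" using assms unfolding spectrum_def by blast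
  then show "\<phi> P" using mono J J_P J_sub by blast
qed

lemma specI:
  assumes "\<And>X. \<phi> X \<Longrightarrow> X \<in> J" "\<phi> P" "\<not> \<phi> {}"
    "\<And>X Y. X \<in> J \<Longrightarrow> Y \<in> J \<Longrightarrow> \<phi> (X \<inter> Y) \<longleftrightarrow> \<phi> X \<and> \<phi> Y"
  shows "\<phi> \<in> spec"
  unfolding spectrum_def using assms by blast

lemma spec_disjoint:
  assumes "\<phi> \<in> spec" "\<phi> X" "\<phi> Y" "X \<inter> Y = {}"
  shows False
  using specD(4)[OF assms(1), of X Y] specD(1,2)[OF assms(1)] assms(2-4) by metis

lemma spec_finite_Inter:
  assumes s: "\<phi> \<in> spec" and "finite S" "\<And>X. X \<in> S \<Longrightarrow> \<phi> X"
  shows "\<exists>Y. \<phi> Y \<and> (\<forall>X\<in>S. Y \<subseteq> X)"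
  using assms(2,3)
proof (induction S rule: finite_induct)
  case empty
  then show ?case using specD(5)[OF s] by auto
next
  case (insert X S)
  then obtain Y where Y: "\<phi> Y" "\<forall>X\<in>S. Y \<subseteq> X" by auto
  have X: "\<phi> X" using insert.prems by simp
  have "\<phi> (X \<inter> Y)" using X Y(1) specD(4)[OF s specD(1)[OF s X] specD(1)[OF s Y(1)]] by simp
  then show ?case using Y(2) by (intro exI[of _ "X \<inter> Y"]) auto
qed

text \<open>Zorn applied to the filters that contain \<open>Z\<close>, a family with the principal
  filter of \<open>Z\<close> as a member. A character above one of these still contains
  \<open>Z\<close>, so maximality in the family is maximality among all characters.\<close>

lemma max_spectrum_exists:
  assumes "Z \<in> J" "Z \<noteq> {}"
  obtains \<omega> where "\<omega> \<in> max_spectrum G P" "\<omega> Z"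
proof -
  define \<A> where "\<A> = {{X. \<omega> X} | \<omega>. \<omega> \<in> spec \<and> \<omega> Z}"
  have AI: "S \<in> \<A>" if "(\<lambda>X. X \<in> S) \<in> spec" "Z \<in> S" for S
    unfolding \<A>_def using that by (intro CollectI exI[of _ "\<lambda>X. X \<in> S"]) auto
  have AD: "(\<lambda>X. X \<in> S) \<in> spec" "Z \<in> S" if "S \<in> \<A>" for S using that by (auto simp: \<A>_def)
  have "{X \<in> J. Z \<subseteq> X} \<in> \<A>"
    using assms J_P J_sub by (intro AI specI) (auto intro: J_Int)
  then have "\<A> \<noteq> {}" by blast
  moreover have "\<Union>\<C> \<in> \<A>" if ne: "\<C> \<noteq> {}" and ch: "subset.chain \<A> \<C>" for \<C>
  proof (intro AI specI)
    have sub: "\<C> \<subseteq> \<A>" using ch by (simp add: subset_chain_def)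
    show "X \<in> J" if "X \<in> \<Union>\<C>" for X using that sub AD(1) specD(1) by blast
    show "Z \<in> \<Union>\<C>" using ne sub AD(2) by blast
    show "P \<in> \<Union>\<C>" using ne sub AD(1) specD(5) by blast
    show "{} \<notin> \<Union>\<C>" using sub AD(1) specD(2) by blast
    fix X Y assume XY: "X \<in> J" "Y \<in> J"
    show "X \<inter> Y \<in> \<Union>\<C> \<longleftrightarrow> X \<in> \<Union>\<C> \<and> Y \<in> \<Union>\<C>"
    proof
      assume "X \<inter> Y \<in> \<Union>\<C>"
      then show "X \<in> \<Union>\<C> \<and> Y \<in> \<Union>\<C>" using sub AD(1) specD(4)[OF _ XY] by blast
    next
      assume "X \<in> \<Union>\<C> \<and> Y \<in> \<Union>\<C>"
      then obtain S T where ST: "S \<in> \<C>" "T \<in> \<C>" "X \<in> S" "Y \<in> T" by blast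
      then have "S \<subseteq> T \<or> T \<subseteq> S" using ch by (auto simp: subset_chain_def)
      then obtain R where R: "R \<in> \<C>" "X \<in> R" "Y \<in> R" using ST by blast
      then have "X \<inter> Y \<in> R" using sub specD(4)[OF AD(1) XY, of R] by blast
      then show "X \<inter> Y \<in> \<Union>\<C>" using R(1) by blast
    qed
  qed
  ultimately obtain M where M: "M \<in> \<A>" "\<And>S. S \<in> \<A> \<Longrightarrow> M \<subseteq> S \<Longrightarrow> S = M"
    using subset_Zorn_nonempty[of \<A>] by blast
  have "(\<lambda>X. X \<in> M) \<in> max_spectrum G P"
    unfolding max_spectrum_def
  proof (intro CollectI conjI ballI impI)
    fix \<psi> assume \<psi>: "\<psi> \<in> spec" "{X. X \<in> M} \<subseteq> {X. \<psi> X}"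
    then have "{X. \<psi> X} \<in> \<A>" using AD(2)[OF M(1)] by (intro AI) auto
    then have "{X. \<psi> X} = M" using \<psi>(2) by (intro M(2)) auto
    then show "\<psi> = (\<lambda>X. X \<in> M)" by auto
  qed (rule AD(1)[OF M(1)])
  then show thesis using AD(2)[OF M(1)] by (rule that)
qed

text \<open>The ultrafilter property: if every member of \<omega> met \<open>f\<close>, the filter
  generated by \<omega> and \<open>f\<close> would be a strictly larger character.\<close>

lemma max_spectrum_disjoint:
  assumes \<omega>: "\<omega> \<in> max_spectrum G P" and f: "f \<in> J" "\<not> \<omega> f"
  obtains W where "\<omega> W" "W \<inter> f = {}"
proof (rule ccontr)
  assume "\<not> thesis"
  then have ne: "W \<inter> f \<noteq> {}" if "\<omega> W" for W using that \<open>\<And>W. \<omega> W \<Longrightarrow> W \<inter> f = {} \<Longrightarrow> thesis\<close> by blast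
  have s: "\<omega> \<in> spec" using \<omega> by (simp add: max_spectrum_def)
  define \<psi> where "\<psi> X \<longleftrightarrow> X \<in> J \<and> (\<exists>W. \<omega> W \<and> W \<inter> f \<subseteq> X)" for X
  have "\<psi> \<in> spec"
  proof (rule specI)
    show "\<psi> X \<Longrightarrow> X \<in> J" for X by (simp add: \<psi>_def)
    show "\<psi> P" using J_P specD(5)[OF s] by (auto simp: \<psi>_def)
    show "\<not> \<psi> {}" using ne by (auto simp: \<psi>_def)
    fix X Y assume XY: "X \<in> J" "Y \<in> J"
    show "\<psi> (X \<inter> Y) \<longleftrightarrow> \<psi> X \<and> \<psi> Y"
    proof
      assume "\<psi> X \<and> \<psi> Y"
      then obtain V W where VW: "\<omega> V" "V \<inter> f \<subseteq> X" "\<omega> W" "W \<inter> f \<subseteq> Y" by (auto simp: \<psi>_def)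
      then have "\<omega> (V \<inter> W)"
        using specD(4)[OF s specD(1)[OF s VW(1)] specD(1)[OF s VW(3)]] by simp
      moreover have "V \<inter> W \<inter> f \<subseteq> X \<inter> Y" using VW by blast
      ultimately show "\<psi> (X \<inter> Y)" using J_Int[OF XY] by (auto simp: \<psi>_def)
    qed (use XY in \<open>auto simp: \<psi>_def\<close>)
  qed
  moreover have "\<omega> X \<Longrightarrow> \<psi> X" for X using specD(1)[OF s] by (auto simp: \<psi>_def)
  ultimately have "\<psi> = \<omega>" using \<omega> by (auto simp: max_spectrum_def)
  moreover have "\<psi> f" using f(1) specD(5)[OF s] by (auto simp: \<psi>_def)
  ultimately show False using f(2) by simp
qed

section \<open>Tight characters\<close>

text \<open>Tightness in the sense of Exel, the description of the closure of the maximal characters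
  by ideals alone. In this form it can be carried along partial translations.\<close>

definition tight :: "('g set \<Rightarrow> bool) \<Rightarrow> bool" where
  "tight \<phi> \<longleftrightarrow> (\<forall>X F. \<phi> X \<longrightarrow> finite F \<longrightarrow> (\<forall>f\<in>F. f \<in> J \<and> \<not> \<phi> f) \<longrightarrow>
    (\<exists>Z\<in>J. Z \<noteq> {} \<and> Z \<subseteq> X \<and> (\<forall>f\<in>F. Z \<inter> f = {})))"

lemma tightD:
  assumes "tight \<phi>" "\<phi> X" "finite F" "\<And>f. f \<in> F \<Longrightarrow> f \<in> J" "\<And>f. f \<in> F \<Longrightarrow> \<not> \<phi> f"
  shows "\<exists>Z\<in>J. Z \<noteq> {} \<and> Z \<subseteq> X \<and> (\<forall>f\<in>F. Z \<inter> f = {})"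
  using assms unfolding tight_def by simp

text \<open>A basic neighbourhood fixes finitely many coordinates. Those in the character have a
  common lower bound \<open>Y\<close>, the omitted ideals are avoided by shrinking \<open>Y\<close>
  to \<open>Z\<close>, and a coordinate that is no constructible ideal is false for every
  character.\<close>

lemma tight_neighbourhood:
  assumes s: "\<phi> \<in> spec" and t: "tight \<phi>" and U: "open U" "\<phi> \<in> U"
  obtains Z where "Z \<in> J" "Z \<noteq> {}" "\<And>\<psi>. \<psi> \<in> spec \<Longrightarrow> \<psi> Z \<Longrightarrow> \<psi> \<in> U"
proof -
  obtain I where I: "finite I" "\<And>\<psi>. (\<And>i. i \<in> I \<Longrightarrow> \<psi> i = \<phi> i) \<Longrightarrow> \<psi> \<in> U"
    using open_bool_fun_basis[OF U] by blast
  have "\<exists>Y. \<phi> Y \<and> (\<forall>X\<in>{i \<in> I. \<phi> i}. Y \<subseteq> X)"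
    using I(1) by (intro spec_finite_Inter[OF s]) auto
  then obtain Y where Y: "\<phi> Y" "\<And>X. X \<in> {i \<in> I. \<phi> i} \<Longrightarrow> Y \<subseteq> X" by blast
  have "\<exists>Z\<in>J. Z \<noteq> {} \<and> Z \<subseteq> Y \<and> (\<forall>f\<in>{i \<in> I. i \<in> J \<and> \<not> \<phi> i}. Z \<inter> f = {})"
    using I(1) by (intro tightD[OF t Y(1)]) auto
  then obtain Z where Z: "Z \<in> J" "Z \<noteq> {}" "Z \<subseteq> Y" "\<And>f. f \<in> I \<Longrightarrow> f \<in> J \<Longrightarrow> \<not> \<phi> f \<Longrightarrow> Z \<inter> f = {}" by blast
  have "\<psi> \<in> U" if \<psi>: "\<psi> \<in> spec" "\<psi> Z" for \<psi>
  proof (rule I(2))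
    fix i assume i: "i \<in> I"
    show "\<psi> i = \<phi> i"
    proof (cases "\<phi> i")
      case True
      then have "Z \<subseteq> i" using Y(2) i Z(3) by blast
      then show ?thesis using True specD(3)[OF \<psi>] specD(1)[OF s] by blast
    next
      case False
      have "\<not> \<psi> i"
      proof
        assume "\<psi> i"
        then have "Z \<inter> i = {}" using Z(4) i False specD(1)[OF \<psi>(1)] by blast
        then show False using spec_disjoint[OF \<psi> \<open>\<psi> i\<close>] by blast
      qed
      then show ?thesis using False by simp
    qed
  qed
  with Z(1,2) show thesis by (rule that)
qed

text \<open>Forward, a nearby maximal character agrees on the finitely many given ideals; it has a
  member disjoint from each omitted one, and a common lower bound serves as \<open>Z\<close>.
  Backward, a neighbourhood missing all maximal characters would contain a cylinder of a nonempty
  ideal, but each such cylinder has a maximal point.\<close>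

lemma boundary_iff: "\<phi> \<in> bdry \<longleftrightarrow> \<phi> \<in> spec \<and> tight \<phi>"
proof
  assume b: "\<phi> \<in> bdry"
  have "tight \<phi>" unfolding tight_def
  proof (intro allI impI)
    fix X F assume X: "\<phi> X" and F: "finite F" "\<forall>f\<in>F. f \<in> J \<and> \<not> \<phi> f"
    let ?U = "{\<psi>. \<psi> X} \<inter> (\<Inter>f\<in>F. {\<psi>. \<not> \<psi> f})"
    have "open ?U" using F(1) open_coordinate by (intro open_Int open_INT) auto
    moreover have "\<phi> \<in> ?U \<inter> closure (max_spectrum G P)" using X F b by (auto simp: boundary_def)
    ultimately have "?U \<inter> max_spectrum G P \<noteq> {}" using open_Int_closure_eq_empty by blast
    then obtain \<omega> where \<omega>: "\<omega> \<in> max_spectrum G P" "\<omega> X" "\<And>f. f \<in> F \<Longrightarrow> \<not> \<omega> f" by auto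
    have s: "\<omega> \<in> spec" using \<omega>(1) by (simp add: max_spectrum_def)
    have "\<exists>W. \<omega> W \<and> W \<inter> f = {}" if "f \<in> F" for f
      using max_spectrum_disjoint[OF \<omega>(1), of f] F(2) \<omega>(3) that by metis
    then obtain W where W: "\<And>f. f \<in> F \<Longrightarrow> \<omega> (W f) \<and> W f \<inter> f = {}" by metis
    have "\<exists>Y. \<omega> Y \<and> (\<forall>V\<in>insert X (W ` F). Y \<subseteq> V)"
      using F(1) \<omega>(2) W by (intro spec_finite_Inter[OF s]) auto
    then obtain Y where Y: "\<omega> Y" "\<And>V. V \<in> insert X (W ` F) \<Longrightarrow> Y \<subseteq> V" by blast
    have "Y \<inter> f = {}" if "f \<in> F" for f using W[OF that] Y(2)[of "W f"] that by blast
    moreover have "Y \<subseteq> X" using Y(2) by simp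
    ultimately show "\<exists>Z\<in>J. Z \<noteq> {} \<and> Z \<subseteq> X \<and> (\<forall>f\<in>F. Z \<inter> f = {})"
      using specD(1,2)[OF s Y(1)] by blast
  qed
  then show "\<phi> \<in> spec \<and> tight \<phi>" using b by (simp add: boundary_def)
next
  assume \<phi>: "\<phi> \<in> spec \<and> tight \<phi>"
  have "\<phi> \<in> closure (max_spectrum G P)"
  proof (rule ccontr)
    assume "\<phi> \<notin> closure (max_spectrum G P)"
    then obtain Z where Z: "Z \<in> J" "Z \<noteq> {}"
      "\<And>\<psi>. \<psi> \<in> spec \<Longrightarrow> \<psi> Z \<Longrightarrow> \<psi> \<in> - closure (max_spectrum G P)"
      using tight_neighbourhood[of \<phi> "- closure (max_spectrum G P)"] \<phi>
      by (metis ComplI closed_closure open_Compl)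
    obtain \<omega> where \<omega>: "\<omega> \<in> max_spectrum G P" "\<omega> Z" using max_spectrum_exists Z(1,2) by blast
    then have "\<omega> \<in> spec" by (simp add: max_spectrum_def)
    then have "\<omega> \<in> - closure (max_spectrum G P)" using Z(3) \<omega>(2) by blast
    then show False using subsetD[OF closure_subset \<omega>(1)] by simp
  qed
  then show "\<phi> \<in> bdry" using \<phi> by (simp add: boundary_def)
qed

lemma boundary_exists:
  assumes "Z \<in> J" "Z \<noteq> {}"
  obtains \<phi> where "\<phi> \<in> bdry" "\<phi> Z"
proof -
  obtain \<omega> where \<omega>: "\<omega> \<in> max_spectrum G P" "\<omega> Z" using max_spectrum_exists[OF assms] .
  have "\<omega> \<in> bdry"
    using \<omega>(1) subsetD[OF closure_subset \<omega>(1)] by (simp add: boundary_def max_spectrum_def)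
  then show thesis using \<omega>(2) by (rule that)
qed

section \<open>Compact cylinders and their indicator functions\<close>

lemma closed_spectrum: "closed spec"
proof -
  \<comment> \<open>The condition that a character is nonzero is an existential and not visibly
    closed; given multiplicativity it amounts to the value at \<open>P\<close> being true, which is
    closed.\<close>
  have "spec = {\<phi>. \<phi> P} \<inter> {\<phi>. \<not> \<phi> {}} \<inter> (\<Inter>X\<in>-J. {\<phi>. \<not> \<phi> X}) \<inter>
      (\<Inter>X\<in>J. \<Inter>Y\<in>J. {\<phi>. \<phi> (X \<inter> Y)} \<inter> {\<phi>. \<phi> X} \<inter> {\<phi>. \<phi> Y} \<union>
        {\<phi>. \<not> \<phi> (X \<inter> Y)} \<inter> ({\<phi>. \<not> \<phi> X} \<union> {\<phi>. \<not> \<phi> Y}))" (is "_ = ?R")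
  proof (intro Set.set_eqI iffI)
    fix \<phi> assume s: "\<phi> \<in> spec"
    show "\<phi> \<in> ?R"
      using specD(1)[OF s] specD(2)[OF s, of "{}"] specD(4,5)[OF s] by auto
  next
    fix \<phi> assume "\<phi> \<in> ?R"
    then show "\<phi> \<in> spec" by (intro specI) auto
  qed
  also have "closed \<dots>" by (intro closed_Int closed_INT closed_Un ballI closed_coordinate)
  finally show ?thesis .
qed

lemma compact_boundary_cylinder: "compact {\<phi> \<in> bdry. \<phi> X}"
proof -
  have "{\<phi> \<in> bdry. \<phi> X} = UNIV \<inter> (spec \<inter> closure (max_spectrum G P) \<inter> {\<phi>. \<phi> X})"
    by (auto simp: boundary_def)
  also have "compact \<dots>"
    by (intro compact_Int_closed compact_UNIV_bool_fun closed_Int closed_spectrum closed_closure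
        closed_coordinate)
  finally show ?thesis .
qed

text \<open>Cylinders are clopen and compact in the boundary. Their indicators supply the unit, the
  separating functions and the coefficients of the isometries.\<close>

lemma indicator_cylinder_C0:
  assumes "{\<phi> \<in> bdry. \<phi> X} \<subseteq> U" "U \<subseteq> bdry"
  shows "indicator {\<phi> \<in> bdry. \<phi> X} \<in> C0 U"
proof -
  let ?f = "indicator {\<phi> \<in> bdry. \<phi> X} :: _ \<Rightarrow> complex"
  have "continuous_on U ((\<lambda>b. if b then 1 else 0 :: complex) \<circ> (\<lambda>\<phi>. \<phi> X))"
    by (rule continuous_on_compose[OF continuous_on_coordinate])
      (simp add: continuous_on_def at_discrete)
  then have "continuous_on U ?f"
    by (rule continuous_on_eq) (use assms(2) in \<open>auto simp: indicator_def\<close>)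
  moreover have "compact {\<phi> \<in> U. e \<le> norm (?f \<phi>)}" if "0 < e" for e
  proof (cases "e \<le> 1")
    case True
    then have "{\<phi> \<in> U. e \<le> norm (?f \<phi>)} = {\<phi> \<in> bdry. \<phi> X}"
      using assms(1) that by (auto simp: indicator_def split: if_splits)
    then show ?thesis by (simp only: compact_boundary_cylinder)
  next
    case False
    then have "{\<phi> \<in> U. e \<le> norm (?f \<phi>)} = {}" using that by (auto simp: indicator_def)
    then show ?thesis by (simp only: compact_empty)
  qed
  ultimately show ?thesis using assms(1) by (auto simp: C0_def indicator_def)
qed

section \<open>The partial action on the boundary\<close>

lemma implements_iff:
  assumes "g \<in> carrier G" "\<phi> \<in> spec"
  shows "implements G P g \<phi> s \<longleftrightarrow> (\<exists>W. s = translation g W \<and> translates g W \<and> \<phi> W)"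
proof
  assume i: "implements G P g \<phi> s"
  then obtain h W where W: "h \<in> carrier G" "s = translation h W" "bitranslates h W"
    using hull_translation[of s] unfolding implements_def by blast
  then have "\<phi> W" using i by (simp add: implements_def dom_translation)
  then have "W \<noteq> {}" "W \<in> J" by (rule specD(1,2)[OF assms(2)])+
  moreover from this have "h = g"
    using i W group_element_translation[OF W(1) J_carrier] by (simp add: implements_def)
  ultimately show "\<exists>W. s = translation g W \<and> translates g W \<and> \<phi> W"
    using i W \<open>\<phi> W\<close> unfolding implements_def translates_def by blast
next
  assume "\<exists>W. s = translation g W \<and> translates g W \<and> \<phi> W"
  then obtain W where W: "s = translation g W" "translates g W" "\<phi> W" by blast
  then have "dom s = W" by (simp add: dom_translation)
  moreover from this have "s \<noteq> Map.empty" using translates_J(3)[OF W(2)] by auto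
  ultimately show "implements G P g \<phi> s"
    using W translates_J[OF W(2)] by (simp add: implements_def group_element_translation translates_def)
qed

lemma bdom_iff:
  assumes "g \<in> carrier G"
  shows "\<phi> \<in> bdom g \<longleftrightarrow> \<phi> \<in> bdry \<and> (\<exists>W. translates g W \<and> \<phi> W)"
  using implements_iff[OF assms, of \<phi>]
  by (auto simp: boundary_dom_def spectrum_dom_def boundary_iff)

lemma bact_iff:
  assumes s: "\<phi> \<in> spec" and W: "translates g W" "\<phi> W"
  shows "bact g \<phi> X \<longleftrightarrow> X \<in> J \<and> \<phi> (pullback g W X)"
proof -
  have g: "g \<in> carrier G" using translates_J(1)[OF W(1)] .
  have "\<exists>s. implements G P g \<phi> s" using implements_iff[OF g s] W by blast
  then have "implements G P g \<phi> (SOME s. implements G P g \<phi> s)" by (rule someI_ex)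
  then obtain V where V: "(SOME s. implements G P g \<phi> s) = translation g V" "translates g V" "\<phi> V"
    using implements_iff[OF g s] by blast
  have eq: "{x. \<exists>y\<in>X \<inter> ran (translation g V). translation g V x = Some y} = pullback g V X"
    by (auto simp: translation_def pullback_def ran_def split: if_splits)
  \<comment> \<open>Independence of the chosen hull element: \<open>W\<close> and the pullback over
    \<open>V\<close> both belong to the filter, and their intersection is contained in the pullback
    over \<open>W\<close>.\<close>
  have *: "\<phi> (pullback g W X)" if "translates g V" "\<phi> V" "translates g W" "\<phi> W" "X \<in> J" "\<phi> (pullback g V X)" for V W
  proof -
    have "\<phi> (W \<inter> pullback g V X)"
      using specD(4)[OF s, of W "pullback g V X"] that translates_J(2) pullback_J by simp
    then show ?thesis using that by (rule_tac specD(3)[OF s]) (auto simp: pullback_def intro!: pullback_J[unfolded pullback_def])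
  qed
  show ?thesis
    unfolding spectrum_act_def Let_def V(1) eq using *[OF V(2,3) W] *[OF W V(2,3)] by auto
qed

lemma bdry_spec: "\<phi> \<in> bdry \<Longrightarrow> \<phi> \<in> spec"
  by (simp add: boundary_iff)

lemma pullback_translate:
  assumes "translates g W"
  shows "pullback g W (g \<cdot> W) = W"
  by (auto simp: pullback_def l_coset_def)

text \<open>Tightness is transported by pulling \<open>X\<close> and the omitted ideals back along
  \<open>g\<close>, applying tightness there, and translating the resulting ideal forward.\<close>

lemma bact_boundary:
  assumes \<phi>: "\<phi> \<in> bdry" and W: "translates g W" "\<phi> W"
  shows "bact g \<phi> \<in> bdry"
proof -
  have s: "\<phi> \<in> spec" and t: "tight \<phi>" using \<phi> by (auto simp: boundary_iff)
  note act = bact_iff[OF s W]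
  note WJ = translates_J[OF W(1)]
  have "bact g \<phi> \<in> spec"
  proof (rule specI)
    show "bact g \<phi> X \<Longrightarrow> X \<in> J" for X using act by blast
    have "\<phi> (pullback g W (g \<cdot> W))" using W by (simp add: pullback_translate)
    moreover have "pullback g W (g \<cdot> W) \<subseteq> pullback g W P"
      using J_sub[OF WJ(5)] by (auto simp: pullback_def)
    ultimately show "bact g \<phi> P"
      unfolding act using specD(3)[OF s _ pullback_J[OF W(1) J_P]] J_P by blast
    have "\<not> \<phi> {}" using specD(2)[OF s] by blast
    then show "\<not> bact g \<phi> {}" by (simp add: act pullback_def)
    fix X Y assume XY: "X \<in> J" "Y \<in> J"
    have "pullback g W (X \<inter> Y) = pullback g W X \<inter> pullback g W Y" by (auto simp: pullback_def)
    then show "bact g \<phi> (X \<inter> Y) \<longleftrightarrow> bact g \<phi> X \<and> bact g \<phi> Y"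
      unfolding act using XY J_Int[OF XY] specD(4)[OF s pullback_J[OF W(1) XY(1)] pullback_J[OF W(1) XY(2)]] by simp
  qed
  moreover have "tight (bact g \<phi>)"
    unfolding tight_def
  proof (intro allI impI)
    fix X F assume X: "bact g \<phi> X" and F: "finite F" "\<forall>f\<in>F. f \<in> J \<and> \<not> bact g \<phi> f"
    have "\<exists>Z\<in>J. Z \<noteq> {} \<and> Z \<subseteq> pullback g W X \<and> (\<forall>f\<in>pullback g W ` F. Z \<inter> f = {})"
      using X F act pullback_J[OF W(1)] by (intro tightD[OF t]) auto
    then obtain Z where Z: "Z \<in> J" "Z \<noteq> {}" "Z \<subseteq> pullback g W X" "\<forall>f\<in>F. Z \<inter> pullback g W f = {}"
      unfolding ball_simps by (elim bexE conjE) (rule that)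
    have "Z \<subseteq> W" using Z(3) by (auto simp: pullback_def)
    then have "translates g Z" by (rule translates_subset[OF W(1) Z(1,2)])
    then have "g \<cdot> Z \<in> J" by (rule translates_J(5))
    moreover have "g \<cdot> Z \<noteq> {}" using Z(2) by (simp add: l_coset_eq_empty)
    moreover have "g \<cdot> Z \<subseteq> X" using Z(3) by (auto simp: l_coset_def pullback_def)
    moreover have "g \<cdot> Z \<inter> f = {}" if "f \<in> F" for f
      using bspec[OF Z(4) that] \<open>Z \<subseteq> W\<close> by (auto simp: l_coset_def pullback_def)
    ultimately show "\<exists>Z\<in>J. Z \<noteq> {} \<and> Z \<subseteq> X \<and> (\<forall>f\<in>F. Z \<inter> f = {})" by blast
  qed
  ultimately show ?thesis by (simp add: boundary_iff)
qed

lemma bact_translate: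
  assumes "\<phi> \<in> spec" "translates g W" "\<phi> W"
  shows "bact g \<phi> (g \<cdot> W)"
  using bact_iff[OF assms] pullback_translate[OF assms(2)] translates_J(5)[OF assms(2)] assms(3) by simp

lemma bact_inv:
  assumes \<phi>: "\<phi> \<in> bdry" and W: "translates g W" "\<phi> W"
  shows "bact (inv g) (bact g \<phi>) = \<phi>"
proof
  fix X
  have s: "\<phi> \<in> spec" using \<phi> by (rule bdry_spec)
  note WJ = translates_J[OF W(1)]
  note gW = translates_inv[OF W(1)]
  have "bact (inv g) (bact g \<phi>) X \<longleftrightarrow> X \<in> J \<and> bact g \<phi> (pullback (inv g) (g \<cdot> W) X)"
    by (rule bact_iff[OF bdry_spec[OF bact_boundary[OF \<phi> W]] gW bact_translate[OF s W]])
  also have "\<dots> \<longleftrightarrow> X \<in> J \<and> \<phi> (pullback g W (pullback (inv g) (g \<cdot> W) X))"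
    using bact_iff[OF s W] pullback_J[OF gW] by blast
  also have "pullback g W (pullback (inv g) (g \<cdot> W) X) = W \<inter> X"
    using WJ(1,4) by (auto simp: pullback_def l_coset_def m_assoc[symmetric] subset_eq)
  also have "X \<in> J \<and> \<phi> (W \<inter> X) \<longleftrightarrow> \<phi> X"
    using specD(4)[OF s WJ(2), of X] specD(1)[OF s, of X] W(2) by blast
  finally show "bact (inv g) (bact g \<phi>) X = \<phi> X" .
qed

lemma bact_mult:
  assumes \<phi>: "\<phi> \<in> bdry" and V: "translates h V" "\<phi> V" and W: "translates g W" "bact h \<phi> W"
  shows "translates (g \<otimes> h) (pullback h V W)" "\<phi> (pullback h V W)"
    "bact (g \<otimes> h) \<phi> = bact g (bact h \<phi>)"
proof -
  have s: "\<phi> \<in> spec" using \<phi> by (rule bdry_spec)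
  let ?Z = "pullback h V W"
  show Z: "\<phi> ?Z" using bact_iff[OF s V] W(2) by simp
  have hZ: "translates h ?Z"
    using specD(1,2)[OF s Z] by (intro translates_subset[OF V(1)]) (auto simp: pullback_def)
  have "h \<cdot> ?Z \<subseteq> W" by (auto simp: l_coset_def pullback_def)
  then have "translates g (h \<cdot> ?Z)"
    using translates_J[OF hZ] by (intro translates_subset[OF W(1)]) (auto simp: l_coset_eq_empty)
  then show gh: "translates (g \<otimes> h) ?Z" by (rule translates_mult[OF hZ])
  note c = translates_J(1)[OF V(1)] translates_J(1)[OF W(1)] translates_J(4)[OF V(1)]
  show "bact (g \<otimes> h) \<phi> = bact g (bact h \<phi>)"
  proof
    fix X
    have "pullback (g \<otimes> h) ?Z X = pullback h V (pullback g W X)"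
      using c by (auto simp: pullback_def m_assoc subset_eq)
    then have "bact (g \<otimes> h) \<phi> X \<longleftrightarrow> X \<in> J \<and> \<phi> (pullback h V (pullback g W X))"
      using bact_iff[OF s gh Z] by simp
    also have "\<dots> \<longleftrightarrow> X \<in> J \<and> bact h \<phi> (pullback g W X)"
      using bact_iff[OF s V] pullback_J[OF W(1)] by blast
    also have "\<dots> \<longleftrightarrow> bact g (bact h \<phi>) X"
      using bact_iff[OF bdry_spec[OF bact_boundary[OF \<phi> V]] W] by simp
    finally show "bact (g \<otimes> h) \<phi> X = bact g (bact h \<phi>) X" .
  qed
qed

lemma bdom_P: "p \<in> P \<Longrightarrow> bdom p = bdry"
  using bdom_iff[OF P_carrier, of p] translates_P[of p] specD(5)[OF bdry_spec] by blast

text \<open>If \<open>inv p\<close> translates \<open>W\<close>, then \<open>inv p \<cdot> W\<close>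
  is constructible, hence inside \<open>P\<close>, so \<open>W\<close> lies in
  \<open>p \<cdot> P\<close>. This makes the image of \<open>p\<close> a compact open set.\<close>

lemma bdom_inv_P:
  assumes p: "p \<in> P"
  shows "bdom (inv p) = {\<phi> \<in> bdry. \<phi> (p \<cdot> P)}"
proof (intro Set.set_eqI iffI)
  fix \<phi> assume "\<phi> \<in> bdom (inv p)"
  then obtain W where W: "\<phi> \<in> bdry" "translates (inv p) W" "\<phi> W"
    using bdom_iff p P_carrier by auto
  have "W \<subseteq> p \<cdot> P"
  proof
    fix x assume x: "x \<in> W"
    then have "inv p \<otimes> x \<in> P" "x \<in> carrier G"
      using J_sub[OF translates_J(5)[OF W(2)]] translates_J(4)[OF W(2)] by (auto simp: l_coset_def)
    then show "x \<in> p \<cdot> P" by (simp add: mem_l_coset_iff[OF P_carrier[OF p] J_carrier[OF J_P]])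
  qed
  then show "\<phi> \<in> {\<phi> \<in> bdry. \<phi> (p \<cdot> P)}"
    using specD(3)[OF bdry_spec[OF W(1)] W(3)] J_translate[OF p J_P] W(1) by blast
next
  fix \<phi> assume "\<phi> \<in> {\<phi> \<in> bdry. \<phi> (p \<cdot> P)}"
  then show "\<phi> \<in> bdom (inv p)"
    using bdom_iff[of "inv p"] translates_inv[OF translates_P[OF p]] p P_carrier by auto
qed

lemma boundary_partial_action: "partial_action G bdry bdom bact"
  unfolding partial_action_def
proof (intro conjI ballI impI)
  have one: "translates \<one> P" by (rule translates_one[OF J_P P_nonempty])
  show "bdom \<one> = bdry" using bdom_iff[OF one_closed] one specD(5)[OF bdry_spec] by blast
  show "bact \<one> \<phi> = \<phi>" if "\<phi> \<in> bdry" for \<phi>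
  proof
    fix X
    have s: "\<phi> \<in> spec" using that by (rule bdry_spec)
    have "pullback \<one> P X = X" if "X \<in> J" using that J_sub[OF that] P_carrier by (auto simp: pullback_def)
    then show "bact \<one> \<phi> X = \<phi> X"
      using bact_iff[OF s one specD(5)[OF s]] specD(1)[OF s, of X] by auto
  qed
  fix g assume g: "g \<in> carrier G"
  show "bdom g \<subseteq> bdry" using bdom_iff[OF g] by blast
  show "bact g \<phi> \<in> bdom (inv g)" "bact (inv g) (bact g \<phi>) = \<phi>" if d: "\<phi> \<in> bdom g" for \<phi>
  proof -
    obtain W where W: "\<phi> \<in> bdry" "translates g W" "\<phi> W" using d bdom_iff[OF g] by blast
    show "bact g \<phi> \<in> bdom (inv g)"
      using bdom_iff[OF inv_closed[OF g]] bact_boundary[OF W] translates_inv[OF W(2)]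
        bact_translate[OF bdry_spec[OF W(1)] W(2,3)] by blast
    show "bact (inv g) (bact g \<phi>) = \<phi>" by (rule bact_inv[OF W])
  qed
  fix h \<phi> assume h: "h \<in> carrier G" and \<phi>: "\<phi> \<in> bdom h" "bact h \<phi> \<in> bdom g"
  obtain V where V: "\<phi> \<in> bdry" "translates h V" "\<phi> V" using \<phi>(1) bdom_iff[OF h] by blast
  obtain W where W: "translates g W" "bact h \<phi> W" using \<phi>(2) bdom_iff[OF g] by blast
  show "\<phi> \<in> bdom (g \<otimes> h)"
    using bdom_iff[of "g \<otimes> h"] g h V(1) bact_mult(1,2)[OF V W] by auto
  show "bact (g \<otimes> h) \<phi> = bact g (bact h \<phi>)" by (rule bact_mult(3)[OF V W])
qed

section \<open>Cylinders moved off themselves\<close>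

text \<open>If all cylinders were recurrent, each nonempty ideal would meet both
  \<open>g \<cdot> W\<close> and \<open>W\<close> for some \<open>W\<close> translated by
  \<open>g\<close>, which puts \<open>g\<close> into the core. Freeness then gives a moved point,
  and tightness at that point yields an ideal \<open>Z\<close> without recurrence.\<close>

lemma moved_cylinder:
  assumes free: "topologically_free G (core_subgroup G P) bdom bact"
    and g: "g \<in> carrier G" "g \<noteq> \<one>"
  obtains X where "X \<in> J" "X \<noteq> {}" "\<And>\<phi>. \<phi> \<in> bdom g \<Longrightarrow> \<phi> X \<Longrightarrow> \<not> bact g \<phi> X"
proof (rule ccontr)
  assume "\<not> thesis"
  then have rec: "\<exists>\<phi>. \<phi> \<in> bdom g \<and> \<phi> X \<and> bact g \<phi> X" if "X \<in> J" "X \<noteq> {}" for X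
    using that \<open>\<And>X. X \<in> J \<Longrightarrow> X \<noteq> {} \<Longrightarrow> (\<And>\<phi>. \<phi> \<in> bdom g \<Longrightarrow> \<phi> X \<Longrightarrow> \<not> bact g \<phi> X) \<Longrightarrow> thesis\<close> by blast
  have rec': "\<exists>\<phi> W. \<phi> \<in> bdry \<and> translates g W \<and> \<phi> W \<and> \<phi> X \<and> bact g \<phi> X" if "X \<in> J" "X \<noteq> {}" for X
    using rec[OF that] bdom_iff[OF g(1)] by blast
  have "g \<in> core_subgroup G P"
    unfolding core_subgroup_def
  proof (intro CollectI conjI ballI impI g)
    fix X assume X: "X \<in> J" "X \<noteq> {}"
    then obtain \<phi> W where W: "\<phi> \<in> bdry" "translates g W" "\<phi> W" "\<phi> X" "bact g \<phi> X" using rec' by blast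
    note WJ = translates_J[OF W(2)]
    have "X \<inter> g \<cdot> W \<noteq> {}"
      using spec_disjoint[OF bdry_spec[OF bact_boundary[OF W(1-3)]] W(5)
          bact_translate[OF bdry_spec[OF W(1)] W(2,3)]] by blast
    moreover have "g \<cdot> W \<subseteq> g \<cdot> P" using J_sub[OF WJ(2)] by (auto simp: l_coset_def)
    ultimately show "X \<inter> g \<cdot> P \<noteq> {}" by blast
    have "X \<inter> W \<noteq> {}" using spec_disjoint[OF bdry_spec[OF W(1)] W(4,3)] by blast
    moreover have "W \<subseteq> inv g \<cdot> P"
    proof
      fix x assume x: "x \<in> W"
      then have "g \<otimes> x \<in> P" "x \<in> carrier G" using J_sub[OF WJ(5)] WJ(4) by (auto simp: l_coset_def)
      then show "x \<in> inv g \<cdot> P" using g(1) by (simp add: mem_l_coset_iff[OF inv_closed[OF g(1)] J_carrier[OF J_P]])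
    qed
    ultimately show "X \<inter> inv g \<cdot> P \<noteq> {}" by blast
  qed
  then have dense: "bdom g \<subseteq> closure {\<phi> \<in> bdom g. bact g \<phi> \<noteq> \<phi>}"
    using free g(2) unfolding topologically_free_def by blast
  have "bdom g \<noteq> {}" using rec[OF J_P P_nonempty] by blast
  then have "{\<phi> \<in> bdom g. bact g \<phi> \<noteq> \<phi>} \<noteq> {}" using dense by (metis closure_empty subset_empty)
  then obtain \<phi> W where W: "\<phi> \<in> bdry" "translates g W" "\<phi> W" and neq: "bact g \<phi> \<noteq> \<phi>"
    using bdom_iff[OF g(1)] by blast
  have s: "\<phi> \<in> spec" and t: "tight \<phi>" using W(1) by (auto simp: boundary_iff)
  note WJ = translates_J[OF W(2)]
  obtain X where X: "bact g \<phi> X \<noteq> \<phi> X" using neq by blast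
  then have XJ: "X \<in> J" using bact_iff[OF s W(2,3)] specD(1)[OF s] by blast
  let ?V = "pullback g W X"
  have VJ: "?V \<in> J" by (rule pullback_J[OF W(2) XJ])
  have V: "bact g \<phi> X \<longleftrightarrow> \<phi> ?V" using bact_iff[OF s W(2,3)] XJ by simp
  \<comment> \<open>The coordinate \<open>X\<close> separates the point from its image. Depending on
    which of the two contains \<open>X\<close>, tightness gives \<open>Z\<close> inside
    \<open>X \<inter> W\<close> and away from the pullback of \<open>X\<close>, or inside that
    pullback and away from \<open>X\<close>. Either way \<open>g\<close> sends no element of
    \<open>Z\<close> into \<open>Z\<close>.\<close>
  obtain Z where Z: "Z \<in> J" "Z \<noteq> {}" "Z \<subseteq> W" "pullback g Z Z = {}"
  proof (cases "\<phi> X")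
    case True
    have "\<phi> (X \<inter> W)" using True W(3) specD(4)[OF s XJ WJ(2)] by simp
    then have "\<exists>Z\<in>J. Z \<noteq> {} \<and> Z \<subseteq> X \<inter> W \<and> (\<forall>f\<in>{?V}. Z \<inter> f = {})"
      using VJ X V True by (intro tightD[OF t]) auto
    then obtain Z where "Z \<in> J" "Z \<noteq> {}" "Z \<subseteq> X \<inter> W" "Z \<inter> ?V = {}" by blast
    then show thesis by (intro that[of Z]) (auto simp: pullback_def)
  next
    case False
    then have "\<phi> ?V" using X V by simp
    then have "\<exists>Z\<in>J. Z \<noteq> {} \<and> Z \<subseteq> ?V \<and> (\<forall>f\<in>{X}. Z \<inter> f = {})"
      using XJ False by (intro tightD[OF t]) auto
    then obtain Z where "Z \<in> J" "Z \<noteq> {}" "Z \<subseteq> ?V" "Z \<inter> X = {}" by blast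
    then show thesis by (intro that[of Z]) (auto simp: pullback_def)
  qed
  obtain \<psi> where \<psi>: "\<psi> \<in> bdom g" "\<psi> Z" "bact g \<psi> Z" using rec[OF Z(1,2)] by blast
  then have s: "\<psi> \<in> spec" using bdom_iff[OF g(1)] bdry_spec by blast
  have "translates g Z" by (rule translates_subset[OF W(2) Z(1-3)])
  then have "\<psi> (pullback g Z Z)" using bact_iff[OF s _ \<psi>(2)] \<psi>(3) by blast
  then show False using specD(2)[OF s] Z(4) by blast
qed

text \<open>\<open>moved_cylinder\<close> does not control where its ideal lies. Translating by some
  \<open>p \<in> Z\<close> brings it inside \<open>Z\<close>, so that lemma is applied to the
  conjugate of \<open>g\<close> by \<open>p\<close>: recurrence of \<open>g\<close> at
  \<open>p \<cdot> X\<close> is recurrence of the conjugate at \<open>X\<close>.\<close>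

lemma moved_cylinder_within:
  assumes free: "topologically_free G (core_subgroup G P) bdom bact"
    and g: "g \<in> carrier G" "g \<noteq> \<one>" and Z: "Z \<in> J" "Z \<noteq> {}"
  obtains X where "X \<in> J" "X \<noteq> {}" "X \<subseteq> Z" "\<And>\<phi>. \<phi> \<in> bdom g \<Longrightarrow> \<phi> X \<Longrightarrow> \<not> bact g \<phi> X"
proof -
  obtain p where pZ: "p \<in> Z" using Z(2) by blast
  then have p: "p \<in> P" using J_sub[OF Z(1)] by blast
  note pc = P_carrier[OF p]
  let ?h = "inv p \<otimes> g \<otimes> p"
  have h: "?h \<in> carrier G" using pc g by simp
  have gp: "p \<otimes> ?h \<otimes> inv p = g" using pc g by (simp add: m_assoc) (simp add: m_assoc[symmetric])
  have "?h \<noteq> \<one>" using gp g pc by auto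
  then obtain X where X: "X \<in> J" "X \<noteq> {}" "\<And>\<phi>. \<phi> \<in> bdom ?h \<Longrightarrow> \<phi> X \<Longrightarrow> \<not> bact ?h \<phi> X"
    using moved_cylinder[OF free h] by blast
  have pX: "translates p X" by (rule translates_subset[OF translates_P[OF p] X(1,2) J_sub[OF X(1)]])
  note pa = boundary_partial_action
  have act_inv: "\<psi> \<in> bdom (inv p) \<and> bact (inv p) \<psi> X" if "\<psi> \<in> bdry" "\<psi> (p \<cdot> X)" for \<psi>
  proof -
    note t = translates_inv[OF pX]
    have "inv p \<cdot> (p \<cdot> X) = X" using pc J_carrier[OF X(1)] by (rule inv_l_coset)
    then have "bact (inv p) \<psi> X" using bact_translate[OF bdry_spec[OF that(1)] t that(2)] by simp
    moreover have "\<psi> \<in> bdom (inv p)" using bdom_iff[OF inv_closed[OF pc]] that t by blast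
    ultimately show ?thesis by blast
  qed
  have "\<not> bact g \<phi> (p \<cdot> X)" if \<phi>: "\<phi> \<in> bdom g" "\<phi> (p \<cdot> X)" for \<phi>
  proof
    assume g\<phi>: "bact g \<phi> (p \<cdot> X)"
    have "\<phi> \<in> bdry" using \<phi>(1) pa_sub[OF is_group pa g(1)] by blast
    then have a: "\<phi> \<in> bdom (inv p)" "bact (inv p) \<phi> X" using act_inv \<phi>(2) by blast+
    have "bact g \<phi> \<in> bdry"
      using pa_inv(1)[OF is_group pa g(1) \<phi>(1)] pa_sub[OF is_group pa inv_closed[OF g(1)]] by blast
    then have b: "bact g \<phi> \<in> bdom (inv p)" "bact (inv p) (bact g \<phi>) X" using act_inv g\<phi> by blast+
    let ?\<psi> = "bact (inv p) \<phi>"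
    have \<psi>: "?\<psi> \<in> bdom p" "bact p ?\<psi> = \<phi>"
      using pa_inv[OF is_group pa inv_closed[OF pc] a(1)] pc by simp_all
    have "?\<psi> \<in> bdom (g \<otimes> p)" "bact (g \<otimes> p) ?\<psi> = bact g \<phi>"
      using pa_mult[OF is_group pa g(1) pc \<psi>(1)] \<psi>(2) \<phi>(1) by simp_all
    then have h\<psi>: "?\<psi> \<in> bdom ?h" "bact ?h ?\<psi> = bact (inv p) (bact g \<phi>)"
      using pa_mult[OF is_group pa inv_closed[OF pc], of "g \<otimes> p" ?\<psi>] b(1) g(1) pc by (simp_all add: m_assoc)
    then show False using X(3)[OF h\<psi>(1) a(2)] b(2) by simp
  qed
  moreover have "p \<cdot> X \<in> J" by (rule J_translate[OF p X(1)])
  moreover have "p \<cdot> X \<noteq> {}" using X(2) by (simp add: l_coset_eq_empty)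
  moreover have "p \<cdot> X \<subseteq> Z"
    using J_principal_sub[OF Z(1) pZ] J_sub[OF X(1)] by (auto simp: l_coset_def)
  ultimately show thesis by (intro that)
qed

text \<open>Being moved off itself passes to smaller cylinders, so the group elements can be treated
  one after another by shrinking.\<close>

lemma moved_cylinder_finite:
  assumes free: "topologically_free G (core_subgroup G P) bdom bact"
    and F: "finite F" "F \<subseteq> carrier G - {\<one>}" and Z: "Z \<in> J" "Z \<noteq> {}"
  shows "\<exists>X\<in>J. X \<noteq> {} \<and> X \<subseteq> Z \<and> (\<forall>g\<in>F. \<forall>\<phi>\<in>bdom g. \<phi> X \<longrightarrow> \<not> bact g \<phi> X)"
  using F
proof (induction F rule: finite_induct)
  case empty
  then show ?case using Z by auto
next
  case (insert g F)
  have "F \<subseteq> carrier G - {\<one>}" using insert.prems by blast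
  from insert.IH[OF this] obtain X where X: "X \<in> J" "X \<noteq> {}" "X \<subseteq> Z"
    "\<forall>h\<in>F. \<forall>\<phi>\<in>bdom h. \<phi> X \<longrightarrow> \<not> bact h \<phi> X"
    by (elim bexE conjE) (rule that)
  have g: "g \<in> carrier G" "g \<noteq> \<one>" using insert.prems by auto
  obtain Y where Y: "Y \<in> J" "Y \<noteq> {}" "Y \<subseteq> X" "\<And>\<phi>. \<phi> \<in> bdom g \<Longrightarrow> \<phi> Y \<Longrightarrow> \<not> bact g \<phi> Y"
    using moved_cylinder_within[OF free g X(1,2)] by blast
  have "\<not> bact h \<phi> Y" if "h \<in> F" "\<phi> \<in> bdom h" "\<phi> Y" for h \<phi>
  proof
    assume h\<phi>: "bact h \<phi> Y"
    have h: "h \<in> carrier G" using that(1) insert.prems by blast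
    note pa = boundary_partial_action
    have "\<phi> \<in> bdry" using that(2) pa_sub[OF is_group pa h] by blast
    then have "\<phi> X" using specD(3)[where \<phi> = \<phi> and X = Y and Y = X] bdry_spec that(3) X(1) Y(3) by simp
    have "bact h \<phi> \<in> bdry"
      using pa_inv(1)[OF is_group pa h that(2)] pa_sub[OF is_group pa inv_closed[OF h]] by blast
    then have "bact h \<phi> X" using specD(3)[where \<phi> = "bact h \<phi>" and X = Y and Y = X] bdry_spec h\<phi> X(1) Y(3) by simp
    then show False using X(4) that(1,2) \<open>\<phi> X\<close> by blast
  qed
  then have "\<forall>h\<in>insert g F. \<forall>\<phi>\<in>bdom h. \<phi> Y \<longrightarrow> \<not> bact h \<phi> Y" using Y(4) by blast
  moreover have "Y \<subseteq> Z" using Y(3) X(3) by (rule order_trans)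
  ultimately show ?case using Y(1,2) by blast
qed

section \<open>Simplicity of the boundary quotient\<close>

lemma boundary_quotient_simple:
  assumes free: "topologically_free G (core_subgroup G P) bdom bact"
  shows "simple_Cstar_algebra (boundary_quotient G P)"
proof -
  interpret partial_group_action G bdry bdom bact
    by unfold_locales (rule boundary_partial_action)
  show ?thesis
    unfolding boundary_quotient_def
  proof (rule contracting_imp_simple)
    show "bdry \<noteq> {}" using boundary_exists[OF J_P P_nonempty] by blast
    have "bdry = {\<phi> \<in> bdry. \<phi> P}" using specD(5)[OF bdry_spec] by blast
    then show "indicator bdry \<in> C0 bdry" using indicator_cylinder_C0[of P bdry] by simp
    show "\<exists>f\<in>C0 (bdom g). f \<phi> \<noteq> 0" if g: "g \<in> carrier G" and d: "\<phi> \<in> bdom g" for g \<phi>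
    proof -
      obtain W where W: "\<phi> \<in> bdry" "translates g W" "\<phi> W" using d bdom_iff[OF g] by blast
      have "indicator {\<phi> \<in> bdry. \<phi> W} \<in> C0 (bdom g)"
        using bdom_iff[OF g] W(2) by (intro indicator_cylinder_C0) auto
      then show ?thesis using W by (intro bexI[of _ "indicator {\<phi> \<in> bdry. \<phi> W}"]) (auto simp: indicator_def)
    qed
    fix \<phi> U F
    assume \<phi>: "\<phi> \<in> bdry" "open U" "\<phi> \<in> U" and F: "finite F" "F \<subseteq> carrier G - {\<one>}"
    obtain Z where Z: "Z \<in> J" "Z \<noteq> {}" "\<And>\<psi>. \<psi> \<in> spec \<Longrightarrow> \<psi> Z \<Longrightarrow> \<psi> \<in> U"
      using tight_neighbourhood[OF _ _ \<phi>(2,3)] \<phi>(1) boundary_iff by blast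
    obtain X where X: "X \<in> J" "X \<noteq> {}" "X \<subseteq> Z"
      "\<forall>g\<in>F. \<forall>\<phi>\<in>bdom g. \<phi> X \<longrightarrow> \<not> bact g \<phi> X"
      using moved_cylinder_finite[OF free F Z(1,2)] by (elim bexE conjE) (rule that)
    \<comment> \<open>The cylinder of \<open>X\<close> need not be the image of a semigroup element.
      Shrinking it to the cylinder of \<open>p \<cdot> P\<close> makes it one, with \<open>p\<close>
      as the total map that the criterion asks for.\<close>
    obtain p where pX: "p \<in> X" using X(2) by blast
    then have p: "p \<in> P" using J_sub[OF X(1)] by blast
    have sub: "p \<cdot> P \<subseteq> X" by (rule J_principal_sub[OF X(1) pX])
    have D: "\<psi> \<in> spec \<and> \<psi> X" if "\<psi> \<in> bdom (inv p)" for \<psi>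
      using that specD(3)[OF bdry_spec _ X(1) sub] bdry_spec unfolding bdom_inv_P[OF p] by blast
    have "bdom (inv p) \<subseteq> U" using D Z(3) specD(3)[OF _ _ Z(1) X(3)] by blast
    moreover have "indicator (bdom (inv p)) \<in> C0 (bdom (inv p))"
      unfolding bdom_inv_P[OF p] by (rule indicator_cylinder_C0) auto
    moreover have "\<forall>g\<in>F. \<forall>\<psi>\<in>bdom g. \<psi> \<in> bdom (inv p) \<longrightarrow> bact g \<psi> \<notin> bdom (inv p)"
      using X(4) D by blast
    ultimately show "\<exists>p\<in>carrier G. bdom p = bdry \<and>
        indicator (bdom (inv p)) \<in> C0 (bdom (inv p)) \<and> bdom (inv p) \<subseteq> U \<and>
        (\<forall>g\<in>F. \<forall>z\<in>bdom g. z \<in> bdom (inv p) \<longrightarrow> bact g z \<notin> bdom (inv p))"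
      using bdom_P[OF p] P_carrier[OF p] by blast
  qed
qed

end

theorem corollary3p22:
  fixes G :: "('g, 'm) monoid_scheme" and P :: "'g set"
  assumes "group G" and "countable (carrier G)" and "subsemigroup P G"
    and "topologically_free G (core_subgroup G P) (boundary_dom G P) (spectrum_act G P)"
  shows "simple_Cstar_algebra (boundary_quotient G P)"
proof -
  interpret group_subsemigroup G P
    using assms(1,3) by (simp add: group_subsemigroup_def group_subsemigroup_axioms_def)
  show ?thesis using assms(4) by (rule boundary_quotient_simple)
qed

end
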